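(* Let $0\le\mu<d$ be integers and let $\Delta$ be any rectilinear partition of a domain $\Psi\subset\mathbb{R}^2$. Let $c$ be the number of cross-cuts of $\Delta$, let $A_1,\dots,A_V$ be the interior vertices of $\Delta$, let $N_i$ be the number of distinct edge directions at $A_i$, and let $M(TE(\Delta))$ be the conformality matrix of the TE-connected component of $\Delta$. Then $$\dim S_d^{\mu}(\Delta)=\binom{d+2}{2}+c\binom{d-\mu+1}{2}+\sum_{i=1}^{V}k_d^{\mu}(N_i)-\operatorname{rank}\bigl(M(TE(\Delta))\bigr),$$ where $$k_d^{\mu}(N)=\sum_{j=1}^{d-\mu}\bigl(N(d-\mu-j+1)-(d-j+2)\bigr)_+,\qquad u_+=\max\{0,u\}.$$
   Context: A rectilinear partition $\Delta$ of a domain $\Psi\subset\mathbb{R}^2$ is a partition of $\Psi$ into polygonal cells formed by a finite set of straight line segments (for example triangulations, quadrangulations, quasi-cross-cut partitions; cells need not be triangles). Cells, edges and vertices are defined in the usual way: an edge is a segment between two adjacent vertices. A vertex is interior if it lies in the interior of $\Psi$; an edge is interior if it is not contained in $\partial\Psi$. An interior $l$-edge is a maximal straight segment (one that cannot be extended further) composed of collinear interior edges. It is a cross-cut if both endpoints lie on $\partial\Psi$, a ray if exactly one endpoint lies on $\partial\Psi$, and a truncated $l$-edge if neither endpoint lies on $\partial\Psi$. $TE(\Delta)$ (the TE-connected component) is the set of all truncated $l$-edges. $\mathbb{P}_k$ is the space of real bivariate polynomials of total degree at most $k$. The spline space is $S_d^\mu(\Delta)=\{f\in C^\mu(\Psi):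 f|_\psi\in\mathbb{P}_d\text{ for every cell }\psi\}$. The number $N_i$ of distinct edge directions at an interior vertex $A_i$ is the number of distinct lines containing the edges incident to $A_i$ (two opposite collinear edges count once); equivalently, the number of $l$-edges containing $A_i$. Conformality matrix. For every $l$-edge $l$ fix a linear polynomial $L_l$ whose zero set is the line containing $l$. For an interior vertex $A$ let $$W[A]=\Bigl\{(p_l^{(A)})_{l\ni A}: p_l^{(A)}\in\mathbb{P}_{d-\mu-1},\ \sum_{l\ni A}p_l^{(A)}L_l^{\mu+1}\equiv0\Bigr\},$$ where $l$ ranges over the $l$-edges containing $A$. The global conformality condition along a truncated $l$-edge $l$ with vertices $B_1,\dots,B_r$ (all vertices of $\Delta$ on $l$, endpoints included) is $\sum_{i=1}^r p_l^{(B_i)}\equiv0$. The conformality matrix $M(TE(\Delta))$ is the coefficient matrix of the homogeneous linear system consisting of these conditions for all truncated $l$-edges, the unknowns being free parameters (coordinates with respect to chosen bases) of the spaces $W[A_i]$, $i=1,\dots,V$. That is, it is a matrix of the linear map $$\bigoplus_{i=1}^V W[A_i]\to\bigoplus_{l\in TE(\Delta)}\mathbb{P}_{d-\mu-1},\qquad (p_l^{(A)})\mapsto\Bigl(\sum_{A\in l}p_l^{(A)}\Bigr)_{l\in TE(\Delta)};$$ its rank does not depend on the choice of bases.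
   Formalization: The domain is assumed simply connected (the formula fails, e.g., for a square with a square hole cut along its axis), and an l-edge is taken to end wherever it meets the boundary, so a line touching a reflex corner gives two l-edges. *)

theory Defs
  imports
    "HOL-Analysis.Analysis"
    "HOL-Library.Function_Algebras"
    "Jordan_Normal_Form.DL_Rank"
begin

type_synonym point = "real \<times> real"

section \<open>Rectilinear partitions\<close>

text \<open>
  An edge is represented by the set of its two end points; the segment itself is the convex hull
  of that set. A partition formed by finitely many straight segments is given by the edges into
  which its vertices cut these segments, so an edge ends at every vertex lying on it, and a
  T-junction or a hanging vertex splits the segment passing through it. The edges contained in the
  frontier of \<open>\<Psi>\<close> make up the whole frontier, so every cell is a bounded region whose boundary
  consists of edges. The domain \<open>\<Psi>\<close> is an open set; that it is simply connected is not part of this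
  definition.
\<close>

definition rectilinear_partition :: "point set \<Rightarrow> point set set \<Rightarrow> bool" where
  "rectilinear_partition \<Psi> \<Delta> \<longleftrightarrow>
     open \<Psi> \<and> connected \<Psi> \<and> bounded \<Psi> \<and> \<Psi> \<noteq> {} \<and>
     finite \<Delta> \<and>
     (\<forall>e\<in>\<Delta>. card e = 2 \<and> convex hull e \<subseteq> closure \<Psi>) \<and>
     (\<forall>e\<in>\<Delta>. \<forall>f\<in>\<Delta>. e \<noteq> f \<longrightarrow> convex hull e \<inter> convex hull f = e \<inter> f) \<and>
     frontier \<Psi> \<subseteq> \<Union>{convex hull e |e. e \<in> \<Delta> \<and> convex hull e \<subseteq> frontier \<Psi>}"

definition cells :: "point set \<Rightarrow> point set set \<Rightarrow> point set set" where
  "cells \<Psi> \<Delta> = components (\<Psi> - \<Union>{convex hull e |e. e \<in> \<Delta>})"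

definition interior_vertices :: "point set \<Rightarrow> point set set \<Rightarrow> point set" where
  "interior_vertices \<Psi> \<Delta> = \<Union>\<Delta> \<inter> interior \<Psi>"

definition interior_edges :: "point set \<Rightarrow> point set set \<Rightarrow> point set set" where
  "interior_edges \<Psi> \<Delta> = {e \<in> \<Delta>. \<not> convex hull e \<subseteq> frontier \<Psi>}"

definition num_directions :: "point set set \<Rightarrow> point \<Rightarrow> nat" where
  "num_directions \<Delta> A = card {affine hull e |e. e \<in> \<Delta> \<and> A \<in> e}"

text \<open>
  An \<open>l\<close>-edge ends as soon as it meets the frontier: at a reflex corner of \<open>\<Psi>\<close> a line can touch the
  frontier and continue in \<open>\<Psi>\<close> on the other side, and then the two parts are different \<open>l\<close>-edges.
\<close>

definition composed_segment :: "point set \<Rightarrow> point set set \<Rightarrow> point \<Rightarrow> point \<Rightarrow> bool" where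
  "composed_segment \<Psi> \<Delta> a b \<longleftrightarrow>
     a \<noteq> b \<and> open_segment a b \<subseteq> \<Psi> \<and>
     (\<exists>F \<subseteq> interior_edges \<Psi> \<Delta>. closed_segment a b = \<Union>((hull) convex ` F))"

definition l_edge :: "point set \<Rightarrow> point set set \<Rightarrow> point \<Rightarrow> point \<Rightarrow> bool" where
  "l_edge \<Psi> \<Delta> a b \<longleftrightarrow>
     composed_segment \<Psi> \<Delta> a b \<and>
     (\<forall>a' b'. composed_segment \<Psi> \<Delta> a' b' \<and> closed_segment a b \<subseteq> closed_segment a' b'
        \<longrightarrow> closed_segment a' b' = closed_segment a b)"

definition l_edges :: "point set \<Rightarrow> point set set \<Rightarrow> point set set" where
  "l_edges \<Psi> \<Delta> = {closed_segment a b |a b. l_edge \<Psi> \<Delta> a b}"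

definition cross_cuts :: "point set \<Rightarrow> point set set \<Rightarrow> point set set" where
  "cross_cuts \<Psi> \<Delta> =
     {closed_segment a b |a b. l_edge \<Psi> \<Delta> a b \<and> a \<in> frontier \<Psi> \<and> b \<in> frontier \<Psi>}"

definition truncated_l_edges :: "point set \<Rightarrow> point set set \<Rightarrow> point set set" where
  "truncated_l_edges \<Psi> \<Delta> =
     {closed_segment a b |a b. l_edge \<Psi> \<Delta> a b \<and> a \<notin> frontier \<Psi> \<and> b \<notin> frontier \<Psi>}"

section \<open>Bivariate polynomials and splines\<close>

text \<open>
  In \<open>p :: real poly poly\<close> the outer variable is \<open>y\<close> and the inner one is \<open>x\<close>: the coefficient of
  \<open>x\<^sup>i y\<^sup>j\<close> is \<open>coeff (coeff p j) i\<close>.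
\<close>

definition poly2 :: "real poly poly \<Rightarrow> point \<Rightarrow> real" where
  "poly2 p z = poly (poly p [:snd z:]) (fst z)"

definition polys :: "nat \<Rightarrow> real poly poly set" where
  "polys k = {p. \<forall>i j. coeff (coeff p j) i \<noteq> 0 \<longrightarrow> i + j \<le> k}"

text \<open>Continuous differentiability on an open set, by recursion on the order: all directional
  derivatives must be one order less smooth.\<close>

fun C_on :: "nat \<Rightarrow> point set \<Rightarrow> (point \<Rightarrow> real) \<Rightarrow> bool" where
  "C_on 0 S f \<longleftrightarrow> continuous_on S f"
| "C_on (Suc k) S f \<longleftrightarrow>
     (\<exists>f'. (\<forall>z\<in>S. (f has_derivative f' z) (at z)) \<and> (\<forall>h. C_on k S (\<lambda>z. f' z h)))"

text \<open>Functions on \<open>\<Psi>\<close> are represented by functions on the plane that vanish outside \<open>\<Psi>\<close>.\<close>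

definition spline_space :: "nat \<Rightarrow> nat \<Rightarrow> point set \<Rightarrow> point set set \<Rightarrow> (point \<Rightarrow> real) set" where
  "spline_space d \<mu> \<Psi> \<Delta> =
     {f. (\<forall>z. z \<notin> \<Psi> \<longrightarrow> f z = 0) \<and> C_on \<mu> \<Psi> f \<and>
         (\<forall>\<psi>\<in>cells \<Psi> \<Delta>. \<exists>p\<in>polys d. \<forall>z\<in>\<psi>. f z = poly2 p z)}"

global_interpretation funs: vector_space "\<lambda>(c::real) (f :: point \<Rightarrow> real). (\<lambda>z. c * f z)"
  by unfold_locales (auto simp: fun_eq_iff algebra_simps)

section \<open>The conformality matrix\<close>

text \<open>A family of polynomials indexed by the \<open>l\<close>-edges through a vertex is represented by a function
  on all point sets that vanishes at all other indices.\<close>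

type_synonym poly_family = "point set \<Rightarrow> real poly poly"

global_interpretation families: vector_space
  "\<lambda>(c::real) (w :: poly_family). (\<lambda>l. Polynomial.smult [:c:] (w l))"
  by unfold_locales (auto simp: fun_eq_iff smult_add_right mult.commute
      simp flip: one_pCons smult_add_left)

definition conformality_space ::
  "nat \<Rightarrow> nat \<Rightarrow> point set \<Rightarrow> point set set \<Rightarrow> poly_family \<Rightarrow> point \<Rightarrow> poly_family set" where
  "conformality_space d \<mu> \<Psi> \<Delta> L A =
     {w. (\<forall>l. w l \<in> polys (d - \<mu> - 1)) \<and>
         (\<forall>l. \<not> (l \<in> l_edges \<Psi> \<Delta> \<and> A \<in> l) \<longrightarrow> w l = 0) \<and>
         (\<Sum>l | l \<in> l_edges \<Psi> \<Delta> \<and> A \<in> l. w l * L l ^ (\<mu> + 1)) = 0}"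

definition line_polys :: "point set \<Rightarrow> point set set \<Rightarrow> poly_family \<Rightarrow> bool" where
  "line_polys \<Psi> \<Delta> L \<longleftrightarrow>
     (\<forall>l\<in>l_edges \<Psi> \<Delta>. L l \<in> polys 1 \<and> {z. poly2 (L l) z = 0} = affine hull l)"

text \<open>
  The columns correspond to the unknowns: pairs of an interior vertex \<open>A\<close> and an element of the
  chosen basis \<open>B A\<close> of the conformality space at \<open>A\<close>. The rows correspond to the scalar equations:
  the coefficient of \<open>x\<^sup>i y\<^sup>j\<close> in the global condition along a truncated \<open>l\<close>-edge \<open>l\<close>. The bases and
  the orders of rows and columns are arbitrary.
\<close>

definition conformality_matrix ::
  "nat \<Rightarrow> nat \<Rightarrow> point set \<Rightarrow> point set set \<Rightarrow> poly_family \<Rightarrow> real mat \<Rightarrow> bool" where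
  "conformality_matrix d \<mu> \<Psi> \<Delta> L M \<longleftrightarrow>
     (\<exists>(B :: point \<Rightarrow> poly_family set)
       (eqs :: (point set \<times> nat \<times> nat) list)
       (unknowns :: (point \<times> poly_family) list).
        (\<forall>A\<in>interior_vertices \<Psi> \<Delta>.
           families.independent (B A) \<and>
           families.span (B A) = conformality_space d \<mu> \<Psi> \<Delta> L A) \<and>
        distinct eqs \<and>
        set eqs = truncated_l_edges \<Psi> \<Delta> \<times> {(i, j). i + j \<le> d - \<mu> - 1} \<and>
        distinct unknowns \<and>
        set unknowns = Sigma (interior_vertices \<Psi> \<Delta>) B \<and>
        M = Matrix.mat (length eqs) (length unknowns)
          (\<lambda>(r, s). case eqs ! r of (l, i, j) \<Rightarrow> case unknowns ! s of (A, w) \<Rightarrow>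
             if A \<in> l then coeff (coeff (w l) j) i else 0))"

definition k_dim :: "nat \<Rightarrow> nat \<Rightarrow> nat \<Rightarrow> int" where
  "k_dim d \<mu> N =
     (\<Sum>j=1..d - \<mu>. max 0 (int N * (int d - int \<mu> - int j + 1) - (int d - int j + 2)))"

end

theory Submission
  imports Defs
begin

text \<open>
  A spline is a polynomial plus contributions of the interior edges: across an edge \<open>e\<close> on the line
  \<open>L = 0\<close> it jumps by \<open>q\<^sub>e L\<^sup>\<mu>\<^sup>+\<^sup>1\<close>, and going once around an interior vertex shows that the
  signed sum of these jumps over the edges at the vertex vanishes. Conversely, cofactors \<open>q\<^sub>e\<close>
  satisfying these vertex conditions come from a spline. With \<open>\<theta>\<^sub>e\<close> the imaginary part of
  \<open>log ((z - hi e) / (z - lo e)) / 2\<pi>\<close>, which jumps by one across \<open>e\<close>, consider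
  \<open>p + \<Sum>\<^sub>e q\<^sub>e L\<^sup>\<mu>\<^sup>+\<^sup>1 \<theta>\<^sub>e\<close>. The vertex conditions make the logarithms at the interior vertices
  cancel, and at a boundary vertex one subtracts a branch of the logarithm that exists globally
  because the domain is simply connected. The result is locally a polynomial off the edges.

  Along one \<open>l\<close>-edge the cofactors are determined by their differences at the interior vertices, up
  to a free polynomial for a cross-cut, uniquely for a ray, and for a truncated \<open>l\<close>-edge uniquely
  and only if the differences sum up to zero. So the space of cofactors has the dimension of the
  kernel of the conformality matrix plus the contribution of the cross-cuts.

  The dimension of \<open>W[A]\<close> is computed degree by degree. In coordinates centred at \<open>A\<close> the
  homogeneous part of degree \<open>m\<close> consists of the syzygies of \<open>(s - a\<^sub>i)\<^sup>\<mu>\<^sup>+\<^sup>1\<close> with univariate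
  coefficients of degree at most \<open>m\<close>, and the apolarity pairing shows that these powers generate
  independently as long as the dimensions permit, and everything after that.
\<close>

subsection \<open>Dimensions of subspaces\<close>

text \<open>The obstacle is the construction of a spline from cofactors. Adding up jumps from cell
  to cell would require that every closed chain of cells reduces to loops about interior vertices, a
  statement about the planar arrangement of the cells. The angles \<open>winding\<close> replace it:
  they are given by one formula on all of \<Psi>, and writing each as a difference of the arguments
  of z - hi e and z - lo e collects the jumps at every end point into one sum, which is zero at an
  interior vertex by the very condition that defines W[A]. Simple connectedness enters through the
  logarithms of z - v for frontier vertices v: around a hole the jumps would have to cancel too, a
  condition that no interior vertex expresses. The planar topology that remains is that \<Psi>
  without its finitely many vertices is connected, so a piecewise polynomial without jumps is a
  single polynomial. The summand j of k belongs to the homogeneous degree m = d - \<mu> - j at a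
  vertex with N directions: N (m + 1) unknown coefficients face m + \<mu> + 2 equations.\<close>

lemma vector_space_fun:
  assumes "vector_space s"
  shows "vector_space (\<lambda>c w i. s c (w i))"
proof -
  interpret vector_space s by fact
  show ?thesis
    by unfold_locales (auto simp: fun_eq_iff scale_right_distrib scale_left_distrib)
qed

text \<open>The ambient spaces are infinite-dimensional, and \<open>dim\<close> is a cardinality
  that is 0 for infinite bases, so finiteness of a subspace is carried separately. Containment in
  the span, rather than equality, passes to subsets.\<close>

definition fin_dim :: "('a::field \<Rightarrow> 'b::ab_group_add \<Rightarrow> 'b) \<Rightarrow> 'b set \<Rightarrow> bool" where
  "fin_dim s S \<longleftrightarrow> (\<exists>B. finite B \<and> S \<subseteq> Modules.module.span s B)"

lemma fin_dim_subset: "fin_dim s T \<Longrightarrow> S \<subseteq> T \<Longrightarrow> fin_dim s S"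
  unfolding fin_dim_def by blast

locale vec_sp = V: vector_space scale
  for scale :: "'a::field \<Rightarrow> 'b::ab_group_add \<Rightarrow> 'b"
begin

lemma fin_dim_independent: "fin_dim scale S \<Longrightarrow> V.independent B \<Longrightarrow> B \<subseteq> S \<Longrightarrow> finite B"
  unfolding fin_dim_def using V.independent_span_bound by (meson order_trans)

lemma dim_eq_imp_eq:
  assumes "V.subspace S" "V.subspace T" "S \<subseteq> T" "fin_dim scale T" "V.dim S = V.dim T"
  shows "S = T"
proof -
  obtain B where B: "B \<subseteq> S" "V.independent B" "S \<subseteq> V.span B" "card B = V.dim S"
    using V.basis_exists by blast
  obtain C where C: "B \<subseteq> C" "C \<subseteq> T" "V.independent C" "T \<subseteq> V.span C"
    using V.maximal_independent_subset_extend[of B T] B assms(3) by blast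
  have "finite C" using fin_dim_independent assms(4) C by blast
  have "card C = V.dim T" using C by (simp add: V.basis_card_eq_dim)
  hence "B = C" using card_subset_eq[OF \<open>finite C\<close> C(1)] B(4) assms(5) by simp
  thus ?thesis using C B V.span_minimal[OF B(1) assms(1)] assms(3) by blast
qed

end

context vector_space_pair
begin

lemma dim_image_inj:
  assumes "Vector_Spaces.linear s1 s2 f" "vs1.subspace S" "inj_on f S"
  shows "vs2.dim (f ` S) = vs1.dim S"
proof -
  obtain B where B: "B \<subseteq> S" "vs1.independent B" "S \<subseteq> vs1.span B" "card B = vs1.dim S"
    using vs1.basis_exists by blast
  have sp: "vs1.span B = S"
    using B vs1.span_minimal[OF B(1) assms(2)] by blast
  have "vs2.independent (f ` B)"
    using assms B sp by (intro linear_independent_injective_image) auto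
  moreover have "vs2.span (f ` B) = f ` S"
    using linear_span_image[OF assms(1)] sp by simp
  moreover have "card (f ` B) = card B"
    using assms(3) B(1) by (meson card_image inj_on_subset)
  ultimately show ?thesis
    using B(4) vs2.dim_eq_card_independent[of "f ` B"] vs2.dim_span[of "f ` B"] by simp
qed

lemma fin_dim_image:
  assumes "Vector_Spaces.linear s1 s2 f" "fin_dim s1 S"
  shows "fin_dim s2 (f ` S)"
proof -
  obtain B where "finite B" "S \<subseteq> vs1.span B"
    using assms(2) unfolding fin_dim_def by blast
  hence "finite (f ` B)" "f ` S \<subseteq> vs2.span (f ` B)"
    using linear_span_image[OF assms(1)] by auto
  thus ?thesis unfolding fin_dim_def by blast
qed

lemma rank_nullity:
  assumes f: "Vector_Spaces.linear s1 s2 f" and S: "vs1.subspace S" and fd: "fin_dim s1 S"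
  shows "vs1.dim S = vs2.dim (f ` S) + vs1.dim {x \<in> S. f x = 0}"
proof -
  let ?K = "{x \<in> S. f x = 0}"
  have K: "vs1.subspace ?K"
    using S linear_subspace_kernel[OF f] vs1.subspace_inter[of S "{x. f x = 0}"]
    by (simp add: Int_def)
  obtain A where A: "A \<subseteq> ?K" "vs1.independent A" "?K \<subseteq> vs1.span A" "card A = vs1.dim ?K"
    using vs1.basis_exists by blast
  obtain B where B: "A \<subseteq> B" "B \<subseteq> S" "vs1.independent B" "S \<subseteq> vs1.span B"
    using vs1.maximal_independent_subset_extend[of A S] A by blast
  have fB: "finite B" using vec_sp.fin_dim_independent[OF _ fd B(3,2)] vs1.vector_space_axioms unfolding vec_sp_def .
  have spB: "vs1.span B = S" using vs1.span_minimal[OF B(2) S] B(4) by blast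
  have spA: "vs1.span A = ?K" using vs1.span_minimal[OF A(1) K] A(3) by blast
  define C where "C = B - A"
  have C: "C \<subseteq> B" "vs1.independent C" using B(3) vs1.independent_mono C_def by blast+
  have inj: "inj_on f (vs1.span C)"
  proof (rule inj_onI)
    fix x y assume xy: "x \<in> vs1.span C" "y \<in> vs1.span C" "f x = f y"
    define z where "z = x - y"
    have zC: "z \<in> vs1.span C" using xy vs1.span_diff z_def by blast
    have "f z = 0" unfolding z_def using xy linear_diff[OF f] by simp
    hence zA: "z \<in> vs1.span A"
      using spA spB zC vs1.span_mono[OF C(1)] by auto
    have "vs1.representation B z = vs1.representation C z"
      using vs1.representation_extend[OF B(3) zC C(1)] .
    moreover have "vs1.representation B z = vs1.representation A z"
      using vs1.representation_extend[OF B(3) zA B(1)] .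
    ultimately have "vs1.representation B z b = 0" for b
      using vs1.representation_ne_zero[of C z b] vs1.representation_ne_zero[of A z b] C_def by auto
    moreover have "z \<in> vs1.span B" using zA vs1.span_mono[OF B(1)] by auto
    ultimately have "z = 0"
      using vs1.sum_nonzero_representation_eq[OF B(3), of z] by simp
    thus "x = y" using z_def by simp
  qed
  have "f ` S = vs2.span (f ` B)" using linear_span_image[OF f] spB by simp
  also have "f ` B = f ` A \<union> f ` C" using C_def B(1) by auto
  also have "vs2.span (f ` A \<union> f ` C) = vs2.span (f ` C)"
  proof
    have "f ` A \<union> f ` C \<subseteq> vs2.span (f ` C)"
      using A(1) vs2.span_zero vs2.span_superset by fastforce
    thus "vs2.span (f ` A \<union> f ` C) \<subseteq> vs2.span (f ` C)" by (simp add: vs2.span_minimal)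
  qed (simp add: vs2.span_mono)
  also have "\<dots> = f ` vs1.span C" using linear_span_image[OF f] by simp
  finally have "vs2.dim (f ` S) = vs1.dim (vs1.span C)"
    using dim_image_inj[OF f _ inj] by simp
  also have "\<dots> = card C" using C(2) by (simp add: vs1.dim_eq_card_independent)
  finally have "vs2.dim (f ` S) = card C" .
  moreover have "card B = card A + card C"
    unfolding C_def using B(1) fB by (metis card_Diff_subset card_mono finite_subset le_add_diff_inverse)
  moreover have "card B = vs1.dim S" using B by (simp add: vs1.basis_card_eq_dim)
  ultimately show ?thesis using A(4) by simp
qed

end

context vec_sp
begin

text \<open>Induction on the index set: evaluation at the new index maps the larger sum onto the new
  summand, with the smaller sum as its kernel.\<close>

lemma dim_direct_sum:
  fixes V :: "'i \<Rightarrow> 'b set"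
  assumes "finite I" "\<And>i. i \<in> I \<Longrightarrow> V.subspace (V i)" "\<And>i. i \<in> I \<Longrightarrow> fin_dim scale (V i)"
  shows "vector_space.dim (\<lambda>c w i. scale c (w i)) {w. (\<forall>i\<in>I. w i \<in> V i) \<and> (\<forall>i. i \<notin> I \<longrightarrow> w i = 0)}
           = (\<Sum>i\<in>I. V.dim (V i))"
    and "fin_dim (\<lambda>c w i. scale c (w i)) {w. (\<forall>i\<in>I. w i \<in> V i) \<and> (\<forall>i. i \<notin> I \<longrightarrow> w i = 0)}"
proof -
  interpret fs: vector_space "\<lambda>c (w :: 'i \<Rightarrow> 'b) i. scale c (w i)"
    by (rule vector_space_fun) unfold_locales
  interpret p: vector_space_pair "\<lambda>c (w :: 'i \<Rightarrow> 'b) i. scale c (w i)" scale ..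
  interpret q: vector_space_pair scale "\<lambda>c (w :: 'i \<Rightarrow> 'b) i. scale c (w i)" ..
  define D where "D I = {w. (\<forall>i\<in>I. w i \<in> V i) \<and> (\<forall>i. i \<notin> I \<longrightarrow> w i = 0)}" for I
  have "fs.dim (D I) = (\<Sum>i\<in>I. V.dim (V i)) \<and> fin_dim (\<lambda>c w i. scale c (w i)) (D I)"
    using assms
  proof (induction I rule: finite_induct)
    case empty
    have "D {} = {0}" unfolding D_def by (auto simp: fun_eq_iff)
    thus ?case unfolding fin_dim_def
      by (metis (no_types, lifting) ext finite.emptyI fs.dim_span fs.dim_eq_card_independent
          fs.independent_empty fs.span_empty order_refl sum.empty card.empty)
  next
    case (insert a I)
    have IH: "fs.dim (D I) = (\<Sum>i\<in>I. V.dim (V i))" "fin_dim (\<lambda>c w i. scale c (w i)) (D I)" using insert by auto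
    have sub: "fs.subspace (D (insert a I))"
      unfolding D_def fs.subspace_def using insert.prems(1)
      by (auto simp: V.subspace_0 V.subspace_add V.subspace_scale)
    have lin: "Vector_Spaces.linear (\<lambda>c w i. scale c (w i)) scale (\<lambda>w. w a)"
      unfolding Vector_Spaces.linear_def Modules.module_hom_def Modules.module_hom_axioms_def
      using fs.module_axioms V.module_axioms fs.vector_space_axioms V.vector_space_axioms by auto
    define g where "g v = (\<lambda>i. if i = a then v else 0)" for v :: 'b
    have ling: "Vector_Spaces.linear scale (\<lambda>c w i. scale c (w i)) g"
      unfolding Vector_Spaces.linear_def Modules.module_hom_def Modules.module_hom_axioms_def g_def
      using fs.module_axioms V.module_axioms fs.vector_space_axioms V.vector_space_axioms by (auto simp: fun_eq_iff)
    have fdg: "fin_dim (\<lambda>c w i. scale c (w i)) (g ` V a)" using q.fin_dim_image[OF ling] insert.prems by blast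
    \<comment> \<open>Rank-nullity requires finiteness beforehand; it follows from splitting
      \<open>w\<close> into its value at \<open>a\<close> and the rest.\<close>
    have fd: "fin_dim (\<lambda>c w i. scale c (w i)) (D (insert a I))"
    proof -
      obtain A where A: "finite A" "g ` V a \<subseteq> fs.span A" using fdg fin_dim_def by blast
      obtain B where B: "finite B" "D I \<subseteq> fs.span B" using IH fin_dim_def by blast
      have "w \<in> fs.span (A \<union> B)" if w: "w \<in> D (insert a I)" for w
      proof -
        have "g (w a) \<in> fs.span A" using A w unfolding D_def by auto
        moreover have "w(a := 0) \<in> D I" using w insert.hyps unfolding D_def by auto
        hence "w(a := 0) \<in> fs.span B" using B by auto
        ultimately have "g (w a) + w(a := 0) \<in> fs.span (A \<union> B)"
          using fs.span_mono[of A "A \<union> B"] fs.span_mono[of B "A \<union> B"] by (intro fs.span_add) auto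
        moreover have "g (w a) + w(a := 0) = w" unfolding g_def by (auto simp: fun_eq_iff)
        ultimately show ?thesis by simp
      qed
      thus ?thesis unfolding fin_dim_def using A(1) B(1) by (meson finite_UnI subsetI)
    qed
    have "(\<lambda>w. w a) ` D (insert a I) = V a"
    proof
      show "V a \<subseteq> (\<lambda>w. w a) ` D (insert a I)"
      proof
        fix v assume "v \<in> V a"
        hence "g v \<in> D (insert a I)" "g v a = v" unfolding D_def g_def
          using insert.prems(1) V.subspace_0 by auto
        thus "v \<in> (\<lambda>w. w a) ` D (insert a I)" by (metis (no_types, lifting) image_eqI)
      qed
    qed (auto simp: D_def)
    moreover have "{w \<in> D (insert a I). w a = 0} = D I"
    proof (intro equalityI subsetI)
      fix w assume "w \<in> {w \<in> D (insert a I). w a = 0}"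
      hence w: "\<And>i. i \<in> I \<Longrightarrow> w i \<in> V i" "\<And>i. i \<notin> insert a I \<Longrightarrow> w i = 0" "w a = 0"
        unfolding D_def by auto
      have "w i = 0" if "i \<notin> I" for i using w(2,3) that by (cases "i = a") auto
      thus "w \<in> D I" unfolding D_def using w(1) by simp
    next
      fix w assume "w \<in> D I"
      thus "w \<in> {w \<in> D (insert a I). w a = 0}"
        unfolding D_def using insert.hyps insert.prems V.subspace_0[of "V a"] by auto
    qed
    ultimately have "fs.dim (D (insert a I)) = V.dim (V a) + fs.dim (D I)"
      using p.rank_nullity[OF lin sub fd] by simp
    thus ?case using insert.hyps IH fd by simp
  qed
  thus "fs.dim {w. (\<forall>i\<in>I. w i \<in> V i) \<and> (\<forall>i. i \<notin> I \<longrightarrow> w i = 0)} = (\<Sum>i\<in>I. V.dim (V i))"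
    "fin_dim (\<lambda>c w i. scale c (w i)) {w. (\<forall>i\<in>I. w i \<in> V i) \<and> (\<forall>i. i \<notin> I \<longrightarrow> w i = 0)}"
    unfolding D_def by auto
qed

end

text \<open>The rank is defined for vectors of a fixed length. Extending the columns by zero to
  functions on nat makes it comparable with the dimension of the image of a linear map between
  function spaces. The extension preserves linear independence, so a maximal independent set of
  columns becomes a basis of the span.\<close>

lemma rank_eq_dim_cols:
  fixes M :: "real mat"
  shows "vec_space.rank (dim_row M) M =
    vector_space.dim (\<lambda>c (w :: nat \<Rightarrow> real) i. c * w i)
      ((\<lambda>j i. if i < dim_row M then M $$ (i, j) else 0) ` {..<dim_col M})"
proof -
  let ?n = "dim_row M"
  interpret V: vec_space "TYPE(real)" ?n .
  interpret fs: vector_space "\<lambda>c (w :: nat \<Rightarrow> real) i. c * w i"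
    by unfold_locales (auto simp: fun_eq_iff algebra_simps)
  define \<iota> where "\<iota> v = (\<lambda>i. if i < ?n then v $ i else (0::real))" for v
  let ?T = "set (cols M)"
  have T: "?T \<subseteq> carrier_vec ?n" using cols_dim by blast
  have inj: "inj_on \<iota> (carrier_vec ?n)"
  proof (rule inj_onI)
    fix x y assume xy: "x \<in> carrier_vec ?n" "y \<in> carrier_vec ?n" "\<iota> x = \<iota> y"
    have "x $ i = y $ i" if "i < ?n" for i
      using fun_cong[OF xy(3), of i] that by (simp add: \<iota>_def)
    thus "x = y" using xy(1,2) by (intro eq_vecI) auto
  qed
  have indep: "fs.independent (\<iota> ` X) \<longleftrightarrow> V.lin_indpt X" if X: "X \<subseteq> ?T" for X
  proof -
    have fX: "finite X" by (rule finite_subset[OF X]) simp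
    have Xc: "X \<subseteq> carrier_vec ?n" using X T by blast
    have injX: "inj_on \<iota> X" using inj Xc inj_on_subset by blast
    have "fs.dependent (\<iota> ` X) \<longleftrightarrow> (\<exists>u. (\<exists>v\<in>\<iota> ` X. u v \<noteq> 0) \<and> (\<Sum>v\<in>\<iota> ` X. (\<lambda>i. u v * v i)) = 0)"
      by (rule fs.dependent_finite[OF finite_imageI[OF fX]])
    also have "\<dots> \<longleftrightarrow> (\<exists>u. (\<exists>v\<in>X. u v \<noteq> 0) \<and> (\<Sum>v\<in>X. (\<lambda>i. u v * \<iota> v i)) = 0)"
    proof (intro iffI; elim exE)
      fix u assume "(\<exists>v\<in>\<iota> ` X. u v \<noteq> 0) \<and> (\<Sum>v\<in>\<iota> ` X. (\<lambda>i. u v * v i)) = 0"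
      thus "\<exists>u. (\<exists>v\<in>X. u v \<noteq> 0) \<and> (\<Sum>v\<in>X. (\<lambda>i. u v * \<iota> v i)) = 0"
        using injX by (intro exI[of _ "u \<circ> \<iota>"]) (auto simp: sum.reindex)
    next
      fix u assume u: "(\<exists>v\<in>X. u v \<noteq> 0) \<and> (\<Sum>v\<in>X. (\<lambda>i. u v * \<iota> v i)) = 0"
      have "(\<Sum>v\<in>\<iota> ` X. (\<lambda>i. (u \<circ> the_inv_into X \<iota>) v * v i)) = (\<Sum>v\<in>X. (\<lambda>i. u v * \<iota> v i))"
        using injX by (subst sum.reindex) (auto simp: the_inv_into_f_f intro!: sum.cong)
      thus "\<exists>u. (\<exists>v\<in>\<iota> ` X. u v \<noteq> 0) \<and> (\<Sum>v\<in>\<iota> ` X. (\<lambda>i. u v * v i)) = 0"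
        using u injX by (intro exI[of _ "u \<circ> the_inv_into X \<iota>"]) (auto simp: the_inv_into_f_f)
    qed
    also have "\<dots> \<longleftrightarrow> (\<exists>u. (\<exists>v\<in>X. u v \<noteq> 0) \<and> V.lincomb u X = 0\<^sub>v ?n)"
    proof -
      have "(\<Sum>v\<in>X. (\<lambda>i. u v * \<iota> v i)) = 0 \<longleftrightarrow> V.lincomb u X = 0\<^sub>v ?n" for u
      proof -
        have "(\<Sum>v\<in>X. (\<lambda>i. u v * \<iota> v i)) = 0 \<longleftrightarrow> (\<forall>i<?n. (\<Sum>v\<in>X. u v * v $ i) = 0)"
        proof -
          have "(\<Sum>v\<in>X. (\<lambda>i. u v * \<iota> v i)) i = (if i < ?n then (\<Sum>v\<in>X. u v * v $ i) else 0)" for i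
            using fX by (induction X rule: finite_induct) (auto simp: \<iota>_def)
          thus ?thesis by (auto simp: fun_eq_iff)
        qed
        also have "\<dots> \<longleftrightarrow> V.lincomb u X = 0\<^sub>v ?n"
          using V.lincomb_index[OF _ Xc, of _ u] V.lincomb_dim[OF fX Xc, of u]
          by (simp add: vec_eq_iff)
        finally show ?thesis .
      qed
      thus ?thesis by simp
    qed
    also have "\<dots> \<longleftrightarrow> V.lin_dep X"
    proof -
      have "V.lin_dep X" if "(\<exists>v\<in>X. u v \<noteq> 0)" "V.lincomb u X = 0\<^sub>v ?n" for u
        unfolding V.lin_dep_def using that fX by (intro exI[of _ X] exI[of _ u]) auto
      moreover have "\<exists>u. (\<exists>v\<in>X. u v \<noteq> 0) \<and> V.lincomb u X = 0\<^sub>v ?n" if dep: "V.lin_dep X"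
        using V.finite_lin_dep[OF fX dep] Xc by auto
      ultimately show ?thesis by blast
    qed
    finally show ?thesis by blast
  qed
  obtain S where S: "maximal S (\<lambda>T. T \<subseteq> ?T \<and> V.lin_indpt T)"
    using DL_Rank.maximal_exists_superset[of ?T "\<lambda>T. T \<subseteq> ?T \<and> V.lin_indpt T" "{}"]
    by (auto simp: V.lin_dep_def)
  have M: "M \<in> carrier_mat ?n (dim_col M)" by auto
  have "V.rank M = card S" using V.rank_card_indpt[OF M S] .
  have S': "S \<subseteq> ?T" "V.lin_indpt S" using S unfolding maximal_def by auto
  have span: "\<iota> t \<in> fs.span (\<iota> ` S)" if t: "t \<in> ?T" for t
  proof (rule ccontr)
    assume n: "\<iota> t \<notin> fs.span (\<iota> ` S)"
    hence "fs.independent (insert (\<iota> t) (\<iota> ` S))"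
      using fs.independent_insertI indep[OF S'(1)] S'(2) by blast
    hence "V.lin_indpt (insert t S)" using indep[of "insert t S"] S'(1) t by simp
    hence "t \<in> S" using S S' t unfolding maximal_def by blast
    thus False using n fs.span_base[of "\<iota> t" "\<iota> ` S"] by simp
  qed
  have "fs.dim (\<iota> ` ?T) = card (\<iota> ` S)"
  proof (rule fs.dim_unique)
    show "\<iota> ` S \<subseteq> \<iota> ` ?T" using S'(1) by (rule image_mono)
    show "\<iota> ` ?T \<subseteq> fs.span (\<iota> ` S)" using span by (rule image_subsetI)
    show "fs.independent (\<iota> ` S)" using indep[OF S'(1)] S'(2) by simp
  qed (rule refl)
  also have "card (\<iota> ` S) = card S"
    by (intro card_image inj_on_subset[OF inj] order_trans[OF S'(1) T])
  finally have dim: "fs.dim (\<iota> ` ?T) = card S" .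
  have "\<iota> ` ?T = (\<lambda>j i. if i < ?n then M $$ (i, j) else 0) ` {..<dim_col M}"
  proof -
    have "\<iota> (col M j) = (\<lambda>i. if i < ?n then M $$ (i, j) else 0)" if "j < dim_col M" for j
      using that by (auto simp: \<iota>_def fun_eq_iff)
    thus ?thesis unfolding cols_def set_map image_image by (intro image_cong) auto
  qed
  from dim[unfolded this] \<open>V.rank M = card S\<close> show ?thesis by (rule trans[OF _ sym, rotated])
qed

subsection \<open>Bivariate polynomials\<close>

lemma poly2_0 [simp]: "poly2 0 z = 0"
  and poly2_1 [simp]: "poly2 1 z = 1"
  and poly2_add [simp]: "poly2 (p + q) z = poly2 p z + poly2 q z"
  and poly2_diff [simp]: "poly2 (p - q) z = poly2 p z - poly2 q z"
  and poly2_minus [simp]: "poly2 (- p) z = - poly2 p z"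
  and poly2_mult [simp]: "poly2 (p * q) z = poly2 p z * poly2 q z"
  and poly2_smult [simp]: "poly2 (Polynomial.smult c p) z = poly c (fst z) * poly2 p z"
  and poly2_pCons [simp]: "poly2 (pCons c p) z = poly c (fst z) + snd z * poly2 p z"
  by (simp_all add: poly2_def)

lemma poly2_power [simp]: "poly2 (p ^ n) z = poly2 p z ^ n"
  by (induction n) auto

lemma poly2_sum: "poly2 (sum f I) z = (\<Sum>i\<in>I. poly2 (f i) z)"
  by (induction I rule: infinite_finite_induct) auto

lemma poly2_of_nat [simp]: "poly2 (of_nat n) z = of_nat n"
  by (induction n) auto

lemma poly2_conv_poly: "poly2 p (x, y) = poly (map_poly (\<lambda>c. poly c x) p) y"
  by (induction p) (auto simp: map_poly_pCons)

lemma poly2_graph: "poly (poly p r) x = poly2 p (x, poly r x)"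
  by (induction p) auto

lemma poly_infinite_zeros:
  fixes p :: "'a::idom poly"
  assumes "infinite X" "\<And>x. x \<in> X \<Longrightarrow> poly p x = 0"
  shows "p = 0"
  using assms poly_roots_finite[of p] finite_subset[of X "{x. poly p x = 0}"] by blast

text \<open>Inside an open box, fixing x leaves a polynomial in y with infinitely many roots. Hence
  each coefficient, a polynomial in x, has infinitely many roots as well.\<close>

lemma poly2_zero_on_open:
  assumes "open U" "U \<noteq> {}" "\<And>z. z \<in> U \<Longrightarrow> poly2 p z = 0"
  shows "p = 0"
proof -
  obtain x0 y0 where "(x0, y0) \<in> U" using assms(2) by auto
  then obtain A B where AB: "open A" "open B" "x0 \<in> A" "y0 \<in> B" "A \<times> B \<subseteq> U"
    using open_prod_elim[OF assms(1)] by (metis mem_Sigma_iff)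
  have inf: "infinite A" "infinite B"
    using AB finite_imp_not_open by blast+
  have "poly (coeff p j) x = 0" if "x \<in> A" for x j
  proof -
    have "map_poly (\<lambda>c. poly c x) p = 0"
      by (rule poly_infinite_zeros[OF inf(2)]) (use AB assms(3) that in \<open>auto simp flip: poly2_conv_poly\<close>)
    hence "coeff (map_poly (\<lambda>c. poly c x) p) j = 0" by simp
    thus ?thesis by (simp add: coeff_map_poly)
  qed
  hence "coeff p j = 0" for j by (rule poly_infinite_zeros[OF inf(1)])
  thus ?thesis by (simp add: poly_eq_iff)
qed

lemma poly2_eqI: "(\<And>z. poly2 p z = poly2 q z) \<Longrightarrow> p = q"
  using poly2_zero_on_open[of UNIV "p - q"] by simp

lemma zero_in_polys [simp]: "0 \<in> polys k"
  by (simp add: polys_def)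

lemma polys_add: "p \<in> polys k \<Longrightarrow> q \<in> polys k \<Longrightarrow> p + q \<in> polys k"
  and polys_diff: "p \<in> polys k \<Longrightarrow> q \<in> polys k \<Longrightarrow> p - q \<in> polys k"
  and polys_smult: "p \<in> polys k \<Longrightarrow> Polynomial.smult [:c:] p \<in> polys k"
  and polys_mono: "p \<in> polys k \<Longrightarrow> k \<le> m \<Longrightarrow> p \<in> polys m"
  unfolding polys_def by (simp; metis add.right_neutral diff_zero le_trans minus_zero)+

lemma polys_sum: "(\<And>i. i \<in> I \<Longrightarrow> f i \<in> polys k) \<Longrightarrow> sum f I \<in> polys k"
  by (induction I rule: infinite_finite_induct) (auto intro: polys_add)

lemma polys_mult:
  assumes "p \<in> polys a" "q \<in> polys b"
  shows "p * q \<in> polys (a + b)"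
  unfolding polys_def
proof (intro CollectI allI impI)
  fix i j assume nz: "coeff (coeff (p * q) j) i \<noteq> 0"
  show "i + j \<le> a + b"
  proof (rule ccontr)
    assume *: "\<not> i + j \<le> a + b"
    have "coeff (coeff p s) t * coeff (coeff q (j - s)) (i - t) = 0" if "s \<le> j" "t \<le> i" for s t
    proof (cases "t + s \<le> a")
      case True
      hence "\<not> (i - t) + (j - s) \<le> b" using * that by linarith
      thus ?thesis using assms(2) unfolding polys_def by auto
    next
      case False
      thus ?thesis using assms(1) unfolding polys_def by auto
    qed
    hence "coeff (coeff (p * q) j) i = 0"
      unfolding coeff_mult coeff_sum by (intro sum.neutral ballI) simp
    thus False using nz by simp
  qed
qed

lemma polys_one [simp]: "1 \<in> polys k"
  by (auto simp: polys_def one_pCons coeff_pCons split: nat.splits)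

lemma polys_power: "p \<in> polys a \<Longrightarrow> p ^ n \<in> polys (n * a)"
  by (induction n) (auto dest: polys_mult)

subsection \<open>Directional derivatives\<close>

text \<open>Here \<open>map_poly pderiv\<close> differentiates with respect to the inner variable x
  and \<open>pderiv\<close> with respect to the outer variable y.\<close>

definition dirp :: "point \<Rightarrow> real poly poly \<Rightarrow> real poly poly" where
  "dirp h p = Polynomial.smult [:fst h:] (map_poly pderiv p) + Polynomial.smult [:snd h:] (pderiv p)"

lemma dirp_0 [simp]: "dirp h 0 = 0"
  by (simp add: dirp_def)

lemma dirp_pCons: "dirp h (pCons c p) = [:Polynomial.smult (fst h) (pderiv c):] + Polynomial.smult [:snd h:] p + pCons 0 (dirp h p)"
  by (simp add: dirp_def map_poly_pCons pderiv_pCons smult_add_right)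

lemma has_derivative_poly2 [derivative_intros]:
  "(poly2 p has_derivative (\<lambda>h. poly2 (dirp h p) z)) (at z within S)"
proof (induction p)
  case 0
  then show ?case by (simp add: poly2_0[abs_def])
next
  case (pCons c p)
  have c: "((\<lambda>z. poly c (fst z)) has_derivative (\<lambda>h. poly (pderiv c) (fst z) * fst h)) (at z within S)"
    by (rule has_derivative_compose[OF has_derivative_fst[OF has_derivative_ident]])
      (use poly_DERIV[of c "fst z"] in \<open>simp add: has_field_derivative_def\<close>)
  have "((\<lambda>z. poly c (fst z) + snd z * poly2 p z) has_derivative
      (\<lambda>h. poly (pderiv c) (fst z) * fst h + (snd z * poly2 (dirp h p) z + snd h * poly2 p z))) (at z within S)"
    by (rule has_derivative_add[OF c has_derivative_mult[OF has_derivative_snd[OF has_derivative_ident] pCons.IH]])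
  thus ?case by (simp add: poly2_pCons[abs_def] dirp_pCons algebra_simps)
qed

text \<open>Uniqueness of the derivative carries the sum and product rules of analysis over to the
  formal operation \<open>dirp\<close>.\<close>

lemma poly2_derivative_eq:
  assumes "(poly2 p has_derivative f') (at z)"
  shows "f' h = poly2 (dirp h p) z"
  using has_derivative_unique[OF assms has_derivative_poly2] by simp

lemma dirp_add: "dirp h (p + q) = dirp h p + dirp h q"
proof (rule poly2_eqI, rule poly2_derivative_eq[symmetric])
  fix z
  show "(poly2 (p + q) has_derivative (\<lambda>h. poly2 (dirp h p + dirp h q) z)) (at z)"
    using has_derivative_add[OF has_derivative_poly2[of p z UNIV] has_derivative_poly2[of q z UNIV]]
    by (simp add: poly2_add[abs_def])
qed

lemma dirp_diff: "dirp h (p - q) = dirp h p - dirp h q"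
  using dirp_add[of h "p - q" q] by simp

lemma dirp_smult: "dirp h (Polynomial.smult [:c:] p) = Polynomial.smult [:c:] (dirp h p)"
proof (rule poly2_eqI, rule poly2_derivative_eq[symmetric])
  fix z
  show "(poly2 (Polynomial.smult [:c:] p) has_derivative (\<lambda>h. poly2 (Polynomial.smult [:c:] (dirp h p)) z)) (at z)"
    using has_derivative_mult_right[OF has_derivative_poly2[of p z UNIV], of c]
    by (simp add: poly2_smult[abs_def])
qed

lemma dirp_sum: "dirp h (sum f I) = (\<Sum>i\<in>I. dirp h (f i))"
  by (induction I rule: infinite_finite_induct) (auto simp: dirp_add)

lemma dirp_mult: "dirp h (p * q) = p * dirp h q + dirp h p * q"
proof (rule poly2_eqI, rule poly2_derivative_eq[symmetric])
  fix z
  show "(poly2 (p * q) has_derivative (\<lambda>h. poly2 (p * dirp h q + dirp h p * q) z)) (at z)"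
    using has_derivative_mult[OF has_derivative_poly2[of p z UNIV] has_derivative_poly2[of q z UNIV]]
    by (simp add: poly2_mult[abs_def])
qed

lemma dirp_power: "dirp h (p ^ Suc n) = of_nat (Suc n) * p ^ n * dirp h p"
  by (induction n) (auto simp: dirp_mult algebra_simps)

subsection \<open>Divisibility by powers of linear forms\<close>

lemma polys_1D:
  assumes "L \<in> polys 1"
  obtains a b c where "L = [:[:a, b:], [:c:]:]"
proof -
  have "coeff (coeff L j) i = coeff (coeff [:[:coeff (coeff L 0) 0, coeff (coeff L 0) 1:], [:coeff (coeff L 1) 0:]:] j) i"
    for i j
  proof (cases "i + j \<le> 1")
    case True
    hence "i = 0 \<and> j = 0 \<or> i = 1 \<and> j = 0 \<or> i = 0 \<and> j = 1" by auto
    thus ?thesis by auto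
  next
    case False
    hence "coeff (coeff L j) i = 0" using assms unfolding polys_def by auto
    thus ?thesis using False by (auto simp: coeff_pCons split: nat.splits)
  qed
  hence "L = [:[:coeff (coeff L 0) 0, coeff (coeff L 0) 1:], [:coeff (coeff L 1) 0:]:]"
    by (intro poly_eqI)
  thus ?thesis using that by blast
qed

text \<open>If c is nonzero, the line is a graph y = r(x); substitution into \<open>D\<close> gives
  a univariate polynomial with infinitely many roots, so y - r divides \<open>D\<close>. A vertical
  line is treated coefficient by coefficient.\<close>

lemma linear_dvd_if_zeros:
  assumes L: "L = [:[:a, b:], [:c:]:]" "b \<noteq> 0 \<or> c \<noteq> 0"
    and S: "infinite S" "\<And>z. z \<in> S \<Longrightarrow> poly2 L z = 0" "\<And>z. z \<in> S \<Longrightarrow> poly2 D z = 0"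
  shows "L dvd D"
proof (cases "c = 0")
  case False
  define r where "r = [:- a / c, - b / c:]"
  have z: "snd z = poly r (fst z)" if "z \<in> S" for z
    using S(2)[OF that] False unfolding L r_def by (simp add: field_simps)
  have "inj_on fst S" by (rule inj_onI) (use z in \<open>auto simp: prod_eq_iff\<close>)
  hence "infinite (fst ` S)" using S(1) finite_imageD by blast
  moreover have "poly (poly D r) x = 0" if "x \<in> fst ` S" for x
    using that S(3) z by (auto simp: poly2_graph)
  ultimately have "poly D r = 0" by (rule poly_infinite_zeros)
  hence "[:- r, 1:] dvd D" by (simp add: poly_eq_0_iff_dvd)
  then obtain E where E: "D = [:- r, 1:] * E" by (auto elim: dvdE)
  have "D = L * Polynomial.smult [:1 / c:] E"
    using False unfolding E L r_def by (intro poly2_eqI) (simp add: field_simps)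
  thus ?thesis by (simp add: dvd_smult)
next
  case True
  with L have b: "b \<noteq> 0" by simp
  define r where "r = - a / b"
  have z: "fst z = r" if "z \<in> S" for z
    using S(2)[OF that] True b unfolding L r_def by (simp add: field_simps)
  have "inj_on snd S" by (rule inj_onI) (use z in \<open>auto simp: prod_eq_iff\<close>)
  hence "infinite (snd ` S)" using S(1) finite_imageD by blast
  moreover have "poly (map_poly (\<lambda>c. poly c r) D) y = 0" if "y \<in> snd ` S" for y
    using that S(3) z by (auto simp flip: poly2_conv_poly)
  ultimately have "map_poly (\<lambda>c. poly c r) D = 0" by (rule poly_infinite_zeros)
  hence "poly (coeff D j) r = 0" for j
    by (metis coeff_0 coeff_map_poly poly_0)
  hence "[:- r, 1:] dvd coeff D j" for j by (simp add: poly_eq_0_iff_dvd)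
  hence "[:a, b:] dvd coeff D j" for j
  proof -
    have "[:a, b:] = Polynomial.smult b [:- r, 1:]" using b unfolding r_def by simp
    thus ?thesis using \<open>[:- r, 1:] dvd coeff D j\<close> b by (metis smult_dvd)
  qed
  hence "[:[:a, b:]:] dvd D" by (simp add: const_poly_dvd_iff)
  thus ?thesis unfolding L using True by simp
qed

lemma dirp_linear: "dirp (b, c) [:[:a, b:], [:c:]:] = [:[:b\<^sup>2 + c\<^sup>2:]:]"
  by (simp add: dirp_pCons pderiv_pCons power2_eq_square)

text \<open>Write \<open>D = L ^ Suc i * E\<close> and differentiate along the gradient (b, c) of
  \<open>L\<close>. The result is \<open>L ^ i\<close> times a multiple of \<open>L\<close> plus a
  nonzero constant times \<open>E\<close>. Since \<open>L ^ Suc i\<close> divides it for i < k,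
  \<open>L\<close> divides \<open>E\<close>, which raises the multiplicity by one.\<close>

lemma power_dvd_step:
  assumes L: "L = [:[:a, b:], [:c:]:]" "b \<noteq> 0 \<or> c \<noteq> 0"
    and D: "L dvd D" "\<And>h. L ^ k dvd dirp h D"
  shows "L ^ Suc k dvd D"
proof -
  have L0: "L \<noteq> 0" using L by auto
  have "i \<le> k \<Longrightarrow> L ^ Suc i dvd D" for i
  proof (induction i)
    case 0
    then show ?case using D(1) by simp
  next
    case (Suc i)
    then obtain E where E: "D = L ^ Suc i * E" by (auto elim: dvdE)
    define u where "u = b\<^sup>2 + c\<^sup>2"
    have u: "u \<noteq> 0" using L(2) unfolding u_def by (simp add: sum_power2_eq_zero_iff)
    have "dirp (b, c) D = L ^ i * (L * dirp (b, c) E + of_nat (Suc i) * [:[:u:]:] * E)"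
      unfolding E dirp_mult dirp_power using dirp_linear[of b c a] unfolding L(1)[symmetric] u_def
      by (simp add: algebra_simps)
    moreover have "L ^ i * L dvd dirp (b, c) D"
      using D(2)[of "(b, c)"] Suc.prems power_le_dvd[of L k _ "Suc i"] by (simp add: mult.commute)
    ultimately have "L dvd L * dirp (b, c) E + of_nat (Suc i) * [:[:u:]:] * E"
      using L0 by (metis dvd_mult_cancel_left power_not_zero)
    hence "L dvd of_nat (Suc i) * [:[:u:]:] * E"
      by (metis dvd_add_right_iff dvd_triv_left)
    also have "of_nat (Suc i) * [:[:u:]:] * E = Polynomial.smult [:of_nat (Suc i) * u:] E"
      by (rule poly2_eqI) simp
    finally have "L dvd Polynomial.smult [:inverse (of_nat (Suc i) * u):] (Polynomial.smult [:of_nat (Suc i) * u:] E)"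
      by (rule dvd_smult)
    hence "L dvd E" using u by (simp add: field_simps del: of_nat_Suc flip: one_pCons)
    thus ?case unfolding E by (metis dvd_refl mult.commute mult_dvd_mono power_Suc)
  qed
  thus ?thesis by blast
qed

lemma power_dvd_dirp:
  assumes "L ^ Suc k dvd D"
  shows "L ^ k dvd dirp h D"
proof -
  obtain E where E: "D = L ^ Suc k * E" using assms by (auto elim: dvdE)
  have "dirp h D = L ^ k * (L * dirp h E + of_nat (Suc k) * dirp h L * E)"
    unfolding E dirp_mult dirp_power by (simp add: algebra_simps)
  thus ?thesis by simp
qed

section \<open>Spaces of polynomials and their dimensions\<close>

lemma linear_intro:
  assumes "vector_space s1" "vector_space s2"
    "\<And>x y. f (x + y) = f x + f y" "\<And>c x. f (s1 c x) = s2 c (f x)"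
  shows "Vector_Spaces.linear s1 s2 f"
proof -
  interpret vector_space_pair s1 s2 using assms(1,2) by (simp add: vector_space_pair_def)
  show ?thesis by unfold_locales (use assms(3,4) in auto)
qed

lemma fin_dim_inj:
  assumes "Vector_Spaces.linear s1 s2 f" "Modules.module.subspace s1 S" "inj_on f S" "fin_dim s2 (f ` S)"
  shows "fin_dim s1 S"
proof -
  interpret vector_space_pair s1 s2
    using assms(1) by (simp add: Vector_Spaces.linear_def vector_space_pair_def)
  interpret v2: vec_sp s2 ..
  obtain B where B: "B \<subseteq> S" "vs1.independent B" "S \<subseteq> vs1.span B"
    using vs1.basis_exists by metis
  have "vs1.span B = S"
    using B vs1.span_minimal[OF B(1) assms(2)] by simp
  hence "vs2.independent (f ` B)"
    using assms(1,3) B(2) by (intro linear_independent_injective_image) auto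
  hence "finite (f ` B)"
    by (rule v2.fin_dim_independent[OF assms(4)]) (use B(1) in auto)
  hence "finite B" using assms(3) B(1) by (metis finite_imageD inj_on_subset)
  thus ?thesis using B(3) unfolding fin_dim_def by auto
qed

abbreviation "psc \<equiv> \<lambda>(c::real) (p :: real poly poly). Polynomial.smult [:c:] p"
abbreviation "usc \<equiv> \<lambda>(c::real) (p :: real poly). Polynomial.smult c p"

lemma vs_psc: "vector_space psc"
  by unfold_locales (auto simp: smult_add_right mult.commute simp flip: one_pCons smult_add_left)

lemma vs_usc: "vector_space usc"
  by unfold_locales (auto simp: smult_add_right smult_add_left mult.commute)

lemma vs_real: "vector_space (times :: real \<Rightarrow> real \<Rightarrow> real)"
  by unfold_locales (auto simp: algebra_simps)

lemma dim_real: "vector_space.dim (times :: real \<Rightarrow> real \<Rightarrow> real) UNIV = 1"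
  and fin_dim_real: "fin_dim (times :: real \<Rightarrow> real \<Rightarrow> real) S"
proof -
  have "vector_space_over_itself.independent {1}" by simp
  moreover have sp: "vector_space_over_itself.span {1} = UNIV" by (auto simp: vector_space_over_itself.span_singleton)
  ultimately show "vector_space_over_itself.dim UNIV = 1" by (intro vector_space_over_itself.dim_unique[of "{1}"]) auto
  show "fin_dim times S" unfolding fin_dim_def using sp by (metis finite.emptyI finite.insertI subset_UNIV)
qed

lemma dim_fin_support:
  assumes "finite I"
  shows "vector_space.dim (\<lambda>c (w :: 'i \<Rightarrow> real) i. c * w i) {w. \<forall>i. i \<notin> I \<longrightarrow> w i = 0} = card I"
    and "fin_dim (\<lambda>c (w :: 'i \<Rightarrow> real) i. c * w i) {w. \<forall>i. i \<notin> I \<longrightarrow> w i = 0}"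
proof -
  interpret vs: vec_sp "times :: real \<Rightarrow> real \<Rightarrow> real" unfolding vec_sp_def by (rule vs_real)
  show "vector_space.dim (\<lambda>c (w :: 'i \<Rightarrow> real) i. c * w i) {w. \<forall>i. i \<notin> I \<longrightarrow> w i = 0} = card I"
    using vs.dim_direct_sum(1)[OF assms, of "\<lambda>_. UNIV"] by (simp add: dim_real fin_dim_real)
  show "fin_dim (\<lambda>c (w :: 'i \<Rightarrow> real) i. c * w i) {w. \<forall>i. i \<notin> I \<longrightarrow> w i = 0}"
    using vs.dim_direct_sum(2)[OF assms, of "\<lambda>_. UNIV"] by (simp add: fin_dim_real)
qed

lemma subspace_polys: "Modules.module.subspace psc (polys k)"
proof -
  interpret vs: vector_space psc by (rule vs_psc)
  show ?thesis unfolding vs.subspace_def by (simp add: polys_add polys_smult)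
qed

lemma card_pairs: "card {(i, j). i + j \<le> k} = (k + 2) choose 2"
proof -
  have "card {(i, j). i + j \<le> k} = card (Sigma {..k} (\<lambda>i. {..k - i}))"
    by (rule arg_cong[where f = card]) auto
  also have "\<dots> = (\<Sum>i\<le>k. Suc (k - i))" by simp
  also have "\<dots> = (\<Sum>i\<le>k. Suc i)" by (rule sum.nat_diff_reindex[of Suc "Suc k", unfolded lessThan_Suc_atMost, simplified])
  also have "\<dots> = (k + 2) choose 2"
    by (induction k) (auto simp: choose_two numeral_2_eq_2)
  finally show ?thesis .
qed

lemma finite_pairs: "finite {(i, j). i + j \<le> (k::nat)}"
  by (rule finite_subset[of _ "{..k} \<times> {..k}"]) auto

lemma dim_polys: "vector_space.dim psc (polys k) = (k + 2) choose 2"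
  and fin_dim_polys: "fin_dim psc (polys k)"
proof -
  let ?f = "\<lambda>p (i, j). coeff (coeff (p :: real poly poly) j) i"
  let ?I = "{(i, j). i + j \<le> k}"
  let ?s = "\<lambda>c (w :: nat \<times> nat \<Rightarrow> real) i. c * w i"
  interpret vector_space_pair psc ?s
    unfolding vector_space_pair_def using vs_psc vector_space_fun[OF vs_real] by blast
  have lin: "Vector_Spaces.linear psc ?s ?f"
    by (rule linear_intro) (auto intro: vs_psc vector_space_fun[OF vs_real] simp: fun_eq_iff)
  have inj: "inj_on ?f (polys k)"
    by (rule inj_onI) (auto simp: fun_eq_iff intro!: poly_eqI)
  have im: "?f ` polys k = {w. \<forall>x. x \<notin> ?I \<longrightarrow> w x = 0}"
  proof (intro equalityI subsetI)
    fix w :: "nat \<times> nat \<Rightarrow> real" assume w: "w \<in> {w. \<forall>x. x \<notin> ?I \<longrightarrow> w x = 0}"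
    define p where "p = (\<Sum>j\<le>k. monom (\<Sum>i\<le>k. monom (w (i, j)) i) j)"
    have "coeff (coeff p j) i = w (i, j)" for i j
      using w unfolding p_def by (auto simp: coeff_sum if_distrib sum.delta cong: if_cong)
    hence "?f p = w" "p \<in> polys k" using w unfolding polys_def by (auto simp: fun_eq_iff)
    thus "w \<in> ?f ` polys k" by (metis (no_types, lifting) image_eqI)
  next
    fix w assume "w \<in> ?f ` polys k"
    thus "w \<in> {w. \<forall>x. x \<notin> ?I \<longrightarrow> w x = 0}" unfolding polys_def by auto
  qed
  show "vector_space.dim psc (polys k) = (k + 2) choose 2"
    using dim_image_inj[OF lin subspace_polys inj] unfolding im
    using dim_fin_support(1)[OF finite_pairs, of k] card_pairs[of k] by simp
  show "fin_dim psc (polys k)"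
    by (rule fin_dim_inj[OF lin subspace_polys inj]) (unfold im, rule dim_fin_support(2)[OF finite_pairs])
qed

abbreviation "upolys m \<equiv> {p :: real poly. degree p \<le> m}"

lemma subspace_upolys: "Modules.module.subspace usc (upolys k)"
proof -
  interpret vs: vector_space usc by (rule vs_usc)
  show ?thesis unfolding vs.subspace_def by (auto intro: degree_add_le order_trans[OF degree_smult_le])
qed

lemma dim_upolys: "vector_space.dim usc (upolys m) = m + 1"
  and fin_dim_upolys: "fin_dim usc (upolys m)"
proof -
  let ?f = "coeff :: real poly \<Rightarrow> _"
  let ?s = "\<lambda>c (w :: nat \<Rightarrow> real) i. c * w i"
  interpret vector_space_pair usc ?s
    unfolding vector_space_pair_def using vs_usc vector_space_fun[OF vs_real] by blast
  have lin: "Vector_Spaces.linear usc ?s ?f"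
    by (rule linear_intro) (auto intro: vs_usc vector_space_fun[OF vs_real] simp: fun_eq_iff)
  have inj: "inj_on ?f (upolys m)"
    by (rule inj_onI) (auto simp: fun_eq_iff intro!: poly_eqI)
  have im: "?f ` upolys m = {w. \<forall>i. i \<notin> {..m} \<longrightarrow> w i = 0}"
  proof (intro equalityI subsetI)
    fix w :: "nat \<Rightarrow> real" assume w: "w \<in> {w. \<forall>x. x \<notin> {..m} \<longrightarrow> w x = 0}"
    define p where "p = (\<Sum>i\<le>m. monom (w i) i)"
    have c: "coeff p i = w i" for i
      using w unfolding p_def by (auto simp: coeff_sum)
    hence "degree p \<le> m" using w by (intro degree_le) auto
    thus "w \<in> ?f ` upolys m" using c by (intro image_eqI[of _ _ p]) auto
  next
    fix w assume "w \<in> ?f ` upolys m"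
    thus "w \<in> {w. \<forall>x. x \<notin> {..m} \<longrightarrow> w x = 0}" by (auto intro: coeff_eq_0)
  qed
  show "vector_space.dim usc (upolys m) = m + 1"
    using dim_image_inj[OF lin subspace_upolys inj] unfolding im
    using dim_fin_support(1)[of "{..m}"] by simp
  show "fin_dim usc (upolys m)"
    by (rule fin_dim_inj[OF lin subspace_upolys inj]) (unfold im, rule dim_fin_support(2), simp)
qed

subsection \<open>Syzygies of powers of linear forms\<close>

definition lin :: "real \<Rightarrow> real poly" where "lin a = [:- a, 1:]"

lemma poly_lin [simp]: "poly (lin a) x = x - a"
  and degree_lin [simp]: "degree (lin a) = 1"
  and lin_nonzero [simp]: "lin a \<noteq> 0"
  and pderiv_lin [simp]: "pderiv (lin a) = 1"
  by (simp_all add: lin_def pderiv_pCons)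

lemma degree_lin_power [simp]: "degree (lin a ^ k) = k"
  by (simp add: degree_power_eq)

lemma degree_lin_power_Suc [simp]: "degree (lin a * lin a ^ k) = Suc k"
  using degree_lin_power[of a "Suc k"] by simp

lemma smult_sum_right: "Polynomial.smult c (sum f I) = (\<Sum>i\<in>I. Polynomial.smult c (f i))"
  by (induction I rule: infinite_finite_induct) (auto simp: smult_add_right)

lemma lin_dvd_iff: "lin a dvd p \<longleftrightarrow> poly p a = 0"
  by (simp add: lin_def poly_eq_0_iff_dvd)

lemma higher_pderiv_eq_0: "degree (p :: real poly) < k \<Longrightarrow> (pderiv ^^ k) p = 0"
  by (rule poly_eqI) (simp add: coeff_higher_pderiv coeff_eq_0)

lemma poly_higher_pderiv_dvd_eq_0:
  fixes a :: real
  assumes "lin a ^ k dvd g" "i < k"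
  shows "poly ((pderiv ^^ i) g) a = 0"
  using assms
proof (induction i arbitrary: k g)
  case 0
  then obtain h where "g = lin a ^ k * h" by (auto elim: dvdE)
  with 0 show ?case by simp
next
  case (Suc i)
  then obtain k' h where k: "k = Suc k'" and g: "g = lin a ^ Suc k' * h"
    by (cases k) (auto elim!: dvdE)
  have "pderiv g = lin a ^ k' * (of_nat (Suc k') * h + lin a * pderiv h)"
    unfolding g pderiv_mult pderiv_power_Suc by (simp add: algebra_simps of_nat_poly)
  hence "lin a ^ k' dvd pderiv g" by simp
  thus ?case using Suc.IH[of k' "pderiv g"] Suc.prems k by (simp add: funpow_swap1)
qed

lemma poly_higher_pderiv_power_mult:
  fixes a :: real
  shows "poly ((pderiv ^^ k) (lin a ^ k * h)) a = fact k * poly h a"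
proof (induction k arbitrary: h)
  case (Suc k)
  have "pderiv (lin a ^ Suc k * h) = lin a ^ k * (of_nat (Suc k) * h + lin a * pderiv h)"
    unfolding pderiv_mult pderiv_power_Suc by (simp add: algebra_simps of_nat_poly)
  hence "(pderiv ^^ Suc k) (lin a ^ Suc k * h)
      = (pderiv ^^ k) (lin a ^ k * (of_nat (Suc k) * h + lin a * pderiv h))"
    by (simp only: funpow_Suc_right o_apply)
  thus ?case by (simp add: Suc.IH of_nat_poly)
qed simp

lemma power_dvd_if_higher_pderiv_eq_0:
  fixes a :: real
  assumes "\<And>i. i < k \<Longrightarrow> poly ((pderiv ^^ i) g) a = 0"
  shows "lin a ^ k dvd g"
  using assms
proof (induction k)
  case (Suc k)
  then obtain h where h: "g = lin a ^ k * h" by (auto elim: dvdE)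
  have "poly h a = 0" using Suc.prems[of k] unfolding h poly_higher_pderiv_power_mult by simp
  then obtain h' where "h = lin a * h'" by (auto simp flip: lin_dvd_iff elim: dvdE)
  thus ?case unfolding h by (simp add: mult.assoc mult.left_commute)
qed simp

lemma lin_power_dvd_cancel: "lin a ^ k dvd P * E \<Longrightarrow> poly P a \<noteq> 0 \<Longrightarrow> lin a ^ k dvd E"
proof (induction k)
  case (Suc k)
  have "lin a ^ k dvd P * E"
    by (rule dvd_trans[OF le_imp_power_dvd Suc.prems(1)]) simp
  hence "lin a ^ k dvd E" using Suc.IH Suc.prems(2) by simp
  then obtain F where F: "E = lin a ^ k * F" by (auto elim: dvdE)
  have "lin a ^ k * lin a dvd lin a ^ k * (P * F)"
    using Suc.prems(1) unfolding F by (simp add: ac_simps)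
  hence "lin a dvd P * F" by simp
  hence "lin a dvd F" using Suc.prems(2) by (simp add: lin_dvd_iff)
  thus ?case unfolding F power_Suc2 by (rule mult_dvd_mono[OF dvd_refl])
qed simp

lemma prod_lin_power_dvd:
  assumes "finite S" "\<And>a. a \<in> S \<Longrightarrow> lin a ^ k dvd g"
  shows "(\<Prod>a\<in>S. lin a ^ k) dvd g"
  using assms
proof (induction S rule: finite_induct)
  case (insert a S)
  then obtain E where E: "g = (\<Prod>a\<in>S. lin a ^ k) * E" by (auto elim: dvdE)
  have "lin a ^ k dvd (\<Prod>a\<in>S. lin a ^ k) * E" using insert.prems[of a] E by simp
  moreover have "poly (\<Prod>a\<in>S. lin a ^ k) a \<noteq> 0"
    using insert.hyps by (auto simp: poly_prod)
  ultimately have "lin a ^ k dvd E" by (rule lin_power_dvd_cancel)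
  thus ?case unfolding E using insert.hyps by (simp add: mult.commute mult_dvd_mono)
qed simp

text \<open>For polynomials of degree at most \<open>n\<close> the derivative of the apolarity pairing telescopes to a
  combination of \<open>f\<close> times the \<open>(n + 1)\<close>-st derivative of \<open>g\<close> and conversely, which is zero;
  hence the pairing can be evaluated at any point.\<close>

definition apolar :: "nat \<Rightarrow> real poly \<Rightarrow> real poly \<Rightarrow> real poly" where
  "apolar n f g = (\<Sum>j\<le>n. (- 1) ^ j * (pderiv ^^ j) f * (pderiv ^^ (n - j)) g)"

lemma pderiv_sum': "pderiv (sum f I) = (\<Sum>i\<in>I. pderiv (f i :: real poly))"
  using higher_pderiv_sum[of 1 f I] by simp

lemma apolar_const:
  assumes "degree f \<le> n" "degree g \<le> n"
  shows "poly (apolar n f g) x = poly (apolar n f g) y"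
proof -
  define b where "b j = (- 1) ^ j * (pderiv ^^ j) f * (pderiv ^^ (Suc n - j)) g" for j
  have "pderiv ((- 1) ^ j * (pderiv ^^ j) f * (pderiv ^^ (n - j)) g) = b j - b (Suc j)" if "j \<le> n" for j
  proof -
    have "pderiv ((- 1) ^ j :: real poly) = 0"
      by (induction j) (auto simp: pderiv_mult pderiv_minus)
    thus ?thesis using that unfolding b_def
      by (simp add: pderiv_mult Suc_diff_le algebra_simps)
  qed
  hence "pderiv (apolar n f g) = (\<Sum>j\<le>n. b j - b (Suc j))"
    unfolding apolar_def pderiv_sum' by (intro sum.cong) auto
  also have "\<dots> = b 0 - b (Suc n)" by (rule sum_telescope)
  also have "\<dots> = 0" using assms unfolding b_def
    by (simp add: higher_pderiv_eq_0 del: funpow.simps)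
  finally have "degree (apolar n f g) = 0" by (simp add: pderiv_eq_0_iff)
  then obtain c where "apolar n f g = [:c:]" by (rule degree_eq_zeroE)
  thus ?thesis by simp
qed

lemma apolar_sum: "apolar n (\<Sum>i\<in>I. f i) g = (\<Sum>i\<in>I. apolar n (f i) g)"
  unfolding apolar_def higher_pderiv_sum
  by (subst sum.swap) (simp add: sum_distrib_left sum_distrib_right)

lemma poly_apolar: "poly (apolar n f g) x
    = (\<Sum>j\<le>n. (- 1) ^ j * poly ((pderiv ^^ j) f) x * poly ((pderiv ^^ (n - j)) g) x)"
  unfolding apolar_def by (simp add: poly_sum poly_power)

text \<open>The orders of vanishing at \<open>a\<close> are complementary: for j < s the derivative
  of \<open>f\<close> is zero, for j > s that of \<open>g\<close>, so only the term j = s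
  survives.\<close>

lemma apolar_single:
  assumes f: "f = lin a ^ s * F" and g: "g = lin a ^ (n - s) * G" and "s \<le> n"
  shows "poly (apolar n f g) a = (- 1) ^ s * (fact s * poly F a) * (fact (n - s) * poly G a)"
proof -
  have "poly ((pderiv ^^ j) f) a * poly ((pderiv ^^ (n - j)) g) a = 0" if "j \<le> n" "j \<noteq> s" for j
  proof (cases "j < s")
    case True
    thus ?thesis using poly_higher_pderiv_dvd_eq_0[of a s f j] unfolding f by simp
  next
    case False
    hence "n - j < n - s" using that by linarith
    thus ?thesis using poly_higher_pderiv_dvd_eq_0[of a "n - s" g "n - j"] unfolding g by simp
  qed
  hence "(\<Sum>j\<le>n. (- 1) ^ j * poly ((pderiv ^^ j) f) a * poly ((pderiv ^^ (n - j)) g) a)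
     = (\<Sum>j\<in>{s}. (- 1) ^ j * poly ((pderiv ^^ j) f) a * poly ((pderiv ^^ (n - j)) g) a)"
    using \<open>s \<le> n\<close> by (intro sum.mono_neutral_right) (auto simp: mult.assoc)
  thus ?thesis unfolding poly_apolar
    by (simp add: poly_higher_pderiv_power_mult[of s a F, folded f]
        poly_higher_pderiv_power_mult[of "n - s" a G, folded g])
qed

text \<open>The relation is paired with a polynomial \<open>g\<close> that vanishes to order m + 1
  at all other \<open>a i\<close>. Evaluated at \<open>a i\<close>, the pairing with the i-th
  summand is then zero, since either the power of order \<mu> + 1 or \<open>g\<close> kills each
  term. Only the summand \<open>i0\<close> remains.\<close>

lemma linear_power_independent:
  fixes a :: "'i \<Rightarrow> real"
  assumes "finite I" "inj_on a I" and N: "card I * (m + 1) \<le> m + \<mu> + 2"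
    and deg: "\<And>i. i \<in> I \<Longrightarrow> degree (h i) \<le> m"
    and sum0: "(\<Sum>i\<in>I. h i * lin (a i) ^ (\<mu> + 1)) = 0" and "i0 \<in> I"
  shows "h i0 = 0"
proof (rule ccontr)
  assume nz: "h i0 \<noteq> 0"
  define n where "n = m + \<mu> + 1"
  define f where "f i = lin (a i) ^ (\<mu> + 1) * h i" for i
  define r where "r = Polynomial.order (a i0) (h i0)"
  obtain E where E: "h i0 = lin (a i0) ^ r * E" "\<not> lin (a i0) dvd E"
    using order_decomp[OF nz, of "a i0"] unfolding r_def lin_def by blast
  have rm: "r \<le> m" using order_degree[OF nz] deg[OF \<open>i0 \<in> I\<close>] unfolding r_def by (meson le_trans)
  define P where "P = (\<Prod>i\<in>I - {i0}. lin (a i) ^ (m + 1))"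
  \<comment> \<open>The exponent m - r complements the order \<mu> + 1 + r of \<open>f i0\<close> at
    \<open>a i0\<close> to n, so that \<open>apolar_single\<close> leaves one nonzero term. The
    hypothesis on \<open>card I\<close> is what keeps the degree of \<open>g\<close> within
    n.\<close>
  define g where "g = lin (a i0) ^ (m - r) * P"
  have "degree P = (card I - 1) * (m + 1)"
    unfolding P_def using assms(1,6) by (subst degree_prod_eq_sum_degree) (auto)
  hence "degree g = m - r + (card I - 1) * (m + 1)"
    unfolding g_def by (subst degree_mult_eq) (auto simp: P_def assms(1))
  also have "\<dots> \<le> n"
    using N assms(1,6) rm unfolding n_def by (cases "card I") auto
  finally have dg: "degree g \<le> n" .
  have df: "degree (f i) \<le> n" if "i \<in> I" for i
  proof -
    have "degree (f i) \<le> (\<mu> + 1) + m"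
      unfolding f_def by (rule order_trans[OF degree_mult_le add_mono]) (use deg that in auto)
    thus ?thesis unfolding n_def by simp
  qed
  have "poly (apolar n (f i) g) (a i0) = 0" if i: "i \<in> I - {i0}" for i
  proof -
    obtain Q where Q: "P = lin (a i) ^ (m + 1) * Q"
      unfolding P_def using prod.remove[OF _ i, of "\<lambda>i. lin (a i) ^ (m + 1)"] assms(1) by simp
    have "poly (apolar n (f i) g) (a i0) = poly (apolar n (f i) g) (a i)"
      using apolar_const df dg i by blast
    also have "\<dots> = 0" unfolding poly_apolar
    proof (rule sum.neutral, rule ballI)
      fix j assume "j \<in> {..n}"
      show "(- 1) ^ j * poly ((pderiv ^^ j) (f i)) (a i) * poly ((pderiv ^^ (n - j)) g) (a i) = 0"
      proof (cases "j < \<mu> + 1")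
        case True
        have "lin (a i) ^ (\<mu> + 1) dvd f i" unfolding f_def by simp
        from poly_higher_pderiv_dvd_eq_0[OF this True] show ?thesis by simp
      next
        case False
        hence *: "n - j < m + 1" unfolding n_def by simp
        have "lin (a i) ^ (m + 1) dvd g" unfolding g_def Q by (simp add: dvd_mult)
        from poly_higher_pderiv_dvd_eq_0[OF this *] show ?thesis by simp
      qed
    qed
    finally show ?thesis .
  qed
  hence "poly (apolar n (\<Sum>i\<in>I. f i) g) (a i0) = poly (apolar n (f i0) g) (a i0)"
    unfolding apolar_sum poly_sum using assms(1,6) by (simp add: sum.remove)
  moreover have "(\<Sum>i\<in>I. f i) = 0" using sum0 unfolding f_def by (simp add: mult.commute)
  ultimately have "poly (apolar n (f i0) g) (a i0) = 0" by (simp add: apolar_def)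
  moreover have "poly (apolar n (f i0) g) (a i0)
      = (- 1) ^ (\<mu> + 1 + r) * (fact (\<mu> + 1 + r) * poly E (a i0)) * (fact (n - (\<mu> + 1 + r)) * poly P (a i0))"
    by (rule apolar_single) (use E rm in \<open>auto simp: f_def g_def n_def power_add mult.assoc\<close>)
  moreover have "poly E (a i0) \<noteq> 0" using E(2) by (simp add: lin_dvd_iff)
  moreover have "poly P (a i0) \<noteq> 0"
    unfolding P_def poly_prod using assms(1,2,6) by (auto simp: inj_on_def)
  ultimately show False by simp
qed

text \<open>Duality: if \<open>v\<close> is missed, some functional \<phi> is zero on the image and
  1 at \<open>v\<close>. It is the pairing with a polynomial \<open>g\<close> of degree at most n.
  Being zero on the image forces \<open>g\<close> to vanish to order m + 1 at every
  \<open>a i\<close>, which is more roots than its degree allows, so \<open>g\<close> and hence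
  \<phi> v would be zero.\<close>

lemma linear_power_spanning:
  fixes a :: "'i \<Rightarrow> real"
  assumes "finite I" "inj_on a I" and N: "m + \<mu> + 2 \<le> card I * (m + 1)"
    and v: "degree v \<le> m + \<mu> + 1"
  shows "v \<in> (\<lambda>h. \<Sum>i\<in>I. h i * lin (a i) ^ (\<mu> + 1)) ` {h. \<forall>i\<in>I. degree (h i) \<le> m}"
    (is "v \<in> ?\<Phi> ` ?H")
proof (rule ccontr)
  assume nv: "v \<notin> ?\<Phi> ` ?H"
  define n where "n = m + \<mu> + 1"
  interpret vector_space_pair usc "times :: real \<Rightarrow> _"
    unfolding vector_space_pair_def using vs_usc vs_real by blast
  define \<Phi> where "\<Phi> h = (\<Sum>i\<in>I. h i * lin (a i) ^ (\<mu> + 1))" for h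
  define H where "H = {h :: 'i \<Rightarrow> real poly. \<forall>i\<in>I. degree (h i) \<le> m}"
  define T where "T = \<Phi> ` H"
  have T: "v \<notin> T" using nv unfolding T_def \<Phi>_def H_def .
  have sub: "vs1.subspace T"
    unfolding vs1.subspace_def
  proof (intro conjI ballI allI)
    have "\<Phi> (\<lambda>_. 0) = 0" "(\<lambda>_. 0) \<in> H" by (simp_all add: \<Phi>_def H_def)
    thus "0 \<in> T" using imageI[of "\<lambda>_. 0" H \<Phi>] unfolding T_def by simp
  next
    fix x y assume "x \<in> T" "y \<in> T"
    then obtain h k where hk: "h \<in> H" "k \<in> H" "x = \<Phi> h" "y = \<Phi> k" unfolding T_def by auto
    have "\<Phi> (\<lambda>i. h i + k i) = \<Phi> h + \<Phi> k"
      by (simp add: \<Phi>_def algebra_simps sum.distrib)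
    moreover have "(\<lambda>i. h i + k i) \<in> H" using hk(1,2) by (auto simp: H_def intro: degree_add_le)
    ultimately show "x + y \<in> T"
      using imageI[of "\<lambda>i. h i + k i" H \<Phi>] unfolding T_def hk by simp
  next
    fix c x assume "x \<in> T"
    then obtain h where h: "h \<in> H" "x = \<Phi> h" unfolding T_def by auto
    have "\<Phi> (\<lambda>i. Polynomial.smult c (h i)) = Polynomial.smult c (\<Phi> h)"
      by (simp add: \<Phi>_def smult_sum_right)
    moreover have "(\<lambda>i. Polynomial.smult c (h i)) \<in> H"
      using h(1) by (auto simp: H_def intro: order_trans[OF degree_smult_le])
    ultimately show "Polynomial.smult c x \<in> T"
      using imageI[of "\<lambda>i. Polynomial.smult c (h i)" H \<Phi>] unfolding T_def h by simp
  qed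
  obtain B where B: "B \<subseteq> T" "vs1.independent B" "T \<subseteq> vs1.span B" "card B = vs1.dim T"
    by (rule vs1.basis_exists)
  have sp: "vs1.span B = T"
    by (rule vs1.span_subspace[OF B(1,3) sub])
  have "vs1.independent (insert v B)"
    using vs1.independent_insertI[of v B] T sp B(2) by simp
  then obtain \<phi> where \<phi>: "Vector_Spaces.linear usc times \<phi>" "\<forall>x\<in>insert v B. \<phi> x = (if x = v then 1 else 0)"
    using linear_independent_extend[of "insert v B" "\<lambda>x. if x = v then 1 else 0"] by blast
  interpret \<phi>: Vector_Spaces.linear usc "times" \<phi> by fact
  have "v \<notin> B" using T B(1) by auto
  have \<phi>B: "\<phi> x = 0" if "x \<in> B" for x using \<phi>(2) that \<open>v \<notin> B\<close> by auto
  have \<phi>v: "\<phi> v = 1" using \<phi>(2) by auto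
  have \<phi>0: "\<phi> x = 0" if "x \<in> T" for x
  proof (rule linear_eq_0_on_span[OF \<phi>(1)])
    show "x \<in> vs1.span B" by (subst sp) (rule that)
  qed (rule \<phi>B)
  \<comment> \<open>These coefficients solve the requirement that the pairing reproduce \<phi> on
    monomials: at 0 the j-th derivative is j! times the j-th coefficient.\<close>
  define g where "g = (\<Sum>i\<le>n. monom ((- 1) ^ (n - i) * \<phi> (monom 1 (n - i)) / (fact (n - i) * fact i)) i)"
  have cg: "coeff g i = (- 1) ^ (n - i) * \<phi> (monom 1 (n - i)) / (fact (n - i) * fact i)" if "i \<le> n" for i
    using that unfolding g_def by (simp add: coeff_sum)
  have dg: "degree g \<le> n" unfolding g_def
    by (rule degree_sum_le) (auto intro: order_trans[OF degree_monom_le])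
  have at0: "poly ((pderiv ^^ j) f) 0 = fact j * coeff f j" for f :: "real poly" and j
    by (simp add: poly_0_coeff_0 coeff_higher_pderiv pochhammer_fact)
  have rep: "poly (apolar n f g) x = \<phi> f" if f: "degree f \<le> n" for f x
  proof -
    have "poly (apolar n f g) x = poly (apolar n f g) 0" by (rule apolar_const[OF f dg])
    also have "\<dots> = (\<Sum>j\<le>n. coeff f j * \<phi> (monom 1 j))"
      unfolding poly_apolar at0
    proof (rule sum.cong)
      fix j assume "j \<in> {..n}"
      moreover have "(- 1) ^ j * (- 1) ^ j = (1 :: real)" by (simp flip: power_mult_distrib)
      ultimately show "(- 1) ^ j * (fact j * coeff f j) * (fact (n - j) * coeff g (n - j))
          = coeff f j * \<phi> (monom 1 j)"
        by (simp add: cg)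
    qed simp
    also have "\<dots> = \<phi> (\<Sum>j\<le>n. Polynomial.smult (coeff f j) (monom 1 j))"
      by (simp add: \<phi>.sum \<phi>.scale)
    also have "(\<Sum>j\<le>n. Polynomial.smult (coeff f j) (monom 1 j)) = f"
      using poly_as_sum_of_monoms'[OF f] by (simp add: smult_monom)
    finally show ?thesis .
  qed
  have "lin (a i) ^ (m + 1) dvd g" if i: "i \<in> I" for i
  proof (rule power_dvd_if_higher_pderiv_eq_0)
    fix k assume k: "k < m + 1"
    define q where "q = lin (a i) ^ (m - k)"
    \<comment> \<open>The family concentrated at \<open>i\<close> puts
      \<open>lin (a i) ^ (n - k)\<close> into the image. Pairing it with \<open>g\<close> at
      \<open>a i\<close> isolates the k-th derivative of \<open>g\<close>.\<close>
    define w where "w j = (if j = i then q else 0)" for j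
    have "\<Phi> w = w i * lin (a i) ^ (\<mu> + 1) + (\<Sum>j\<in>I - {i}. w j * lin (a j) ^ (\<mu> + 1))"
      unfolding \<Phi>_def by (rule sum.remove[OF assms(1) i])
    also have "\<dots> = q * lin (a i) ^ (\<mu> + 1)" by (simp add: w_def)
    also have "\<dots> = lin (a i) ^ (n - k)" unfolding q_def n_def power_add[symmetric]
      using k by (intro arg_cong[where f = "\<lambda>x. _ ^ x"]) auto
    finally have \<Phi>w: "\<Phi> w = lin (a i) ^ (n - k)" .
    have "w \<in> H" by (simp add: w_def H_def q_def)
    hence "lin (a i) ^ (n - k) \<in> T" unfolding T_def \<Phi>w[symmetric] by (rule imageI)
    hence "\<phi> (lin (a i) ^ (n - k)) = 0" by (rule \<phi>0)
    hence "poly (apolar n (lin (a i) ^ (n - k)) g) (a i) = 0"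
      by (subst rep) auto
    moreover have "poly (apolar n (lin (a i) ^ (n - k)) g) (a i)
        = (- 1) ^ (n - k) * fact (n - k) * poly ((pderiv ^^ k) g) (a i)"
    proof -
      have "(\<Sum>j\<le>n. (- 1) ^ j * poly ((pderiv ^^ j) (lin (a i) ^ (n - k))) (a i) * poly ((pderiv ^^ (n - j)) g) (a i))
        = (\<Sum>j\<in>{n - k}. (- 1) ^ j * poly ((pderiv ^^ j) (lin (a i) ^ (n - k))) (a i) * poly ((pderiv ^^ (n - j)) g) (a i))"
      proof (rule sum.mono_neutral_right)
        show "\<forall>j\<in>{..n} - {n - k}. (- 1) ^ j * poly ((pderiv ^^ j) (lin (a i) ^ (n - k))) (a i) * poly ((pderiv ^^ (n - j)) g) (a i) = 0"
        proof
          fix j assume j: "j \<in> {..n} - {n - k}"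
          show "(- 1) ^ j * poly ((pderiv ^^ j) (lin (a i) ^ (n - k))) (a i) * poly ((pderiv ^^ (n - j)) g) (a i) = 0"
          proof (cases "j < n - k")
            case True
            thus ?thesis using poly_higher_pderiv_dvd_eq_0[of "a i" "n - k" _ j] by simp
          next
            case False
            hence "n - k < j" using j by auto
            thus ?thesis by (simp add: higher_pderiv_eq_0 degree_power_eq)
          qed
        qed
      qed auto
      thus ?thesis unfolding poly_apolar
        using poly_higher_pderiv_power_mult[of "n - k" "a i" 1] k by (simp add: n_def)
    qed
    ultimately show "poly ((pderiv ^^ k) g) (a i) = 0" by simp
  qed
  hence "(\<Prod>x\<in>a ` I. lin x ^ (m + 1)) dvd g"
    using assms(1) by (intro prod_lin_power_dvd) auto
  moreover have "degree (\<Prod>x\<in>a ` I. lin x ^ (m + 1)) = card I * (m + 1)"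
    using assms(1,2) by (subst degree_prod_eq_sum_degree) (auto simp: card_image)
  ultimately have "g = 0"
  proof (rule_tac ccontr)
    assume dvd: "(\<Prod>x\<in>a ` I. lin x ^ (m + 1)) dvd g" and "g \<noteq> 0"
      and deg: "degree (\<Prod>x\<in>a ` I. lin x ^ (m + 1)) = card I * (m + 1)"
    show False using dvd_imp_degree_le[OF dvd \<open>g \<noteq> 0\<close>] dg N unfolding n_def deg by simp
  qed
  hence "\<phi> v = 0" using rep[of v 0] v unfolding n_def apolar_def by simp
  thus False using \<phi>v by simp
qed

lemma (in vec_sp) dim_zero: "V.dim {0} = 0"
  by (rule V.dim_unique[of "{}"]) (simp_all add: V.span_zero V.independent_empty)

lemma (in vector_space_pair) subspace_kernel_on:
  assumes "Vector_Spaces.linear s1 s2 f" "vs1.subspace S"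
  shows "vs1.subspace {x \<in> S. f x = 0}"
  using vs1.subspace_inter[OF assms(2) linear_subspace_kernel[OF assms(1)]] by (simp add: Int_def)

lemma (in vec_sp) subspace_direct_sum:
  assumes "\<And>i. i \<in> I \<Longrightarrow> V.subspace (U i)"
  shows "Modules.module.subspace (\<lambda>c w i. scale c (w i)) {w. (\<forall>i\<in>I. w i \<in> U i) \<and> (\<forall>i. i \<notin> I \<longrightarrow> w i = 0)}"
proof -
  interpret fs: vector_space "\<lambda>c (w :: 'i \<Rightarrow> 'b) i. scale c (w i)"
    by (rule vector_space_fun) unfold_locales
  show ?thesis
    unfolding fs.subspace_def using assms V.subspace_0 V.subspace_add V.subspace_scale by simp
qed

definition syz :: "'i set \<Rightarrow> ('i \<Rightarrow> real poly) \<Rightarrow> nat \<Rightarrow> nat \<Rightarrow> ('i \<Rightarrow> real poly) set" where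
  "syz I lf \<mu> m = {h. (\<forall>i\<in>I. h i \<in> upolys m) \<and> (\<forall>i. i \<notin> I \<longrightarrow> h i = 0) \<and> (\<Sum>i\<in>I. h i * lf i ^ (\<mu> + 1)) = 0}"

text \<open>With N = \<open>card I\<close>: as long as N (m + 1) is at most m + \<mu> + 2, the
  powers are independent and the kernel is zero; beyond that, the map is onto the polynomials of
  degree at most m + \<mu> + 1, and rank-nullity applies. Truncated subtraction on nat serves as the
  positive part. The factors \<open>c i\<close> are the leading coefficients of linear forms that
  need not be monic.\<close>

lemma
  fixes lf :: "'i \<Rightarrow> real poly"
  assumes "finite I" "inj_on a I" and lf: "\<And>i. i \<in> I \<Longrightarrow> lf i = Polynomial.smult (c i) (lin (a i))" "\<And>i. i \<in> I \<Longrightarrow> c i \<noteq> 0"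
  shows dim_syz: "vector_space.dim (\<lambda>c w i. usc c (w i)) (syz I lf \<mu> m) = card I * (m + 1) - (m + \<mu> + 2)"
    and subspace_syz: "Modules.module.subspace (\<lambda>c w i. usc c (w i)) (syz I lf \<mu> m)"
    and fin_dim_syz: "fin_dim (\<lambda>c w i. usc c (w i)) (syz I lf \<mu> m)"
proof -
  interpret u: vec_sp usc unfolding vec_sp_def by (rule vs_usc)
  interpret fs: vec_sp "\<lambda>c (w :: 'i \<Rightarrow> real poly) i. usc c (w i)"
    unfolding vec_sp_def by (rule vector_space_fun[OF vs_usc])
  interpret p: vector_space_pair "\<lambda>c (w :: 'i \<Rightarrow> real poly) i. usc c (w i)" usc ..
  define H where "H = {w :: 'i \<Rightarrow> real poly. (\<forall>i\<in>I. w i \<in> upolys m) \<and> (\<forall>i. i \<notin> I \<longrightarrow> w i = 0)}"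
  define f where "f h = (\<Sum>i\<in>I. h i * lf i ^ (\<mu> + 1))" for h
  have H: "fs.V.subspace H" "fs.V.dim H = card I * (m + 1)" "fin_dim (\<lambda>c w i. usc c (w i)) H"
    unfolding H_def
    using u.subspace_direct_sum[of I "\<lambda>_. upolys m"] u.dim_direct_sum[OF assms(1), of "\<lambda>_. upolys m"]
    by (simp_all add: subspace_upolys fin_dim_upolys dim_upolys)
  have lin: "Vector_Spaces.linear (\<lambda>c w i. usc c (w i)) usc f"
    by (rule linear_intro[OF vector_space_fun[OF vs_usc] vs_usc])
      (simp_all add: f_def algebra_simps sum.distrib smult_sum_right)
  have K: "syz I lf \<mu> m = {h \<in> H. f h = 0}"
    unfolding syz_def H_def f_def by auto
  have lp: "h * lf i ^ (\<mu> + 1) = Polynomial.smult (c i ^ (\<mu> + 1)) h * lin (a i) ^ (\<mu> + 1)" if "i \<in> I" for h i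
    using lf(1)[OF that] by (simp add: smult_power)
  show "fs.V.subspace (syz I lf \<mu> m)" unfolding K by (rule p.subspace_kernel_on[OF lin H(1)])
  show "fin_dim (\<lambda>c w i. usc c (w i)) (syz I lf \<mu> m)"
    by (rule fin_dim_subset[OF H(3)]) (unfold K, rule Collect_subset)
  show "fs.V.dim (syz I lf \<mu> m) = card I * (m + 1) - (m + \<mu> + 2)"
  proof (cases "card I * (m + 1) \<le> m + \<mu> + 2")
    case True
    have "h = 0" if h: "h \<in> H" "f h = 0" for h
    proof
      fix i
      show "h i = 0 i"
      proof (cases "i \<in> I")
        case True
        have "Polynomial.smult (c i ^ (\<mu> + 1)) (h i) = 0"
        proof (rule linear_power_independent[OF assms(1,2) \<open>card I * (m + 1) \<le> m + \<mu> + 2\<close> _ _ True])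
          show "degree (Polynomial.smult (c i ^ (\<mu> + 1)) (h i)) \<le> m" if "i \<in> I" for i
            using h(1) that unfolding H_def by (auto intro: order_trans[OF degree_smult_le])
          show "(\<Sum>i\<in>I. Polynomial.smult (c i ^ (\<mu> + 1)) (h i) * lin (a i) ^ (\<mu> + 1)) = 0"
            using h(2) lp unfolding f_def by simp
        qed
        thus ?thesis using lf(2)[OF True] by simp
      qed (use h in \<open>simp add: H_def\<close>)
    qed
    moreover have "0 \<in> H" "f 0 = 0" by (simp_all add: H_def f_def)
    ultimately have "{h \<in> H. f h = 0} = {0}" by auto
    thus ?thesis unfolding K using fs.dim_zero True by simp
  next
    case False
    have "f ` H = upolys (m + \<mu> + 1)"
    proof (intro equalityI subsetI)
      fix v assume "v \<in> f ` H"
      then obtain h where h: "h \<in> H" "v = f h" by auto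
      have "degree (h i * lf i ^ (\<mu> + 1)) \<le> m + \<mu> + 1" if "i \<in> I" for i
      proof -
        have "degree (h i * lf i ^ (\<mu> + 1)) \<le> m + (\<mu> + 1)"
          unfolding lp[OF that] using h(1) that unfolding H_def
          by (intro order_trans[OF degree_mult_le] add_mono) (auto intro: order_trans[OF degree_smult_le])
        thus ?thesis by simp
      qed
      hence "degree (f h) \<le> m + \<mu> + 1" unfolding f_def using assms(1) by (intro degree_sum_le) auto
      thus "v \<in> upolys (m + \<mu> + 1)" using h by simp
    next
      fix v assume "v \<in> upolys (m + \<mu> + 1)"
      hence v: "degree v \<le> m + \<mu> + 1" by simp
      have "m + \<mu> + 2 \<le> card I * (m + 1)" using False by simp
      from linear_power_spanning[OF assms(1,2) this v] obtain h where
        h: "\<forall>i\<in>I. degree (h i) \<le> m" "v = (\<Sum>i\<in>I. h i * lin (a i) ^ (\<mu> + 1))" by auto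
      define k where "k i = (if i \<in> I then Polynomial.smult (inverse (c i ^ (\<mu> + 1))) (h i) else 0)" for i
      have "k \<in> H" using h(1) unfolding H_def k_def by (auto intro: order_trans[OF degree_smult_le])
      moreover have "f k = v"
        unfolding f_def h(2)
      proof (rule sum.cong[OF refl])
        fix i assume i: "i \<in> I"
        show "k i * lf i ^ (\<mu> + 1) = h i * lin (a i) ^ (\<mu> + 1)"
          using lf(2)[OF i] i right_inverse[of "c i ^ (\<mu> + 1)"] unfolding lp[OF i] k_def by (simp del: power_Suc)
      qed
      ultimately show "v \<in> f ` H" by auto
    qed
    hence "u.V.dim (f ` H) = m + \<mu> + 2" using dim_upolys[of "m + \<mu> + 1"] by simp
    thus ?thesis using p.rank_nullity[OF lin H(1,3)] H(2) unfolding K by simp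
  qed
qed

section \<open>Homogeneous components about a vertex\<close>

lemma graded_zero:
  fixes g :: "nat \<Rightarrow> real"
  assumes "\<And>t. t \<noteq> 0 \<Longrightarrow> (\<Sum>m\<le>K. t ^ m * g m) = 0" "m \<le> K"
  shows "g m = 0"
proof -
  define p where "p = (\<Sum>m\<le>K. monom (g m) m)"
  have "p = 0"
  proof (rule poly_infinite_zeros[of "UNIV - {0}"])
    show "infinite (UNIV - {0 :: real})" by (simp add: infinite_UNIV_char_0)
    show "poly p t = 0" if "t \<in> UNIV - {0}" for t
      using assms(1)[of t] that by (simp add: p_def poly_sum poly_monom mult.commute)
  qed
  hence "coeff p m = 0" by simp
  thus ?thesis using assms(2) by (simp add: p_def coeff_sum)
qed

text \<open>In the coordinates \<open>(x, y) = A + t ((1, 0) + s (\<kappa>, 1))\<close> a polynomial is homogeneous of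
  degree \<open>m\<close> about \<open>A\<close> iff it is \<open>t\<^sup>m c(s)\<close> with \<open>deg c \<le> m\<close>. The shear \<open>\<kappa>\<close> keeps the lines
  under consideration away from infinity.\<close>

definition homog :: "point \<Rightarrow> real \<Rightarrow> nat \<Rightarrow> real poly \<Rightarrow> real poly poly" where
  "homog A \<kappa> m c = (\<Sum>j\<le>m. Polynomial.smult [:coeff c j:]
     ([:[:\<kappa> * snd A - fst A, 1:], [:- \<kappa>:]:] ^ (m - j) * [:[:- snd A:], 1:] ^ j))"

lemma homog_add: "homog A \<kappa> m (c + d) = homog A \<kappa> m c + homog A \<kappa> m d"
  unfolding homog_def by (simp add: sum.distrib[symmetric] smult_add_left[symmetric])

lemma homog_smult: "homog A \<kappa> m (Polynomial.smult r c) = Polynomial.smult [:r:] (homog A \<kappa> m c)"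
  unfolding homog_def by (simp add: smult_sum_right mult.commute)

lemma poly2_homog:
  assumes "degree c \<le> m"
  shows "poly2 (homog A \<kappa> m c) (fst A + t + \<kappa> * t * s, snd A + t * s) = t ^ m * poly c s"
proof -
  have "poly2 (homog A \<kappa> m c) (fst A + t + \<kappa> * t * s, snd A + t * s) = (\<Sum>j\<le>m. coeff c j * (t ^ (m - j) * (t * s) ^ j))"
    unfolding homog_def poly2_sum by (rule sum.cong) (simp_all add: algebra_simps)
  also have "\<dots> = (\<Sum>j\<le>m. t ^ m * (coeff c j * s ^ j))"
    by (rule sum.cong) (simp_all add: power_mult_distrib mult.left_commute flip: power_add mult.assoc)
  also have "\<dots> = t ^ m * poly c s"
  proof -
    have "poly (\<Sum>j\<le>m. monom (coeff c j) j) s = poly c s"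
      by (subst poly_as_sum_of_monoms'[OF assms]) (rule refl)
    thus ?thesis by (simp add: poly_sum poly_monom flip: sum_distrib_left)
  qed
  finally show ?thesis .
qed

lemma homog_in_polys: "homog A \<kappa> m c \<in> polys m"
  unfolding homog_def
proof (intro polys_sum polys_smult)
  fix j assume "j \<in> {..m}"
  have "[:[:\<kappa> * snd A - fst A, 1:], [:- \<kappa>:]:] \<in> polys 1" "[:[:- snd A:], 1:] \<in> polys 1"
    by (auto simp: polys_def coeff_pCons one_pCons split: nat.splits)
  hence "[:[:\<kappa> * snd A - fst A, 1:], [:- \<kappa>:]:] ^ (m - j) * [:[:- snd A:], 1:] ^ j \<in> polys ((m - j) * 1 + j * 1)"
    by (intro polys_mult polys_power)
  thus "[:[:\<kappa> * snd A - fst A, 1:], [:- \<kappa>:]:] ^ (m - j) * [:[:- snd A:], 1:] ^ j \<in> polys m"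
    using \<open>j \<in> {..m}\<close> by simp
qed

text \<open>The coordinates (t, s) with t nonzero reach every point off the line t = 0, which is a
  nonempty open set.\<close>

lemma poly2_zero_if_shear:
  assumes "\<And>t s. t \<noteq> 0 \<Longrightarrow> poly2 p (fst A + t + \<kappa> * t * s, snd A + t * s) = 0"
  shows "p = 0"
proof (rule poly2_zero_on_open)
  define U where "U = {z :: point. fst z - fst A - \<kappa> * (snd z - snd A) \<noteq> 0}"
  show "open U" unfolding U_def by (intro open_Collect_neq continuous_intros)
  have "(fst A + 1, snd A) \<in> U" by (simp add: U_def)
  thus "U \<noteq> {}" by auto
  fix z assume "z \<in> U"
  define t where "t = fst z - fst A - \<kappa> * (snd z - snd A)"
  define s where "s = (snd z - snd A) / t"
  have t: "t \<noteq> 0" using \<open>z \<in> U\<close> by (simp add: U_def t_def)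
  have "t * s = snd z - snd A" using t by (simp add: s_def)
  hence "(fst A + t + \<kappa> * t * s, snd A + t * s) = z" by (simp add: t_def mult.assoc)
  thus "poly2 p z = 0" using assms[OF t, of s] by simp
qed

lemma homog_sum_inj:
  assumes "\<And>m. m \<le> K \<Longrightarrow> degree (h m) \<le> m" "(\<Sum>m\<le>K. homog A \<kappa> m (h m)) = 0" "m \<le> K"
  shows "h m = 0"
proof (rule poly_infinite_zeros[of UNIV])
  fix s
  show "poly (h m) s = 0"
  proof (rule graded_zero[where g = "\<lambda>m. poly (h m) s" and K = K])
    fix t :: real
    have "poly2 (\<Sum>m\<le>K. homog A \<kappa> m (h m)) (fst A + t + \<kappa> * t * s, snd A + t * s) = 0"
      using assms(2) by simp
    thus "(\<Sum>m\<le>K. t ^ m * poly (h m) s) = 0"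
      unfolding poly2_sum using assms(1) by (simp add: poly2_homog)
  qed fact
qed (simp add: infinite_UNIV_char_0)

text \<open>A dimension count: the map from the families of components to polynomials is injective
  by \<open>homog_sum_inj\<close>, and both sides have dimension
  \<open>(K + 2) choose 2\<close>.\<close>

lemma homog_surj:
  assumes "p \<in> polys K"
  obtains h where "\<And>m. m \<le> K \<Longrightarrow> degree (h m) \<le> m" "\<And>m. \<not> m \<le> K \<Longrightarrow> h m = 0"
    "p = (\<Sum>m\<le>K. homog A \<kappa> m (h m))"
proof -
  interpret u: vec_sp usc unfolding vec_sp_def by (rule vs_usc)
  interpret ps: vec_sp psc unfolding vec_sp_def by (rule vs_psc)
  interpret fs: vec_sp "\<lambda>c (w :: nat \<Rightarrow> real poly) i. usc c (w i)"
    unfolding vec_sp_def by (rule vector_space_fun[OF vs_usc])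
  interpret pr: vector_space_pair "\<lambda>c (w :: nat \<Rightarrow> real poly) i. usc c (w i)" psc ..
  define H where "H = {w :: nat \<Rightarrow> real poly. (\<forall>i\<in>{..K}. w i \<in> upolys i) \<and> (\<forall>i. i \<notin> {..K} \<longrightarrow> w i = 0)}"
  define f where "f h = (\<Sum>m\<le>K. homog A \<kappa> m (h m))" for h
  have H: "fs.V.subspace H" unfolding H_def
    by (rule u.subspace_direct_sum) (rule subspace_upolys)
  have "fs.V.dim H = (\<Sum>m\<le>K. m + 1)" unfolding H_def
    using u.dim_direct_sum(1)[of "{..K}" upolys] subspace_upolys fin_dim_upolys dim_upolys by simp
  also have "\<dots> = (K + 2) choose 2" by (induction K) (auto simp: choose_two numeral_2_eq_2)
  finally have dH: "fs.V.dim H = (K + 2) choose 2" .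
  have lin: "Vector_Spaces.linear (\<lambda>c w i. usc c (w i)) psc f"
    by (rule linear_intro[OF vector_space_fun[OF vs_usc] vs_psc])
      (simp_all add: f_def homog_add homog_smult sum.distrib smult_sum_right)
  have inj: "inj_on f H"
  proof (rule inj_onI)
    fix g h assume gh: "g \<in> H" "h \<in> H" "f g = f h"
    define k where "k = g - h"
    have k: "k \<in> H" unfolding k_def using fs.V.subspace_diff[OF H gh(1,2)] .
    have "f k = 0" unfolding k_def pr.linear_diff[OF lin] using gh(3) by simp
    hence "k m = 0" for m
      using homog_sum_inj[of K k A \<kappa> m] k unfolding H_def f_def by (cases "m \<le> K") auto
    thus "g = h" unfolding k_def by (auto simp: fun_eq_iff)
  qed
  have sub: "f ` H \<subseteq> polys K"
    unfolding f_def by (auto intro!: polys_sum intro: polys_mono[OF homog_in_polys])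
  have "f ` H = polys K"
  proof (rule ps.dim_eq_imp_eq[OF _ subspace_polys sub fin_dim_polys])
    show "ps.V.subspace (f ` H)" by (rule pr.linear_subspace_image[OF lin H])
    show "ps.V.dim (f ` H) = ps.V.dim (polys K)"
      using pr.dim_image_inj[OF lin H inj] dH dim_polys[of K] by simp
  qed
  then obtain h where "h \<in> H" "p = f h" using assms by auto
  thus ?thesis using that[of h] unfolding H_def f_def by auto
qed

lemma homog_0 [simp]: "homog A \<kappa> m 0 = 0"
  by (simp add: homog_def)

text \<open>The space W[A] over an arbitrary index set of lines through one point; see
  \<open>W_eq\<close>.\<close>

definition line_syz :: "'i set \<Rightarrow> ('i \<Rightarrow> real poly poly) \<Rightarrow> nat \<Rightarrow> nat \<Rightarrow> ('i \<Rightarrow> real poly poly) set" where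
  "line_syz I L \<mu> K = {w. (\<forall>i. w i \<in> polys K) \<and> (\<forall>i. i \<notin> I \<longrightarrow> w i = 0) \<and> (\<Sum>i\<in>I. w i * L i ^ (\<mu> + 1)) = 0}"

text \<open>In shear coordinates \<open>L i\<close> becomes t times the univariate form
  \<open>lf i\<close>, so the relation becomes t^(\<mu>+1) times a polynomial in t whose m-th
  coefficient is a relation among powers of the \<open>lf i\<close> with coefficients of degree at
  most m. Each coefficient vanishes separately, so the space is the isomorphic image under
  \<open>\<rho>\<close> of the direct sum of the spaces \<open>syz\<close>.\<close>

lemma
  fixes L :: "'i \<Rightarrow> real poly poly"
  assumes I: "finite I"
    and L: "\<And>i. i \<in> I \<Longrightarrow> L i \<in> polys 1" "\<And>i. i \<in> I \<Longrightarrow> L i \<noteq> 0" "\<And>i. i \<in> I \<Longrightarrow> poly2 (L i) A = 0"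
    and dist: "\<And>i j. i \<in> I \<Longrightarrow> j \<in> I \<Longrightarrow> {z. poly2 (L i) z = 0} = {z. poly2 (L j) z = 0} \<Longrightarrow> i = j"
  shows dim_line_syz: "vector_space.dim (\<lambda>c w i. psc c (w i)) (line_syz I L \<mu> K)
      = (\<Sum>m\<le>K. card I * (m + 1) - (m + \<mu> + 2))"
    and subspace_line_syz: "Modules.module.subspace (\<lambda>c w i. psc c (w i)) (line_syz I L \<mu> K)"
    and fin_dim_line_syz: "fin_dim (\<lambda>c w i. psc c (w i)) (line_syz I L \<mu> K)"
proof -
  define b where "b i = coeff (coeff (L i) 0) 1" for i
  define c where "c i = coeff (coeff (L i) 1) 0" for i
  have Lz: "poly2 (L i) z = b i * (fst z - fst A) + c i * (snd z - snd A)" if i: "i \<in> I" for i z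
  proof -
    obtain a' b' c' where L': "L i = [:[:a', b':], [:c':]:]" by (rule polys_1D[OF L(1)[OF i]])
    have "b' = b i" "c' = c i" unfolding b_def c_def L' by simp_all
    moreover have "a' = - (b' * fst A + c' * snd A)" using L(3)[OF i] unfolding L' by (simp add: algebra_simps)
    ultimately show ?thesis unfolding L' by (simp add: algebra_simps)
  qed
  have bc: "b i \<noteq> 0 \<or> c i \<noteq> 0" if i: "i \<in> I" for i
  proof (rule ccontr)
    assume "\<not> (b i \<noteq> 0 \<or> c i \<noteq> 0)"
    hence "poly2 (L i) z = poly2 0 z" for z using Lz[OF i] by simp
    hence "L i = 0" by (rule poly2_eqI)
    thus False using L(2)[OF i] by simp
  qed
  \<comment> \<open>The form \<open>L i\<close> becomes t (b i + (b i \<kappa> + c i) s). Avoiding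
    finitely many \<kappa> makes every coefficient of s nonzero, so each line has a finite root
    \<open>a i\<close>.\<close>
  have "finite {\<kappa>. b i * \<kappa> + c i = 0}" if "i \<in> I" for i
  proof (rule finite_subset)
    show "{\<kappa>. b i * \<kappa> + c i = 0} \<subseteq> {- c i / b i}"
    proof
      fix \<kappa> assume "\<kappa> \<in> {\<kappa>. b i * \<kappa> + c i = 0}"
      hence "b i * \<kappa> = - c i" "b i \<noteq> 0" using bc[OF that] by auto
      thus "\<kappa> \<in> {- c i / b i}" by (simp add: field_simps)
    qed
  qed simp
  hence "finite (\<Union>i\<in>I. {\<kappa>. b i * \<kappa> + c i = 0})" using I by blast
  then obtain \<kappa> where "\<kappa> \<notin> (\<Union>i\<in>I. {\<kappa>. b i * \<kappa> + c i = 0})"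
    by (rule exE[OF ex_new_if_finite[OF infinite_UNIV_char_0]])
  hence \<kappa>: "b i * \<kappa> + c i \<noteq> 0" if "i \<in> I" for i using that by auto
  define e where "e i = b i * \<kappa> + c i" for i
  define a where "a i = - b i / e i" for i
  define lf where "lf i = Polynomial.smult (e i) (lin (a i))" for i
  have e: "e i \<noteq> 0" if "i \<in> I" for i using \<kappa>[OF that] e_def by simp
  have Lshear: "poly2 (L i) (fst A + t + \<kappa> * t * s, snd A + t * s) = t * poly (lf i) s" if "i \<in> I" for i t s
  proof -
    have "poly (lf i) s = e i * s + b i"
      using e[OF that] unfolding lf_def a_def by (simp add: field_simps)
    thus ?thesis unfolding Lz[OF that] by (simp add: e_def algebra_simps)
  qed
  have inj: "inj_on a I"
  proof (rule inj_onI)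
    fix i j assume ij: "i \<in> I" "j \<in> I" "a i = a j"
    have L': "poly2 (L i) z = e i * (- a i * (fst z - fst A - \<kappa> * (snd z - snd A)) + (snd z - snd A))" if "i \<in> I" for i z
      using e[OF that] unfolding Lz[OF that] a_def by (simp add: field_simps) (simp add: e_def algebra_simps)
    have "{z. poly2 (L i) z = 0} = {z. poly2 (L j) z = 0}"
      using L'[OF ij(1)] L'[OF ij(2)] e ij by auto
    thus "i = j" using dist ij by blast
  qed
  note syz = dim_syz[OF I inj lf_def e] subspace_syz[OF I inj lf_def e] fin_dim_syz[OF I inj lf_def e]
  interpret u: vec_sp "\<lambda>c (w :: 'i \<Rightarrow> real poly) i. usc c (w i)"
    unfolding vec_sp_def by (rule vector_space_fun[OF vs_usc])
  interpret p: vector_space_pair "\<lambda>c (w :: nat \<Rightarrow> 'i \<Rightarrow> real poly) m i. usc c (w m i)" "\<lambda>c (w :: 'i \<Rightarrow> real poly poly) i. psc c (w i)"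
    unfolding vector_space_pair_def using vector_space_fun[OF vector_space_fun[OF vs_usc]] vector_space_fun[OF vs_psc]
    by (intro conjI)
  define H where "H = {h :: nat \<Rightarrow> 'i \<Rightarrow> real poly. (\<forall>m\<in>{..K}. h m \<in> syz I lf \<mu> m) \<and> (\<forall>m. m \<notin> {..K} \<longrightarrow> h m = 0)}"
  have H: "p.vs1.subspace H" unfolding H_def
    by (rule u.subspace_direct_sum) (rule syz(2))
  have dH: "p.vs1.dim H = (\<Sum>m\<le>K. card I * (m + 1) - (m + \<mu> + 2))"
    unfolding H_def by (subst u.dim_direct_sum(1)) (simp_all add: syz)
  have fH: "fin_dim (\<lambda>c (w :: nat \<Rightarrow> 'i \<Rightarrow> real poly) m i. usc c (w m i)) H"
    unfolding H_def by (rule u.dim_direct_sum(2)) (simp_all add: syz)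
  define \<rho> where "\<rho> h i = (\<Sum>m\<le>K. homog A \<kappa> m (h m i))" for h :: "nat \<Rightarrow> 'i \<Rightarrow> real poly" and i
  have lin: "Vector_Spaces.linear (\<lambda>c w m i. usc c (w m i)) (\<lambda>c w i. psc c (w i)) \<rho>"
  proof (rule linear_intro[OF vector_space_fun[OF vector_space_fun[OF vs_usc]] vector_space_fun[OF vs_psc]])
    show "\<rho> (x + y) = \<rho> x + \<rho> y" for x y
      unfolding fun_eq_iff \<rho>_def by (simp add: homog_add sum.distrib)
    show "\<rho> (\<lambda>m i. usc c (x m i)) = (\<lambda>i. psc c (\<rho> x i))" for c x
      unfolding fun_eq_iff \<rho>_def by (simp add: homog_smult smult_sum_right)
  qed
  have deg: "degree (h m i) \<le> m" if "h \<in> H" "m \<le> K" for h m i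
    using that unfolding H_def syz_def by (cases "i \<in> I") auto
  have inj\<rho>: "inj_on \<rho> H"
  proof (rule inj_onI)
    fix g h assume gh: "g \<in> H" "h \<in> H" "\<rho> g = \<rho> h"
    define k where "k = g - h"
    have k: "k \<in> H" unfolding k_def using p.vs1.subspace_diff[OF H gh(1,2)] .
    have \<rho>k: "\<rho> k = 0" unfolding k_def p.linear_diff[OF lin] using gh(3) by simp
    have "k m i = 0" for m i
    proof (cases "m \<le> K")
      case True
      show ?thesis
      proof (rule homog_sum_inj[where h = "\<lambda>m. k m i" and K = K])
        show "(\<Sum>m\<le>K. homog A \<kappa> m (k m i)) = 0" using fun_cong[OF \<rho>k, of i] by (simp add: \<rho>_def)
      qed (use True deg[OF k] in auto)
    qed (use k in \<open>simp add: H_def\<close>)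
    thus "g = h" unfolding k_def by (auto simp: fun_eq_iff)
  qed
  have eval: "poly2 (\<Sum>i\<in>I. (\<Sum>m\<le>K. homog A \<kappa> m (h m i)) * L i ^ (\<mu> + 1)) (fst A + t + \<kappa> * t * s, snd A + t * s)
      = t ^ (\<mu> + 1) * (\<Sum>m\<le>K. t ^ m * poly (\<Sum>i\<in>I. h m i * lf i ^ (\<mu> + 1)) s)"
    if "\<And>m i. m \<le> K \<Longrightarrow> degree (h m i) \<le> m" for h :: "nat \<Rightarrow> 'i \<Rightarrow> real poly" and t s
  proof -
    have "poly2 (\<Sum>i\<in>I. (\<Sum>m\<le>K. homog A \<kappa> m (h m i)) * L i ^ (\<mu> + 1)) (fst A + t + \<kappa> * t * s, snd A + t * s)
      = (\<Sum>i\<in>I. (\<Sum>m\<le>K. t ^ m * poly (h m i) s) * (t * poly (lf i) s) ^ (\<mu> + 1))"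
      unfolding poly2_sum poly2_mult poly2_power using that Lshear
      by (intro sum.cong) (simp_all add: poly2_homog)
    also have "\<dots> = (\<Sum>m\<le>K. \<Sum>i\<in>I. t ^ (\<mu> + 1) * (t ^ m * (poly (h m i) s * poly (lf i) s ^ (\<mu> + 1))))"
      unfolding sum_distrib_right by (subst sum.swap) (simp add: power_mult_distrib ac_simps)
    also have "\<dots> = t ^ (\<mu> + 1) * (\<Sum>m\<le>K. t ^ m * poly (\<Sum>i\<in>I. h m i * lf i ^ (\<mu> + 1)) s)"
      unfolding poly_sum poly_mult poly_power sum_distrib_left by (rule refl)
    finally show ?thesis .
  qed
  have im: "\<rho> ` H = line_syz I L \<mu> K"
  proof (intro equalityI subsetI)
    fix w assume "w \<in> \<rho> ` H"
    then obtain h where h: "h \<in> H" "w = \<rho> h" by auto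
    have "(\<Sum>i\<in>I. w i * L i ^ (\<mu> + 1)) = 0" unfolding h(2) \<rho>_def
    proof (rule poly2_zero_if_shear)
      fix t s :: real
      have "(\<Sum>m\<le>K. t ^ m * poly (\<Sum>i\<in>I. h m i * lf i ^ (\<mu> + 1)) s) = 0"
        using h(1) unfolding H_def syz_def by (intro sum.neutral) auto
      thus "poly2 (\<Sum>i\<in>I. (\<Sum>m\<le>K. homog A \<kappa> m (h m i)) * L i ^ (\<mu> + 1)) (fst A + t + \<kappa> * t * s, snd A + t * s) = 0"
        by (subst eval) (use deg[OF h(1)] in auto)
    qed
    moreover have "w i \<in> polys K" for i
      unfolding h(2) \<rho>_def by (intro polys_sum) (auto intro: polys_mono[OF homog_in_polys])
    moreover have "w i = 0" if "i \<notin> I" for i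
      using h that unfolding \<rho>_def H_def syz_def by simp
    ultimately show "w \<in> line_syz I L \<mu> K" unfolding line_syz_def by simp
  next
    fix w assume w: "w \<in> line_syz I L \<mu> K"
    have "\<forall>i. \<exists>h. (\<forall>m\<le>K. degree (h m) \<le> m) \<and> w i = (\<Sum>m\<le>K. homog A \<kappa> m (h m))"
    proof
      fix i
      have "w i \<in> polys K" using w unfolding line_syz_def by simp
      thus "\<exists>h. (\<forall>m\<le>K. degree (h m) \<le> m) \<and> w i = (\<Sum>m\<le>K. homog A \<kappa> m (h m))"
      proof (rule homog_surj[where A = A and \<kappa> = \<kappa>])
        fix h assume "\<And>m. m \<le> K \<Longrightarrow> degree (h m) \<le> m" "\<And>m. \<not> m \<le> K \<Longrightarrow> h m = 0" "w i = (\<Sum>m\<le>K. homog A \<kappa> m (h m))"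
        thus ?thesis by (intro exI[of _ h]) simp
      qed
    qed
    from choice[OF this] obtain h0 where
      "\<forall>i. (\<forall>m\<le>K. degree (h0 i m) \<le> m) \<and> w i = (\<Sum>m\<le>K. homog A \<kappa> m (h0 i m))" ..
    hence h0: "\<And>i m. m \<le> K \<Longrightarrow> degree (h0 i m) \<le> m" "\<And>i. w i = (\<Sum>m\<le>K. homog A \<kappa> m (h0 i m))"
      by auto
    define h where "h m i = (if m \<le> K \<and> i \<in> I then h0 i m else 0)" for m i
    have hw: "w i = (\<Sum>m\<le>K. homog A \<kappa> m (h m i))" for i
      using w h0(2)[of i] unfolding line_syz_def h_def by (cases "i \<in> I") simp_all
    have dh: "degree (h m i) \<le> m" if "m \<le> K" for m i using h0(1) that unfolding h_def by simp
    have "(\<Sum>i\<in>I. h m i * lf i ^ (\<mu> + 1)) = 0" if m: "m \<le> K" for m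
    proof (rule poly_infinite_zeros[of UNIV])
      fix s
      show "poly (\<Sum>i\<in>I. h m i * lf i ^ (\<mu> + 1)) s = 0"
      proof (rule graded_zero[OF _ m])
        fix t :: real assume t: "t \<noteq> 0"
        have "t ^ (\<mu> + 1) * (\<Sum>m\<le>K. t ^ m * poly (\<Sum>i\<in>I. h m i * lf i ^ (\<mu> + 1)) s)
            = poly2 (\<Sum>i\<in>I. w i * L i ^ (\<mu> + 1)) (fst A + t + \<kappa> * t * s, snd A + t * s)"
          unfolding hw by (rule eval[OF dh, symmetric])
        also have "\<dots> = 0" using w unfolding line_syz_def by (simp del: power_Suc add_0_right)
        finally have "t ^ (\<mu> + 1) * (\<Sum>m\<le>K. t ^ m * poly (\<Sum>i\<in>I. h m i * lf i ^ (\<mu> + 1)) s) = 0" .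
        thus "(\<Sum>m\<le>K. t ^ m * poly (\<Sum>i\<in>I. h m i * lf i ^ (\<mu> + 1)) s) = 0" using t by simp
      qed
    qed (simp add: infinite_UNIV_char_0)
    moreover have "h m i = 0" if "i \<notin> I" for m i using that by (simp add: h_def)
    moreover have "h m = 0" if "\<not> m \<le> K" for m using that by (simp add: h_def fun_eq_iff)
    ultimately have "h \<in> H" unfolding H_def syz_def using dh by simp
    moreover have "w = \<rho> h" unfolding fun_eq_iff \<rho>_def using hw by simp
    ultimately show "w \<in> \<rho> ` H" by (simp add: imageI)
  qed
  show "p.vs2.dim (line_syz I L \<mu> K) = (\<Sum>m\<le>K. card I * (m + 1) - (m + \<mu> + 2))"
    unfolding im[symmetric] using p.dim_image_inj[OF lin H inj\<rho>] dH by simp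
  show "p.vs2.subspace (line_syz I L \<mu> K)"
    unfolding im[symmetric] by (rule p.linear_subspace_image[OF lin H])
  show "fin_dim (\<lambda>c w i. psc c (w i)) (line_syz I L \<mu> K)"
    unfolding im[symmetric] by (rule p.fin_dim_image[OF lin fH])
qed

text \<open>The substitution m = d - \<mu> - j matches the summands; truncated subtraction on nat is
  the maximum with 0.\<close>

lemma k_dim_conv:
  assumes "\<mu> < d"
  shows "int (\<Sum>m\<le>d - \<mu> - 1. N * (m + 1) - (m + \<mu> + 2)) = k_dim d \<mu> N"
proof -
  have "k_dim d \<mu> N = (\<Sum>j=1..d - \<mu>. int (N * (d - \<mu> - j + 1) - (d - \<mu> - j + \<mu> + 2)))"
    unfolding k_dim_def
  proof (rule sum.cong[OF refl])
    fix j assume j: "j \<in> {1..d - \<mu>}"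
    have *: "int (d - \<mu> - j + 1) = int d - int \<mu> - int j + 1" "int (d - \<mu> - j + \<mu> + 2) = int d - int j + 2"
      using j assms by auto
    show "max 0 (int N * (int d - int \<mu> - int j + 1) - (int d - int j + 2))
        = int (N * (d - \<mu> - j + 1) - (d - \<mu> - j + \<mu> + 2))"
      unfolding *[symmetric] of_nat_mult[symmetric] by linarith
  qed
  also have "\<dots> = (\<Sum>m\<le>d - \<mu> - 1. int (N * (m + 1) - (m + \<mu> + 2)))"
    by (rule sum.reindex_bij_witness[of _ "\<lambda>m. d - \<mu> - m" "\<lambda>j. d - \<mu> - j"]) (use assms in auto)
  finally show ?thesis by simp
qed

subsection \<open>Edges and \<open>l\<close>-edges\<close>

definition lexl :: "point \<Rightarrow> point \<Rightarrow> bool" where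
  "lexl a b \<longleftrightarrow> fst a < fst b \<or> fst a = fst b \<and> snd a < snd b"

lemma lexl_irrefl [simp]: "\<not> lexl a a"
  and lexl_trans: "lexl a b \<Longrightarrow> lexl b c \<Longrightarrow> lexl a c"
  and lexl_total: "a \<noteq> b \<Longrightarrow> lexl a b \<or> lexl b a"
  and lexl_asym: "lexl a b \<Longrightarrow> \<not> lexl b a"
  by (auto simp: lexl_def prod_eq_iff)

text \<open>Lexicographically smallest and largest end points, so that edges and \<open>l\<close>-edges are oriented
  consistently.\<close>

definition lo :: "point set \<Rightarrow> point" where
  "lo S = (THE a. a \<in> S \<and> (\<forall>b\<in>S. a = b \<or> lexl a b))"

definition hi :: "point set \<Rightarrow> point" where
  "hi S = (THE a. a \<in> S \<and> (\<forall>b\<in>S. a = b \<or> lexl b a))"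

lemma lo_eqI: "a \<in> S \<Longrightarrow> (\<And>b. b \<in> S \<Longrightarrow> a = b \<or> lexl a b) \<Longrightarrow> lo S = a"
  unfolding lo_def by (rule the_equality) (use lexl_asym in blast)+

lemma hi_eqI: "a \<in> S \<Longrightarrow> (\<And>b. b \<in> S \<Longrightarrow> a = b \<or> lexl b a) \<Longrightarrow> hi S = a"
  unfolding hi_def by (rule the_equality) (use lexl_asym in blast)+

lemma lo_hi_card2:
  assumes "card e = 2"
  shows "e = {lo e, hi e}" "lexl (lo e) (hi e)"
proof -
  obtain x y where xy: "e = {x, y}" "x \<noteq> y" using assms unfolding card_2_iff by blast
  obtain a b where ab: "e = {a, b}" "lexl a b"
  proof (cases "lexl x y")
    case True
    thus ?thesis using that[of x y] xy by simp
  next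
    case False
    hence "lexl y x" using lexl_total xy by blast
    thus ?thesis using that[of y x] xy by (simp add: insert_commute)
  qed
  have "lo e = a" "hi e = b" using ab by (auto intro: lo_eqI hi_eqI)
  thus "e = {lo e, hi e}" "lexl (lo e) (hi e)" using ab by auto
qed

abbreviation seg :: "point set \<Rightarrow> point set" where "seg e \<equiv> convex hull e"

abbreviation ray :: "point \<Rightarrow> point \<Rightarrow> real \<Rightarrow> point" where "ray p u \<equiv> \<lambda>r. p + r *\<^sub>R u"

lemma inj_ray: "u \<noteq> 0 \<Longrightarrow> ray p u s = ray p u t \<longleftrightarrow> s = t"
  by simp

lemma closed_segment_ray: "s \<le> t \<Longrightarrow> closed_segment (ray p u s) (ray p u t) = ray p u ` {s..t}"
  using closed_segment_translation[of p "s *\<^sub>R u" "t *\<^sub>R u"]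
    closed_segment_linear_image[of "\<lambda>r. r *\<^sub>R u" s t] closed_segment_eq_real_ivl[of s t]
  by (simp add: linear_iff algebra_simps image_image)

lemma open_segment_ray:
  assumes "u \<noteq> 0" "s < t"
  shows "open_segment (ray p u s) (ray p u t) = ray p u ` {s<..<t}"
proof -
  have "ray p u ` ({s..t} - {s, t}) = ray p u ` {s..t} - ray p u ` {s, t}"
    using assms(1) by (intro image_set_diff) (simp add: inj_on_def)
  moreover have "{s..t} - {s, t} = {s<..<t}" by auto
  ultimately show ?thesis
    unfolding open_segment_def closed_segment_ray[OF less_imp_le[OF assms(2)]] by simp
qed

lemma ray_affine_hull: "x \<in> affine hull {a, b} \<Longrightarrow> \<exists>r. x = ray a (b - a) r"
  unfolding affine_hull_2_alt by auto

lemma ray_in_affine_hull: "ray a (b - a) r \<in> affine hull {a, b}"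
  unfolding affine_hull_2_alt by auto

lemma affine_hull_two_points:
  assumes "p \<in> affine hull {a, b}" "q \<in> affine hull {a, b}" "p \<noteq> q"
  shows "affine hull {p, q} = affine hull {a, b :: point}"
proof
  show "affine hull {p, q} \<subseteq> affine hull {a, b}"
    using assms by (intro hull_minimal) auto
  obtain s t where st: "p = ray a (b - a) s" "q = ray a (b - a) t"
    using assms(1,2) ray_affine_hull by metis
  hence ne: "t - s \<noteq> 0" using assms(3) by auto
  define v where "v = b - a"
  have pq: "p = a + s *\<^sub>R v" "q - p = (t - s) *\<^sub>R v" unfolding st v_def by (simp_all add: algebra_simps)
  have "ray a v r \<in> affine hull {p, q}" for r
  proof -
    have "((r - s) / (t - s)) *\<^sub>R (q - p) = (r - s) *\<^sub>R v" unfolding pq(2) using ne by simp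
    hence "ray p (q - p) ((r - s) / (t - s)) = ray a v r" unfolding pq(1) by (simp add: algebra_simps)
    thus ?thesis using ray_in_affine_hull[where a = p and b = q and r = "(r - s) / (t - s)"] by simp
  qed
  thus "affine hull {a, b} \<subseteq> affine hull {p, q}"
    unfolding v_def using ray_affine_hull[of _ a b] by blast
qed

lemma affine_hull_closed_segment': "affine hull (closed_segment a b) = affine hull {a, b}"
  by (simp add: segment_convex_hull affine_hull_convex_hull)

lemma lexl_ray: "lexl 0 u \<Longrightarrow> lexl (ray p u s) (ray p u t) \<longleftrightarrow> s < t"
  unfolding lexl_def by auto

lemma lexl_diff: "lexl a b \<longleftrightarrow> lexl 0 (b - a)"
  unfolding lexl_def by auto

lemma lo_hi_closed_segment:
  assumes "lexl a b"
  shows "lo (closed_segment a b) = a" "hi (closed_segment a b) = b"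
proof -
  have u: "lexl 0 (b - a)" using assms lexl_diff by blast
  have cs: "closed_segment a b = ray a (b - a) ` {0..1}"
    using closed_segment_ray[of 0 1 a "b - a"] by simp
  have "a = c \<or> lexl a c" "b = c \<or> lexl c b" if c: "c \<in> closed_segment a b" for c
  proof -
    obtain r where r: "c = ray a (b - a) r" "r \<in> {0..1}" using c unfolding cs by (rule imageE)
    show "a = c \<or> lexl a c" using lexl_ray[OF u, of a 0 r] r by (cases "r = 0") auto
    show "b = c \<or> lexl c b" using lexl_ray[OF u, of a r 1] r by (cases "r = 1") auto
  qed
  thus "lo (closed_segment a b) = a" "hi (closed_segment a b) = b"
    by (auto intro!: lo_eqI hi_eqI)
qed

section \<open>Edges of a partition and the segments composed of them\<close>

locale partition =
  fixes \<Psi> :: "point set" and \<Delta> :: "point set set"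
  assumes rp: "rectilinear_partition \<Psi> \<Delta>"
begin

abbreviation "IV \<equiv> interior_vertices \<Psi> \<Delta>"
abbreviation "IE \<equiv> interior_edges \<Psi> \<Delta>"
abbreviation "LE \<equiv> l_edges \<Psi> \<Delta>"

lemma open_domain: "open \<Psi>" and connected_domain: "connected \<Psi>" and domain_ne: "\<Psi> \<noteq> {}"
  and finite_edges: "finite \<Delta>"
  and card_edge: "e \<in> \<Delta> \<Longrightarrow> card e = 2" and seg_closure: "e \<in> \<Delta> \<Longrightarrow> seg e \<subseteq> closure \<Psi>"
  and seg_Int: "e \<in> \<Delta> \<Longrightarrow> f \<in> \<Delta> \<Longrightarrow> e \<noteq> f \<Longrightarrow> seg e \<inter> seg f = e \<inter> f"
  and frontier_cover: "frontier \<Psi> \<subseteq> \<Union>{convex hull e |e. e \<in> \<Delta> \<and> convex hull e \<subseteq> frontier \<Psi>}"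
  using rp unfolding rectilinear_partition_def by auto

lemma IV_def: "IV = \<Union>\<Delta> \<inter> \<Psi>"
  unfolding interior_vertices_def using open_domain by (simp add: interior_open)

lemma IE_subset: "IE \<subseteq> \<Delta>" and finite_IE: "finite IE"
  unfolding interior_edges_def using finite_edges by auto

lemma edge_eq: "e \<in> \<Delta> \<Longrightarrow> e = {lo e, hi e}" and edge_lexl: "e \<in> \<Delta> \<Longrightarrow> lexl (lo e) (hi e)"
  using lo_hi_card2[OF card_edge] by auto

lemma lo_ne_hi: "e \<in> \<Delta> \<Longrightarrow> lo e \<noteq> hi e"
  using edge_lexl by fastforce

lemma lo_in: "e \<in> \<Delta> \<Longrightarrow> lo e \<in> e" and hi_in: "e \<in> \<Delta> \<Longrightarrow> hi e \<in> e"
  using edge_eq by blast+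

lemma seg_eq: "e \<in> \<Delta> \<Longrightarrow> seg e = closed_segment (lo e) (hi e)"
  using edge_eq segment_convex_hull by metis

lemma domain_frontier: "\<Psi> \<inter> frontier \<Psi> = {}" "closure \<Psi> = \<Psi> \<union> frontier \<Psi>"
  using open_domain closure_subset by (auto simp: frontier_def interior_open)

text \<open>A vertex belongs to some edge, and two different edges meet only in common end
  points.\<close>

lemma vertex_on_edge:
  assumes "z \<in> \<Union>\<Delta>" "e \<in> \<Delta>" "z \<in> seg e"
  shows "z \<in> e"
proof -
  obtain f where f: "f \<in> \<Delta>" "z \<in> f" using assms(1) by blast
  show ?thesis
  proof (cases "e = f")
    case False
    have "z \<in> seg f" using f(2) by (simp add: hull_inc)
    thus ?thesis using seg_Int[OF assms(2) f(1) False] assms(3) by blast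
  qed (use f in simp)
qed

lemma edge_at_interior: "e \<in> \<Delta> \<Longrightarrow> z \<in> e \<Longrightarrow> z \<in> \<Psi> \<Longrightarrow> e \<in> IE"
  unfolding interior_edges_def using domain_frontier(1) hull_inc[of z e convex] by blast

text \<open>A frontier point strictly inside \<open>e\<close> would lie on an edge contained in the
  frontier. That edge differs from \<open>e\<close>, and different edges share only
  vertices.\<close>

lemma open_seg_domain:
  assumes "e \<in> IE"
  shows "open_segment (lo e) (hi e) \<subseteq> \<Psi>"
proof
  fix z assume z: "z \<in> open_segment (lo e) (hi e)"
  have e: "e \<in> \<Delta>" "\<not> seg e \<subseteq> frontier \<Psi>" using assms unfolding interior_edges_def by auto
  have ze: "z \<in> seg e" "z \<notin> e" using z seg_eq[OF e(1)] edge_eq[OF e(1)] unfolding open_segment_def by auto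
  show "z \<in> \<Psi>"
  proof (rule ccontr)
    assume "z \<notin> \<Psi>"
    hence "z \<in> frontier \<Psi>" using ze(1) seg_closure[OF e(1)] domain_frontier(2) by blast
    then obtain f where f: "f \<in> \<Delta>" "z \<in> seg f" "seg f \<subseteq> frontier \<Psi>" using frontier_cover by blast
    have "e \<noteq> f" using f(3) e(2) by blast
    thus False using seg_Int[OF e(1) f(1)] ze f(2) by blast
  qed
qed

lemma composed_edge:
  assumes "e \<in> IE"
  shows "composed_segment \<Psi> \<Delta> (lo e) (hi e)"
proof -
  have e: "e \<in> \<Delta>" using assms IE_subset by blast
  have "{e} \<subseteq> IE \<and> closed_segment (lo e) (hi e) = \<Union>((hull) convex ` {e})" using assms seg_eq[OF e] by auto
  thus ?thesis unfolding composed_segment_def using lo_ne_hi[OF e] open_seg_domain[OF assms] by blast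
qed

lemma composed_commute: "composed_segment \<Psi> \<Delta> a b \<longleftrightarrow> composed_segment \<Psi> \<Delta> b a"
  unfolding composed_segment_def by (auto simp: closed_segment_commute open_segment_commute)

text \<open>On the common line both segments are intervals that meet in \<open>c\<close>. The only
  point of the open union that can lie in neither open segment is \<open>c\<close> itself, and it
  belongs to \<Psi>. At a frontier point the union would not be a composed segment, in accordance
  with l-edges ending there.\<close>

lemma composed_Un:
  assumes c1: "composed_segment \<Psi> \<Delta> a b" and c2: "composed_segment \<Psi> \<Delta> a' b'"
    and col: "a' \<in> affine hull {a, b}" "b' \<in> affine hull {a, b}"
    and c: "c \<in> \<Psi>" "c \<in> closed_segment a b" "c \<in> closed_segment a' b'"
  obtains a'' b'' where "composed_segment \<Psi> \<Delta> a'' b''"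
    "closed_segment a'' b'' = closed_segment a b \<union> closed_segment a' b'"
proof -
  define u where "u = b - a"
  have u0: "u \<noteq> 0" using c1 unfolding composed_segment_def u_def by auto
  have "\<exists>s t. s < t \<and> composed_segment \<Psi> \<Delta> (ray a u s) (ray a u t) \<and> closed_segment a' b' = closed_segment (ray a u s) (ray a u t)"
  proof -
    obtain s where s: "a' = ray a u s" using ray_affine_hull[OF col(1)] unfolding u_def by blast
    obtain t where t: "b' = ray a u t" using ray_affine_hull[OF col(2)] unfolding u_def by blast
    have "s \<noteq> t" using c2 s t unfolding composed_segment_def by auto
    thus ?thesis using c2 s t composed_commute closed_segment_commute by (metis linorder_neqE)
  qed
  then obtain s t where st: "s < t" "composed_segment \<Psi> \<Delta> (ray a u s) (ray a u t)"
    "closed_segment a' b' = ray a u ` {s..t}" using closed_segment_ray[of _ _ a u] by (metis less_imp_le)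
  have ab: "closed_segment a b = ray a u ` {0..1}" using closed_segment_ray[of 0 1 a u] by (simp add: u_def)
  have o1: "ray a u ` {0<..<1} \<subseteq> \<Psi>"
    using c1 open_segment_ray[OF u0, of 0 1 a] unfolding composed_segment_def by (simp add: u_def)
  have o2: "ray a u ` {s<..<t} \<subseteq> \<Psi>"
    using st(2) open_segment_ray[OF u0 st(1), of a] unfolding composed_segment_def by simp
  obtain r where r: "c = ray a u r" "r \<in> {0..1}" "r \<in> {s..t}"
  proof -
    obtain r r' where "c = ray a u r" "r \<in> {0..1}" "c = ray a u r'" "r' \<in> {s..t}"
      using c(2,3) unfolding ab st(3) by blast
    thus ?thesis using that[of r] u0 by simp
  qed
  define s' t' where "s' = min 0 s" "t' = max 1 t"
  have st': "s' < t'" unfolding s'_t'_def by simp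
  have un: "{s'..t'} = {0..1} \<union> {s..t}" unfolding s'_t'_def using r by auto
  show ?thesis
  proof (rule that)
    show eq: "closed_segment (ray a u s') (ray a u t') = closed_segment a b \<union> closed_segment a' b'"
      unfolding ab st(3) closed_segment_ray[OF less_imp_le[OF st']] un by (rule image_Un)
    have "open_segment (ray a u s') (ray a u t') \<subseteq> \<Psi>"
      unfolding open_segment_ray[OF u0 st']
    proof (rule image_subsetI)
      fix x assume x: "x \<in> {s'<..<t'}"
      show "ray a u x \<in> \<Psi>"
      proof (cases "x \<in> {0<..<1} \<or> x \<in> {s<..<t}")
        case True
        thus ?thesis using o1 o2 by blast
      next
        case False
        hence "x = r" using x r unfolding s'_t'_def by (auto simp: min_def max_def split: if_splits)
        thus ?thesis using r(1) c(1) by simp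
      qed
    qed
    moreover obtain F1 where "F1 \<subseteq> IE" "closed_segment a b = \<Union>((hull) convex ` F1)"
      using c1 unfolding composed_segment_def by blast
    moreover obtain F2 where "F2 \<subseteq> IE" "closed_segment a' b' = \<Union>((hull) convex ` F2)"
      using c2 unfolding composed_segment_def by blast
    ultimately show "composed_segment \<Psi> \<Delta> (ray a u s') (ray a u t')"
      unfolding composed_segment_def eq using st' u0
      by (intro conjI exI[of _ "F1 \<union> F2"]) (auto simp: image_Un)
  qed
qed

lemma finite_composed: "finite {closed_segment a b |a b. composed_segment \<Psi> \<Delta> a b}"
proof (rule finite_subset)
  show "{closed_segment a b |a b. composed_segment \<Psi> \<Delta> a b} \<subseteq> (\<lambda>F. \<Union>((hull) convex ` F)) ` Pow IE"
    unfolding composed_segment_def by blast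
qed (simp add: finite_IE)

lemma finite_LE: "finite LE"
  by (rule finite_subset[OF _ finite_composed]) (auto simp: l_edges_def l_edge_def)

lemma l_edge_obtain:
  assumes "l \<in> LE"
  obtains a b where "lexl a b" "l_edge \<Psi> \<Delta> a b" "l = closed_segment a b" "lo l = a" "hi l = b"
proof -
  obtain a b where ab: "l_edge \<Psi> \<Delta> a b" "l = closed_segment a b" using assms unfolding l_edges_def by blast
  have "a \<noteq> b" using ab(1) unfolding l_edge_def composed_segment_def by blast
  have ba: "l_edge \<Psi> \<Delta> b a" "l = closed_segment b a"
    using ab unfolding l_edge_def by (auto simp: composed_commute closed_segment_commute)
  show ?thesis using lexl_total[OF \<open>a \<noteq> b\<close>] that ab ba lo_hi_closed_segment by metis
qed

text \<open>A composed segment is the union of a set of edges, so there are finitely many, and one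
  that contains \<open>seg e\<close> and is maximal exists.\<close>

lemma edge_in_l_edge:
  assumes "e \<in> IE"
  obtains l where "l \<in> LE" "seg e \<subseteq> l"
proof -
  have e: "e \<in> \<Delta>" using assms IE_subset by blast
  define C where "C = {closed_segment a b |a b. composed_segment \<Psi> \<Delta> a b}"
  have "seg e \<in> C" unfolding C_def seg_eq[OF e]
    by (intro CollectI exI conjI, rule refl, rule composed_edge[OF assms])
  moreover have "finite C" unfolding C_def by (rule finite_composed)
  ultimately obtain m where m: "m \<in> C" "seg e \<subseteq> m" "\<forall>b\<in>C. m \<subseteq> b \<longrightarrow> m = b"
    using finite_has_maximal2[of C "seg e"] by auto
  obtain a b where ab: "composed_segment \<Psi> \<Delta> a b" "m = closed_segment a b"
    using m(1) unfolding C_def by blast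
  have eq: "closed_segment a' b' = closed_segment a b"
    if "composed_segment \<Psi> \<Delta> a' b'" "closed_segment a b \<subseteq> closed_segment a' b'" for a' b'
  proof -
    have "closed_segment a' b' \<in> C" unfolding C_def
      by (intro CollectI exI conjI, rule refl, rule that(1))
    moreover have "m \<subseteq> closed_segment a' b'" using that(2) ab(2) by simp
    ultimately have "m = closed_segment a' b'" using m(3) by simp
    thus ?thesis using ab(2) by simp
  qed
  have "l_edge \<Psi> \<Delta> a b" unfolding l_edge_def
    by (intro conjI allI impI ab(1), elim conjE, rule eq)
  hence "m \<in> LE" unfolding l_edges_def ab(2) by (intro CollectI exI conjI) (rule refl)
  thus ?thesis using m(2) that by simp
qed

lemma l_edge_absorb:
  assumes "l \<in> LE" "composed_segment \<Psi> \<Delta> a b" "a \<in> affine hull l" "b \<in> affine hull l"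
    "c \<in> \<Psi>" "c \<in> l" "c \<in> closed_segment a b"
  shows "closed_segment a b \<subseteq> l"
proof -
  obtain p q where pq: "l_edge \<Psi> \<Delta> p q" "l = closed_segment p q" using assms(1) unfolding l_edges_def by blast
  have "composed_segment \<Psi> \<Delta> p q" using pq(1) unfolding l_edge_def by blast
  then obtain a'' b'' where "composed_segment \<Psi> \<Delta> a'' b''" "closed_segment a'' b'' = closed_segment p q \<union> closed_segment a b"
    using composed_Un[OF _ assms(2), of p q c] assms unfolding pq(2) affine_hull_closed_segment' by metis
  moreover have "closed_segment a'' b'' = closed_segment p q"
    using pq(1) calculation unfolding l_edge_def by blast
  ultimately show ?thesis unfolding pq(2) by blast
qed

lemma l_edge_unique:
  assumes "l \<in> LE" "l' \<in> LE" "affine hull l = affine hull l'" "c \<in> \<Psi>" "c \<in> l" "c \<in> l'"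
  shows "l = l'"
proof -
  have "l \<subseteq> l'" if "l \<in> LE" "l' \<in> LE" "affine hull l = affine hull l'" "c \<in> l" "c \<in> l'" for l l'
  proof -
    obtain p q where pq: "l_edge \<Psi> \<Delta> p q" "l = closed_segment p q" using \<open>l \<in> LE\<close> unfolding l_edges_def by blast
    have "p \<in> affine hull l'" "q \<in> affine hull l'"
      using that(3) hull_inc[of _ l affine] pq(2) by auto
    moreover have "composed_segment \<Psi> \<Delta> p q" using pq(1) unfolding l_edge_def by blast
    ultimately show ?thesis
      using l_edge_absorb[OF that(2), of p q c] that(4,5) assms(4) pq(2) by blast
  qed
  thus ?thesis using assms by (metis subset_antisym)
qed

lemma affine_hull_edge:
  assumes "e \<in> \<Delta>" "l \<in> LE" "seg e \<subseteq> l"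
  shows "affine hull e = affine hull l"
proof -
  obtain a b where ab: "l = closed_segment a b" using assms(2) unfolding l_edges_def by blast
  have "{lo e, hi e} \<subseteq> l" using hull_subset[of e convex] assms(3) edge_eq[OF assms(1)] by auto
  hence "lo e \<in> affine hull {a, b}" "hi e \<in> affine hull {a, b}"
    using hull_subset[of l affine] unfolding ab affine_hull_closed_segment' by auto
  thus ?thesis using affine_hull_two_points[OF _ _ lo_ne_hi[OF assms(1)]] edge_eq[OF assms(1)]
    unfolding ab affine_hull_closed_segment' by metis
qed

lemma l_edge_of_edge_unique:
  assumes "e \<in> IE" "l \<in> LE" "l' \<in> LE" "seg e \<subseteq> l" "seg e \<subseteq> l'"
  shows "l = l'"
proof -
  have e: "e \<in> \<Delta>" using assms(1) IE_subset by blast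
  have "midpoint (lo e) (hi e) \<in> open_segment (lo e) (hi e)" using lo_ne_hi[OF e] by simp
  hence "midpoint (lo e) (hi e) \<in> \<Psi>" "midpoint (lo e) (hi e) \<in> seg e"
    using open_seg_domain[OF assms(1)] seg_eq[OF e] by (auto simp: open_segment_def)
  thus ?thesis using l_edge_unique[OF assms(2,3)] affine_hull_edge[OF e] assms by blast
qed

text \<open>Near \<open>A\<close> the two edges overlap in points that are not vertices, whereas
  different edges meet only in end points.\<close>

lemma same_ray_same_edge:
  assumes "{A, A + u} \<in> \<Delta>" "{A, A + c *\<^sub>R u} \<in> \<Delta>" "0 < c"
  shows "{A, A + u} = {A, A + c *\<^sub>R u}"
proof (rule ccontr)
  assume ne: "{A, A + u} \<noteq> {A, A + c *\<^sub>R u}"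
  have u: "u \<noteq> 0" using card_edge[OF assms(1)] by auto
  define x where "x = min 1 c / 2"
  have x: "0 < x" "x < 1" "x < c" unfolding x_def using assms(3) by auto
  have "ray A u x \<in> ray A u ` {0..1}" "ray A u x \<in> ray A u ` {0..c}"
    using x by (intro imageI; simp)+
  hence "ray A u x \<in> closed_segment (ray A u 0) (ray A u 1)" "ray A u x \<in> closed_segment (ray A u 0) (ray A u c)"
    using closed_segment_ray[of 0 1 A u] closed_segment_ray[of 0 c A u] assms(3) by auto
  hence "ray A u x \<in> seg {A, A + u} \<inter> seg {A, A + c *\<^sub>R u}" by (simp add: segment_convex_hull)
  hence "ray A u x \<in> {A, A + u}" using seg_Int[OF assms(1,2) ne] by blast
  hence "ray A u x = ray A u 0 \<or> ray A u x = ray A u 1" by simp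
  thus False using x u by (simp only: inj_ray[OF u]) auto
qed

definition edges_of :: "point set \<Rightarrow> point set set" where
  "edges_of l = {e \<in> IE. seg e \<subseteq> l}"

lemma edges_of_IE: "e \<in> edges_of l \<Longrightarrow> e \<in> IE" and edges_of_edge: "e \<in> edges_of l \<Longrightarrow> e \<in> \<Delta>"
  and edges_of_subset: "e \<in> edges_of l \<Longrightarrow> seg e \<subseteq> l" and finite_edges_of: "finite (edges_of l)"
  unfolding edges_of_def using IE_subset finite_IE by auto

lemma l_edge_cover:
  assumes "l \<in> LE" "z \<in> l"
  obtains e where "e \<in> edges_of l" "z \<in> seg e"
proof -
  obtain F where "F \<subseteq> IE" "l = \<Union>((hull) convex ` F)"
    using assms(1) unfolding l_edges_def l_edge_def composed_segment_def by blast
  thus ?thesis using assms(2) that unfolding edges_of_def by blast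
qed

text \<open>A point slightly beyond the vertex is covered by some edge of \<open>l\<close>. No edge
  starts between the vertex and this point, so the covering edge contains the vertex, and then as an
  end point.\<close>

lemma l_edge_vertex_edge:
  assumes l: "l \<in> LE" "l = ray p u ` {s..t}" "u \<noteq> 0" and A: "ray p u r \<in> \<Union>\<Delta>" "r \<in> {s..<t}"
  obtains r' where "r < r'" "{ray p u r, ray p u r'} \<in> edges_of l"
proof -
  define \<pi> where "\<pi> z = (z - p) \<bullet> u / (u \<bullet> u)" for z
  have \<pi>: "\<pi> (ray p u r) = r" for r using l(3) unfolding \<pi>_def by simp
  define x where "x e = min (\<pi> (lo e)) (\<pi> (hi e))" for e
  define y where "y e = max (\<pi> (lo e)) (\<pi> (hi e))" for e
  have xy: "x e < y e" "e = {ray p u (x e), ray p u (y e)}" "seg e = ray p u ` {x e..y e}" if e: "e \<in> edges_of l" for e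
  proof -
    have "lo e \<in> l" "hi e \<in> l"
      using edges_of_subset[OF e] hull_subset[of e convex] lo_in[OF edges_of_edge[OF e]] hi_in[OF edges_of_edge[OF e]] by blast+
    hence r: "lo e = ray p u (\<pi> (lo e))" "hi e = ray p u (\<pi> (hi e))" unfolding l(2) using \<pi> by auto
    have "\<pi> (lo e) \<noteq> \<pi> (hi e)" using lo_ne_hi[OF edges_of_edge[OF e]] r by metis
    thus xy: "x e < y e" unfolding x_def y_def by auto
    have "{ray p u (x e), ray p u (y e)} = {lo e, hi e}"
      using r unfolding x_def y_def by (auto simp: min_def max_def)
    thus eq: "e = {ray p u (x e), ray p u (y e)}" using edge_eq[OF edges_of_edge[OF e]] by simp
    have "seg e = seg {ray p u (x e), ray p u (y e)}" by (subst eq) (rule refl)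
    also have "\<dots> = ray p u ` {x e..y e}"
      unfolding segment_convex_hull[symmetric] by (rule closed_segment_ray[OF less_imp_le[OF xy]])
    finally show "seg e = ray p u ` {x e..y e}" .
  qed
  \<comment> \<open>The parameters beyond r at which edges start; \<open>t\<close> is included to
    make the minimum exist and to keep the chosen point within \<open>l\<close>.\<close>
  define X where "X = insert t (x ` {e \<in> edges_of l. r < x e})"
  have X: "finite X" "X \<noteq> {}" "\<And>v. v \<in> X \<Longrightarrow> r < v" unfolding X_def using finite_edges_of A(2) by auto
  define m where "m = Min X"
  have m: "r < m" "m \<le> t" "\<And>v. v \<in> X \<Longrightarrow> m \<le> v"
    unfolding m_def using X(3)[OF Min_in[OF X(1,2)]] Min_le[OF X(1)] by (simp_all add: X_def)
  define z where "z = (r + m) / 2"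
  have z: "r < z" "z < m" unfolding z_def using m(1) by auto
  have "ray p u z \<in> l" unfolding l(2) using z m A(2) by (intro imageI) auto
  then obtain e where e: "e \<in> edges_of l" "ray p u z \<in> seg e" using l_edge_cover[OF l(1)] by blast
  have ze: "x e \<le> z" "z \<le> y e" using e(2) unfolding xy(3)[OF e(1)] using l(3) by auto
  have "\<not> r < x e" using m(3)[of "x e"] e(1) ze z unfolding X_def by auto
  hence "ray p u r \<in> seg e" unfolding xy(3)[OF e(1)] using ze z by (intro imageI) auto
  hence "ray p u r \<in> e" using vertex_on_edge[OF A(1) edges_of_edge[OF e(1)]] by blast
  hence "ray p u r = ray p u (x e) \<or> ray p u r = ray p u (y e)" using xy(2)[OF e(1)] by blast
  hence "r = x e \<or> r = y e" by (simp only: inj_ray[OF l(3)])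
  hence "r = x e" using ze z by auto
  thus ?thesis using that[of "y e"] xy(1,2)[OF e(1)] e(1) by auto
qed

end

section \<open>Successive vertices and edges along an l-edge\<close>

definition lexle :: "point \<Rightarrow> point \<Rightarrow> bool" where
  "lexle a b \<longleftrightarrow> a = b \<or> lexl a b"

lemma lexle_ray: "lexl 0 u \<Longrightarrow> lexle (ray p u s) (ray p u t) \<longleftrightarrow> s \<le> t"
  using lexl_ray[of u p s t] unfolding lexle_def by (auto simp: lexl_def)

lemma lexl_0_ne: "lexl 0 u \<Longrightarrow> u \<noteq> 0"
  by auto

context partition
begin

lemma l_edge_ray:
  assumes "l \<in> LE"
  obtains a u where "lexl 0 u" "l = ray a u ` {0..1}" "lo l = a" "hi l = a + u" "ray a u ` {0<..<1} \<subseteq> \<Psi>"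
proof -
  obtain a b where ab: "lexl a b" "l_edge \<Psi> \<Delta> a b" "l = closed_segment a b" "lo l = a" "hi l = b"
    by (rule l_edge_obtain[OF assms])
  have u: "lexl 0 (b - a)" using ab(1) lexl_diff by blast
  have "open_segment a b \<subseteq> \<Psi>" using ab(2) unfolding l_edge_def composed_segment_def by blast
  hence "ray a (b - a) ` {0<..<1} \<subseteq> \<Psi>" using open_segment_ray[OF lexl_0_ne[OF u], of 0 1 a] by simp
  thus ?thesis using that[of "b - a" a] u ab(3-5) closed_segment_ray[of 0 1 a "b - a"] by simp
qed

lemma edges_of_ray:
  assumes l: "lexl 0 u" "l = ray a u ` {0..1}" and e: "e \<in> edges_of l"
  obtains x y where "x < y" "lo e = ray a u x" "hi e = ray a u y" "x \<in> {0..1}" "y \<in> {0..1}"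
    "seg e = ray a u ` {x..y}"
proof -
  have "lo e \<in> l" "hi e \<in> l"
    using edges_of_subset[OF e] hull_subset[of e convex] lo_in[OF edges_of_edge[OF e]] hi_in[OF edges_of_edge[OF e]] by blast+
  hence m: "lo e \<in> ray a u ` {0..1}" "hi e \<in> ray a u ` {0..1}" using l(2) by simp_all
  obtain x where x: "lo e = ray a u x" "x \<in> {0..1}" using m(1) by (rule imageE)
  obtain y where y: "hi e = ray a u y" "y \<in> {0..1}" using m(2) by (rule imageE)
  note xy = x(1) y(1) x(2) y(2)
  have "x < y" using edge_lexl[OF edges_of_edge[OF e]] unfolding xy lexl_ray[OF l(1)] .
  moreover have "seg e = ray a u ` {x..y}"
    unfolding seg_eq[OF edges_of_edge[OF e]] xy by (rule closed_segment_ray) (use calculation in simp)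
  ultimately show ?thesis using that[of x y] xy by simp
qed

lemma next_edge:
  assumes "l \<in> LE" "A \<in> \<Union>\<Delta>" "A \<in> l" "A \<noteq> hi l"
  obtains e where "e \<in> edges_of l" "lo e = A"
proof -
  obtain a u where l: "lexl 0 u" "l = ray a u ` {0..1}" "lo l = a" "hi l = a + u" by (rule l_edge_ray[OF assms(1)])
  obtain r where r: "A = ray a u r" "r \<in> {0..1}" using assms(3) unfolding l(2) by (rule imageE)
  have "r \<noteq> 1" using assms(4) r l(4) by auto
  hence r1: "r \<in> {0..<1}" using r(2) by auto
  obtain r' where r': "r < r'" "{ray a u r, ray a u r'} \<in> edges_of l"
    by (rule l_edge_vertex_edge[OF assms(1) l(2) lexl_0_ne[OF l(1)] assms(2)[unfolded r(1)] r1])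
  have "lo {ray a u r, ray a u r'} = A"
    unfolding r(1) by (rule lo_eqI) (use lexl_ray[OF l(1), of a r r'] r'(1) in auto)
  thus ?thesis using that r'(2) by blast
qed

lemma prev_edge:
  assumes "l \<in> LE" "A \<in> \<Union>\<Delta>" "A \<in> l" "A \<noteq> lo l"
  obtains e where "e \<in> edges_of l" "hi e = A"
proof -
  obtain a u where l: "lexl 0 u" "l = ray a u ` {0..1}" "lo l = a" "hi l = a + u" by (rule l_edge_ray[OF assms(1)])
  obtain r where r: "A = ray a u r" "r \<in> {0..1}" using assms(3) unfolding l(2) by (rule imageE)
  \<comment> \<open>Traversing \<open>l\<close> backwards turns the preceding edge into the next
    one.\<close>
  have flip: "ray a u r = ray (a + u) (- u) (1 - r)" for r by (simp add: algebra_simps)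
  have "l = ray (a + u) (- u) ` ((\<lambda>r. 1 - r) ` {0..1})"
    unfolding l(2) image_image by (rule image_cong[OF refl]) (rule flip)
  also have "(\<lambda>r. 1 - r) ` {0..1} = {0..1::real}"
    by simp
  finally have l': "l = ray (a + u) (- u) ` {0..1}" .
  have "r \<noteq> 0" using assms(4) r l(3) by auto
  hence r1: "1 - r \<in> {0..<1}" using r(2) by auto
  have "- u \<noteq> 0" using lexl_0_ne[OF l(1)] by simp
  from l_edge_vertex_edge[OF assms(1) l' this assms(2)[unfolded r(1) flip[of r]] r1]
  obtain r' where r': "1 - r < r'" "{ray (a + u) (- u) (1 - r), ray (a + u) (- u) r'} \<in> edges_of l" by blast
  have "hi {ray a u r, ray a u (1 - r')} = A"
    unfolding r(1) by (rule hi_eqI) (use lexl_ray[OF l(1), of a "1 - r'" r] r'(1) in auto)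
  moreover have "{ray (a + u) (- u) (1 - r), ray (a + u) (- u) r'} = {ray a u r, ray a u (1 - r')}"
  proof -
    have "ray (a + u) (- u) r' = ray a u (1 - r')" by (simp add: algebra_simps)
    thus ?thesis using flip[of r] by (simp only:)
  qed
  ultimately show ?thesis using that r'(2) by metis
qed

text \<open>Both edges leave the common point in the direction of \<open>l\<close>, so
  \<open>same_ray_same_edge\<close> applies.\<close>

lemma edges_of_lo_unique:
  assumes "l \<in> LE" "e \<in> edges_of l" "f \<in> edges_of l" "lo e = lo f"
  shows "e = f"
proof -
  obtain a u where l: "lexl 0 u" "l = ray a u ` {0..1}" "lo l = a" "hi l = a + u" by (rule l_edge_ray[OF assms(1)])
  obtain x y where e: "x < y" "lo e = ray a u x" "hi e = ray a u y" by (rule edges_of_ray[OF l(1,2) assms(2)])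
  obtain x' y' where f: "x' < y'" "lo f = ray a u x'" "hi f = ray a u y'" by (rule edges_of_ray[OF l(1,2) assms(3)])
  have x: "x' = x" using assms(4) e(2) f(2) lexl_0_ne[OF l(1)] by simp
  have "e = {lo e, lo e + (y - x) *\<^sub>R u}"
    using edge_eq[OF edges_of_edge[OF assms(2)]] e(2,3) by (simp add: algebra_simps)
  moreover have "f = {lo e, lo e + ((y' - x) / (y - x)) *\<^sub>R ((y - x) *\<^sub>R u)}"
  proof -
    have "((y' - x) / (y - x)) *\<^sub>R ((y - x) *\<^sub>R u) = (y' - x) *\<^sub>R u" using e(1) by simp
    thus ?thesis
      using edge_eq[OF edges_of_edge[OF assms(3)]] f(2,3) e(2) x assms(4) by (simp add: algebra_simps)
  qed
  moreover have "0 < (y' - x) / (y - x)" using e(1) f(1) x by simp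
  ultimately show ?thesis
    using same_ray_same_edge[of "lo e" "(y - x) *\<^sub>R u" "(y' - x) / (y - x)"]
      edges_of_edge[OF assms(2)] edges_of_edge[OF assms(3)] by metis
qed

lemma edges_of_hi_unique:
  assumes "l \<in> LE" "e \<in> edges_of l" "f \<in> edges_of l" "hi e = hi f"
  shows "e = f"
proof -
  obtain a u where l: "lexl 0 u" "l = ray a u ` {0..1}" "lo l = a" "hi l = a + u" by (rule l_edge_ray[OF assms(1)])
  obtain x y where e: "x < y" "lo e = ray a u x" "hi e = ray a u y" by (rule edges_of_ray[OF l(1,2) assms(2)])
  obtain x' y' where f: "x' < y'" "lo f = ray a u x'" "hi f = ray a u y'" by (rule edges_of_ray[OF l(1,2) assms(3)])
  have x: "y' = y" using assms(4) e(3) f(3) lexl_0_ne[OF l(1)] by simp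
  have "e = {hi e, hi e + (x - y) *\<^sub>R u}"
    using edge_eq[OF edges_of_edge[OF assms(2)]] e(2,3) by (simp add: algebra_simps insert_commute)
  moreover have "f = {hi e, hi e + ((x' - y) / (x - y)) *\<^sub>R ((x - y) *\<^sub>R u)}"
  proof -
    have "((x' - y) / (x - y)) *\<^sub>R ((x - y) *\<^sub>R u) = (x' - y) *\<^sub>R u" using e(1) by simp
    thus ?thesis
      using edge_eq[OF edges_of_edge[OF assms(3)]] f(2,3) e(3) x assms(4) by (simp add: algebra_simps insert_commute)
  qed
  moreover have "0 < (x' - y) / (x - y)" using e(1) f(1) x by (simp add: divide_neg_neg)
  ultimately show ?thesis
    using same_ray_same_edge[of "hi e" "(x - y) *\<^sub>R u" "(x' - y) / (x - y)"]
      edges_of_edge[OF assms(2)] edges_of_edge[OF assms(3)] by metis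
qed

lemma edges_of_ends:
  assumes "l \<in> LE" "e \<in> edges_of l"
  shows "lo e \<in> l" "hi e \<in> l" "lo e \<noteq> hi l" "hi e \<noteq> lo l"
    "lo e = lo l \<or> lo e \<in> IV" "hi e = hi l \<or> hi e \<in> IV"
proof -
  obtain a u where l: "lexl 0 u" "l = ray a u ` {0..1}" "lo l = a" "hi l = a + u" "ray a u ` {0<..<1} \<subseteq> \<Psi>"
    by (rule l_edge_ray[OF assms(1)])
  obtain x y where e: "x < y" "lo e = ray a u x" "hi e = ray a u y" "x \<in> {0..1}" "y \<in> {0..1}"
    by (rule edges_of_ray[OF l(1,2) assms(2)])
  note u = lexl_0_ne[OF l(1)]
  have h: "hi l = ray a u 1" "lo l = ray a u 0" using l by simp_all
  show "lo e \<in> l" "hi e \<in> l" unfolding l(2) using e by blast+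
  show "lo e \<noteq> hi l" unfolding h e(2) inj_ray[OF u] using e by auto
  show "hi e \<noteq> lo l" unfolding h e(3) inj_ray[OF u] using e by auto
  have V: "lo e \<in> \<Union>\<Delta>" "hi e \<in> \<Union>\<Delta>"
    using lo_in hi_in edges_of_edge[OF assms(2)] by blast+
  show "lo e = lo l \<or> lo e \<in> IV"
  proof (cases "x = 0")
    case False
    hence "lo e \<in> \<Psi>" using l(5) e by (auto intro!: subsetD[OF l(5)] imageI)
    thus ?thesis using V unfolding IV_def by blast
  qed (use h e in simp)
  show "hi e = hi l \<or> hi e \<in> IV"
  proof (cases "y = 1")
    case False
    hence "hi e \<in> \<Psi>" using l(5) e by (auto intro!: subsetD[OF l(5)] imageI)
    thus ?thesis using V unfolding IV_def by blast
  qed (use h e in simp)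
qed

text \<open>No vertex lies strictly between the ends of an edge. Hence passing from
  \<open>lo e\<close> to \<open>hi e\<close> adds just \<open>hi e\<close> to the vertices below,
  which drives the summation in \<open>below_step\<close>.\<close>

lemma lexle_lo_step:
  assumes "l \<in> LE" "e \<in> edges_of l" "B \<in> \<Union>\<Delta>" "B \<in> l"
  shows "lexle B (hi e) \<longleftrightarrow> B = hi e \<or> lexle B (lo e)" "\<not> lexle (hi e) (lo e)"
proof -
  obtain a u where l: "lexl 0 u" "l = ray a u ` {0..1}" by (rule l_edge_ray[OF assms(1)])
  obtain x y where e: "x < y" "lo e = ray a u x" "hi e = ray a u y" "x \<in> {0..1}" "y \<in> {0..1}" "seg e = ray a u ` {x..y}"
    by (rule edges_of_ray[OF l(1,2) assms(2)])
  note u = lexl_0_ne[OF l(1)]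
  obtain r where r: "B = ray a u r" using assms(4) unfolding l(2) by (rule imageE)
  have "\<not> (x < r \<and> r < y)"
  proof
    assume xr: "x < r \<and> r < y"
    hence "B \<in> seg e" unfolding e(6) r by (intro imageI) auto
    hence "B \<in> e" using vertex_on_edge[OF assms(3) edges_of_edge[OF assms(2)]] by blast
    hence "B = lo e \<or> B = hi e" using edge_eq[OF edges_of_edge[OF assms(2)]] by blast
    hence "r = x \<or> r = y" unfolding r e(2,3) inj_ray[OF u] .
    thus False using xr by auto
  qed
  hence "r \<le> y \<longleftrightarrow> r = y \<or> r \<le> x" using e(1) by auto
  thus "lexle B (hi e) \<longleftrightarrow> B = hi e \<or> lexle B (lo e)"
    unfolding r e(2,3) lexle_ray[OF l(1)] inj_ray[OF u] .
  show "\<not> lexle (hi e) (lo e)" unfolding e(2,3) lexle_ray[OF l(1)] using e(1) by simp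
qed

lemma l_edge_ends:
  assumes "l \<in> LE"
  shows "lo l \<noteq> hi l" "lo l \<in> l" "hi l \<in> l"
proof -
  obtain a b where ab: "lexl a b" "l = closed_segment a b" "lo l = a" "hi l = b" by (rule l_edge_obtain[OF assms])
  show "lo l \<in> l" "hi l \<in> l" unfolding ab(3,4) unfolding ab(2) by simp_all
  show "lo l \<noteq> hi l" using ab by auto
qed

lemma lexle_l_edge:
  assumes "l \<in> LE" "B \<in> l"
  shows "lexle (lo l) B" "lexle B (hi l)"
proof -
  obtain a u where l: "lexl 0 u" "l = ray a u ` {0..1}" "lo l = a" "hi l = a + u" by (rule l_edge_ray[OF assms(1)])
  obtain r where r: "B = ray a u r" "r \<in> {0..1}" using assms(2) unfolding l(2) by (rule imageE)
  have h: "hi l = ray a u 1" "lo l = ray a u 0" using l by simp_all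
  show "lexle (lo l) B" "lexle B (hi l)" unfolding h r lexle_ray[OF l(1)] using r(2) by auto
qed

lemma l_edge_end_vertex:
  assumes "l \<in> LE"
  shows "lo l \<in> \<Union>\<Delta>" "hi l \<in> \<Union>\<Delta>"
proof -
  obtain a u where l: "lexl 0 u" "l = ray a u ` {0..1}" "lo l = a" "hi l = a + u" by (rule l_edge_ray[OF assms(1)])
  note u = lexl_0_ne[OF l(1)]
  have h: "hi l = ray a u 1" "lo l = ray a u 0" using l by simp_all
  note m = l_edge_ends(2,3)[OF assms]
  obtain e where e: "e \<in> edges_of l" "lo l \<in> seg e" by (rule l_edge_cover[OF assms m(1)])
  obtain x y where xy: "lo e = ray a u x" "x \<in> {0..1}" "seg e = ray a u ` {x..y}"
    by (rule edges_of_ray[OF l(1,2) e(1)])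
  obtain r where "ray a u 0 = ray a u r" "r \<in> {x..y}" using e(2) unfolding xy(3) h by (rule imageE)
  hence "x = 0" using xy(2) u by auto
  hence "lo l = lo e" using xy h by simp
  thus "lo l \<in> \<Union>\<Delta>" using lo_in edges_of_edge[OF e(1)] by auto
  obtain f where f: "f \<in> edges_of l" "hi l \<in> seg f" by (rule l_edge_cover[OF assms m(2)])
  obtain x y where xy: "hi f = ray a u y" "y \<in> {0..1}" "seg f = ray a u ` {x..y}"
    by (rule edges_of_ray[OF l(1,2) f(1)])
  obtain r where r: "ray a u 1 = ray a u r" "r \<in> {x..y}" using f(2) unfolding xy(3) h by (rule imageE)
  have "r = 1" using r(1) unfolding inj_ray[OF u] by simp
  hence "y = 1" using xy(2) r(2) by auto
  hence "hi l = hi f" using xy h by simp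
  thus "hi l \<in> \<Union>\<Delta>" using hi_in edges_of_edge[OF f(1)] by auto
qed

lemma vertex_cases:
  assumes "e \<in> \<Delta>" "v \<in> e"
  shows "v \<in> IV \<longleftrightarrow> v \<notin> frontier \<Psi>"
proof -
  have "v \<in> closure \<Psi>" using seg_closure[OF assms(1)] hull_inc[OF assms(2)] by blast
  thus ?thesis using assms domain_frontier unfolding IV_def by blast
qed

lemma l_edge_end_cases:
  assumes "l \<in> LE"
  shows "lo l \<in> IV \<longleftrightarrow> lo l \<notin> frontier \<Psi>" "hi l \<in> IV \<longleftrightarrow> hi l \<notin> frontier \<Psi>"
  using l_edge_end_vertex[OF assms] vertex_cases by blast+

lemma cross_cuts_eq: "cross_cuts \<Psi> \<Delta> = {l \<in> LE. lo l \<in> frontier \<Psi> \<and> hi l \<in> frontier \<Psi>}"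
  and truncated_eq: "truncated_l_edges \<Psi> \<Delta> = {l \<in> LE. lo l \<notin> frontier \<Psi> \<and> hi l \<notin> frontier \<Psi>}"
proof -
  have *: "{a, b} = {lo (closed_segment a b), hi (closed_segment a b)}" if "l_edge \<Psi> \<Delta> a b" for a b
  proof -
    have "a \<noteq> b" using that unfolding l_edge_def composed_segment_def by blast
    thus ?thesis using lexl_total[of a b] lo_hi_closed_segment[of a b] lo_hi_closed_segment[of b a]
      by (auto simp: closed_segment_commute)
  qed
  have aux: "((a \<in> F \<and> b \<in> F) \<longleftrightarrow> (p \<in> F \<and> q \<in> F)) \<and> ((a \<notin> F \<and> b \<notin> F) \<longleftrightarrow> (p \<notin> F \<and> q \<notin> F))"
    if "a = p \<and> b = q \<or> a = q \<and> b = p" for a b p q :: point and F using that by auto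
  have **: "(a \<in> frontier \<Psi> \<and> b \<in> frontier \<Psi>) \<longleftrightarrow> (lo (closed_segment a b) \<in> frontier \<Psi> \<and> hi (closed_segment a b) \<in> frontier \<Psi>)"
    "(a \<notin> frontier \<Psi> \<and> b \<notin> frontier \<Psi>) \<longleftrightarrow> (lo (closed_segment a b) \<notin> frontier \<Psi> \<and> hi (closed_segment a b) \<notin> frontier \<Psi>)"
    if "l_edge \<Psi> \<Delta> a b" for a b
  proof -
    have "a = lo (closed_segment a b) \<and> b = hi (closed_segment a b) \<or> a = hi (closed_segment a b) \<and> b = lo (closed_segment a b)"
      using *[OF that] unfolding doubleton_eq_iff .
    from aux[OF this, of "frontier \<Psi>"] show "(a \<in> frontier \<Psi> \<and> b \<in> frontier \<Psi>) \<longleftrightarrow> (lo (closed_segment a b) \<in> frontier \<Psi> \<and> hi (closed_segment a b) \<in> frontier \<Psi>)"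
      "(a \<notin> frontier \<Psi> \<and> b \<notin> frontier \<Psi>) \<longleftrightarrow> (lo (closed_segment a b) \<notin> frontier \<Psi> \<and> hi (closed_segment a b) \<notin> frontier \<Psi>)"
      by (rule conjunct1, rule conjunct2)
  qed
  show "cross_cuts \<Psi> \<Delta> = {l \<in> LE. lo l \<in> frontier \<Psi> \<and> hi l \<in> frontier \<Psi>}"
    unfolding cross_cuts_def l_edges_def using **(1) by blast
  show "truncated_l_edges \<Psi> \<Delta> = {l \<in> LE. lo l \<notin> frontier \<Psi> \<and> hi l \<notin> frontier \<Psi>}"
    unfolding truncated_l_edges_def l_edges_def using **(2) by blast
qed

text \<open>The l-edge that carries an interior edge; uniqueness is
  \<open>l_edge_of_edge_unique\<close>.\<close>

definition le :: "point set \<Rightarrow> point set" where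
  "le e = (THE l. l \<in> LE \<and> e \<in> edges_of l)"

lemma le_eq:
  assumes "l \<in> LE" "e \<in> edges_of l"
  shows "le e = l"
  unfolding le_def
proof (rule the_equality)
  fix l' assume l': "l' \<in> LE \<and> e \<in> edges_of l'"
  show "l' = l"
    by (rule l_edge_of_edge_unique[of e]) (use assms l' edges_of_IE edges_of_subset in simp_all)
qed (use assms in simp)

lemma le_in: "e \<in> IE \<Longrightarrow> le e \<in> LE" and le_edge: "e \<in> IE \<Longrightarrow> e \<in> edges_of (le e)"
proof -
  assume e: "e \<in> IE"
  obtain l where l: "l \<in> LE" "seg e \<subseteq> l" by (rule edge_in_l_edge[OF e])
  hence "e \<in> edges_of l" using e by (simp add: edges_of_def)
  thus "le e \<in> LE" "e \<in> edges_of (le e)" using le_eq[OF l(1)] l(1) by simp_all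
qed

text \<open>Taking affine hulls is a bijection from the l-edges through \<open>A\<close> to the
  lines of the edges at \<open>A\<close>: two l-edges on one line that share a point of \<Psi> are
  equal by maximality.\<close>

lemma num_directions_eq:
  assumes "A \<in> IV"
  shows "num_directions \<Delta> A = card {l \<in> LE. A \<in> l}"
proof -
  have A: "A \<in> \<Psi>" "A \<in> \<Union>\<Delta>" using assms unfolding IV_def by auto
  have inj: "inj_on (\<lambda>l. affine hull l) {l \<in> LE. A \<in> l}"
    by (rule inj_onI) (use l_edge_unique A(1) in blast)
  have im: "(\<lambda>l. affine hull l) ` {l \<in> LE. A \<in> l} = {affine hull e |e. e \<in> \<Delta> \<and> A \<in> e}"
  proof (intro equalityI subsetI)
    fix h assume "h \<in> (\<lambda>l. affine hull l) ` {l \<in> LE. A \<in> l}"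
    then obtain l where l: "l \<in> LE" "A \<in> l" "h = affine hull l" by auto
    obtain e where e: "e \<in> edges_of l" "A \<in> seg e" by (rule l_edge_cover[OF l(1,2)])
    have "A \<in> e" using vertex_on_edge[OF A(2) edges_of_edge[OF e(1)] e(2)] .
    moreover have "affine hull e = h"
      using affine_hull_edge[OF edges_of_edge[OF e(1)] l(1) edges_of_subset[OF e(1)]] l(3) by simp
    ultimately show "h \<in> {affine hull e |e. e \<in> \<Delta> \<and> A \<in> e}" using edges_of_edge[OF e(1)] by blast
  next
    fix h assume "h \<in> {affine hull e |e. e \<in> \<Delta> \<and> A \<in> e}"
    then obtain e where e: "e \<in> \<Delta>" "A \<in> e" "h = affine hull e" by blast
    have IE: "e \<in> IE" using edge_at_interior[OF e(1,2) A(1)] .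
    have "A \<in> le e" using edges_of_subset[OF le_edge[OF IE]] hull_inc[OF e(2)] by blast
    moreover have "affine hull (le e) = h"
      using affine_hull_edge[OF e(1) le_in[OF IE] edges_of_subset[OF le_edge[OF IE]]] e(3) by simp
    ultimately show "h \<in> (\<lambda>l. affine hull l) ` {l \<in> LE. A \<in> l}" using le_in[OF IE] by blast
  qed
  show ?thesis unfolding num_directions_def im[symmetric] by (rule card_image[OF inj])
qed

end

subsection \<open>Cofactors and their jumps at the vertices\<close>

abbreviation "fsc \<equiv> \<lambda>c (w :: point set \<Rightarrow> real poly poly) l. psc c (w l)"
abbreviation "ysc \<equiv> \<lambda>c (y :: point \<Rightarrow> point set \<Rightarrow> real poly poly) A l. psc c (y A l)"

lemma vs_fsc: "vector_space fsc" by (rule vector_space_fun[OF vs_psc])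
lemma vs_ysc: "vector_space ysc" by (rule vector_space_fun[OF vs_fsc])

lemma sum_fun_apply: "(sum f I) x = (\<Sum>i\<in>I. f i x)"
  by (induction I rule: infinite_finite_induct) auto

locale conformality = partition +
  fixes L :: poly_family and d \<mu> :: nat
  assumes md: "\<mu> < d" and Lp: "line_polys \<Psi> \<Delta> L"
begin

text \<open>The degree bound for a cofactor of \<open>L ^ (\<mu> + 1)\<close> in a polynomial of
  degree at most d.\<close>

definition "K = d - \<mu> - 1"
abbreviation "W A \<equiv> conformality_space d \<mu> \<Psi> \<Delta> L A"
abbreviation "TE \<equiv> truncated_l_edges \<Psi> \<Delta>"
abbreviation "CC \<equiv> cross_cuts \<Psi> \<Delta>"

lemma L_poly: "l \<in> LE \<Longrightarrow> L l \<in> polys 1" and L_zero: "l \<in> LE \<Longrightarrow> {z. poly2 (L l) z = 0} = affine hull l"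
  using Lp unfolding line_polys_def by auto

lemma L_nonzero:
  assumes "l \<in> LE"
  shows "L l \<noteq> 0"
proof
  assume "L l = 0"
  hence U: "affine hull l = UNIV" using L_zero[OF assms] by auto
  obtain a b where ab: "lexl a b" "l = closed_segment a b" by (rule l_edge_obtain[OF assms])
  define u where "u = b - a"
  have "a + (- snd u, fst u) \<in> affine hull {a, b}" using U unfolding ab(2) affine_hull_closed_segment' by simp
  then obtain r where "a + (- snd u, fst u) = ray a u r" using ray_affine_hull unfolding u_def by blast
  hence r: "- snd u = r * fst u" "fst u = r * snd u" by (auto simp: prod_eq_iff)
  have "fst u * fst u = snd u * (r * fst u)" using r(2) by (simp add: mult.commute mult.left_commute)
  also have "\<dots> = - (snd u * snd u)" using r(1) by (metis minus_mult_right)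
  finally have "fst u * fst u + snd u * snd u = 0" by simp
  hence "u = 0" by (simp add: prod_eq_iff sum_squares_eq_zero_iff)
  thus False using ab(1) unfolding u_def by simp
qed

lemma W_eq: "W A = line_syz {l \<in> LE. A \<in> l} L \<mu> K"
  unfolding conformality_space_def line_syz_def K_def by simp

lemma
  assumes "A \<in> IV"
  shows dim_W: "int (families.dim (W A)) = k_dim d \<mu> (num_directions \<Delta> A)"
    and subspace_W: "families.subspace (W A)"
    and fin_dim_W: "fin_dim fsc (W A)"
proof -
  have A: "A \<in> \<Psi>" using assms IV_def by blast
  have 1: "finite {l \<in> LE. A \<in> l}" using finite_LE by simp
  have 2: "poly2 (L l) A = 0" if "l \<in> {l \<in> LE. A \<in> l}" for l
    using L_zero[of l] hull_inc[of A l affine] that by auto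
  \<comment> \<open>Equal zero sets mean equal lines, and two l-edges on one line cannot share the
    interior point \<open>A\<close> unless they coincide.\<close>
  have 3: "l = l'" if "l \<in> {l \<in> LE. A \<in> l}" "l' \<in> {l \<in> LE. A \<in> l}"
    "{z. poly2 (L l) z = 0} = {z. poly2 (L l') z = 0}" for l l'
    using l_edge_unique[of l l' A] L_zero[of l] L_zero[of l'] that A by auto
  note * = 1 _ _ 2 3
  have "families.dim (W A) = (\<Sum>m\<le>K. card {l \<in> LE. A \<in> l} * (m + 1) - (m + \<mu> + 2))"
    unfolding W_eq by (rule dim_line_syz[OF *]) (use L_poly L_nonzero in auto)
  thus "int (families.dim (W A)) = k_dim d \<mu> (num_directions \<Delta> A)"
    unfolding num_directions_eq[OF assms] k_dim_conv[OF md, symmetric] K_def by simp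
  show "families.subspace (W A)" unfolding W_eq by (rule subspace_line_syz[OF *]) (use L_poly L_nonzero in auto)
  show "fin_dim fsc (W A)" unfolding W_eq by (rule fin_dim_line_syz[OF *]) (use L_poly L_nonzero in auto)
qed

lemma W_polys: "w \<in> W A \<Longrightarrow> w l \<in> polys K"
  and W_zero: "w \<in> W A \<Longrightarrow> \<not> (l \<in> LE \<and> A \<in> l) \<Longrightarrow> w l = 0"
  unfolding conformality_space_def K_def by auto

lemma W_0: "A \<in> IV \<Longrightarrow> 0 \<in> W A"
  using families.subspace_0[OF subspace_W] .

text \<open>For an l-edge \<open>l\<close> each sum has at most one term, the edge starting at
  \<open>A\<close> and the edge ending there. At an end of \<open>l\<close> one sum is empty, so the
  cofactor beyond the end counts as zero.\<close>

definition jump :: "poly_family \<Rightarrow> point \<Rightarrow> point set \<Rightarrow> real poly poly" where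
  "jump q A l = (\<Sum>e\<in>{e \<in> edges_of l. lo e = A}. q e) - (\<Sum>e\<in>{e \<in> edges_of l. hi e = A}. q e)"

definition jumps :: "poly_family \<Rightarrow> point \<Rightarrow> poly_family" where
  "jumps q A l = (if A \<in> IV \<and> l \<in> LE \<and> A \<in> l then jump q A l else 0)"

lemma linear_jumps: "Vector_Spaces.linear fsc ysc jumps"
proof (rule linear_intro[OF vs_fsc vs_ysc])
  show "jumps (x + y) = jumps x + jumps y" for x y
    unfolding fun_eq_iff jumps_def jump_def by (simp add: sum.distrib)
  show "jumps (fsc c x) = ysc c (jumps x)" for c x
    unfolding fun_eq_iff jumps_def jump_def by (simp add: smult_sum_right smult_diff_right)
qed

lemma next_set:
  assumes "l \<in> LE" "A \<in> \<Union>\<Delta>" "A \<in> l"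
  shows "A = hi l \<Longrightarrow> {e \<in> edges_of l. lo e = A} = {}"
    "A \<noteq> hi l \<Longrightarrow> \<exists>e. e \<in> edges_of l \<and> lo e = A \<and> {e \<in> edges_of l. lo e = A} = {e}"
proof -
  show "A = hi l \<Longrightarrow> {e \<in> edges_of l. lo e = A} = {}" using edges_of_ends(3)[OF assms(1)] by auto
  assume "A \<noteq> hi l"
  then obtain e where e: "e \<in> edges_of l" "lo e = A" by (rule next_edge[OF assms])
  hence "{e \<in> edges_of l. lo e = A} = {e}" using edges_of_lo_unique[OF assms(1)] by auto
  thus "\<exists>e. e \<in> edges_of l \<and> lo e = A \<and> {e \<in> edges_of l. lo e = A} = {e}" using e by blast
qed

lemma prev_set:
  assumes "l \<in> LE" "A \<in> \<Union>\<Delta>" "A \<in> l"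
  shows "A = lo l \<Longrightarrow> {e \<in> edges_of l. hi e = A} = {}"
    "A \<noteq> lo l \<Longrightarrow> \<exists>e. e \<in> edges_of l \<and> hi e = A \<and> {e \<in> edges_of l. hi e = A} = {e}"
proof -
  show "A = lo l \<Longrightarrow> {e \<in> edges_of l. hi e = A} = {}" using edges_of_ends(4)[OF assms(1)] by auto
  assume "A \<noteq> lo l"
  then obtain e where e: "e \<in> edges_of l" "hi e = A" by (rule prev_edge[OF assms])
  hence "{e \<in> edges_of l. hi e = A} = {e}" using edges_of_hi_unique[OF assms(1)] by auto
  thus "\<exists>e. e \<in> edges_of l \<and> hi e = A \<and> {e \<in> edges_of l. hi e = A} = {e}" using e by blast
qed

text \<open>The linear map behind the conformality matrix. All vertices of a truncated l-edge are
  interior, so the sum over \<open>IV \<inter> l\<close> is its full global condition.\<close>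

definition glue :: "(point \<Rightarrow> poly_family) \<Rightarrow> poly_family" where
  "glue y l = (if l \<in> TE then \<Sum>A\<in>IV \<inter> l. y A l else 0)"

lemma linear_glue: "Vector_Spaces.linear ysc fsc glue"
proof (rule linear_intro[OF vs_ysc vs_fsc])
  show "glue (x + y) = glue x + glue y" for x y
    unfolding fun_eq_iff glue_def by (simp add: sum.distrib)
  show "glue (ysc c x) = fsc c (glue x)" for c x
    unfolding fun_eq_iff glue_def by (simp add: smult_sum_right)
qed

lemma finite_IV: "finite IV"
proof (rule finite_subset)
  show "IV \<subseteq> \<Union>\<Delta>" unfolding IV_def by blast
  show "finite (\<Union>\<Delta>)" by (rule finite_Union[OF finite_edges]) (use card_edge card_ge_0_finite in force)
qed

text \<open>The direct sum of the spaces W[A], the domain of the conformality map.\<close>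

definition Y :: "(point \<Rightarrow> poly_family) set" where
  "Y = {y. (\<forall>A\<in>IV. y A \<in> W A) \<and> (\<forall>A. A \<notin> IV \<longrightarrow> y A = 0)}"

lemma subspace_Y: "Modules.module.subspace ysc Y"
  and dim_Y: "int (vector_space.dim ysc Y) = (\<Sum>A\<in>IV. k_dim d \<mu> (num_directions \<Delta> A))"
  and fin_dim_Y: "fin_dim ysc Y"
proof -
  interpret f: vec_sp fsc unfolding vec_sp_def by (rule vs_fsc)
  show "Modules.module.subspace ysc Y" unfolding Y_def
    by (rule f.subspace_direct_sum) (rule subspace_W)
  show "fin_dim ysc Y" unfolding Y_def
    by (rule f.dim_direct_sum(2)[OF finite_IV subspace_W fin_dim_W])
  have "vector_space.dim ysc Y = (\<Sum>A\<in>IV. families.dim (W A))" unfolding Y_def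
    by (rule f.dim_direct_sum(1)[OF finite_IV subspace_W fin_dim_W])
  thus "int (vector_space.dim ysc Y) = (\<Sum>A\<in>IV. k_dim d \<mu> (num_directions \<Delta> A))"
    by (simp add: dim_W)
qed

text \<open>The index \<open>{}\<close>, which is no edge, holds the polynomial that is added globally.\<close>

definition cofactors :: "poly_family set" where
  "cofactors = {q. q {} \<in> polys d \<and> (\<forall>e\<in>IE. q e \<in> polys K) \<and> (\<forall>e. e \<notin> insert {} IE \<longrightarrow> q e = 0) \<and>
     (\<forall>A\<in>IV. jumps q A \<in> W A)}"

lemma empty_notin_IE: "{} \<notin> IE" and empty_notin_LE: "{} \<notin> LE"
  using card_edge IE_subset l_edge_ends(2) by fastforce+

lemma subspace_cofactors: "families.subspace cofactors"
proof -
  interpret j: Vector_Spaces.linear fsc ysc jumps by (rule linear_jumps)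
  show ?thesis
    unfolding families.subspace_def
  proof (intro conjI ballI allI)
    show "0 \<in> cofactors" unfolding cofactors_def using W_0 by (simp add: j.zero)
    show "x + y \<in> cofactors" if "x \<in> cofactors" "y \<in> cofactors" for x y
      using that families.subspace_add[OF subspace_W] unfolding cofactors_def by (simp add: j.add polys_add)
    show "fsc c x \<in> cofactors" if "x \<in> cofactors" for c x
      using that families.subspace_scale[OF subspace_W] unfolding cofactors_def by (simp add: j.scale polys_smult)
  qed
qed

lemma fin_dim_cofactors: "fin_dim fsc cofactors"
proof -
  interpret p: vec_sp psc unfolding vec_sp_def by (rule vs_psc)
  let ?U = "\<lambda>e. if e = {} then polys d else polys K"
  have "fin_dim fsc {w. (\<forall>e\<in>insert {} IE. w e \<in> ?U e) \<and> (\<forall>e. e \<notin> insert {} IE \<longrightarrow> w e = 0)}"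
    by (rule p.dim_direct_sum(2)) (use finite_IE subspace_polys fin_dim_polys in auto)
  thus ?thesis by (rule fin_dim_subset) (use empty_notin_IE in \<open>auto simp: cofactors_def\<close>)
qed

lemma TE_ends: "l \<in> TE \<Longrightarrow> l \<in> LE \<and> lo l \<in> IV \<and> hi l \<in> IV"
  unfolding truncated_eq using l_edge_end_cases by blast

text \<open>Each edge of a truncated l-edge is counted positively at its lower end and negatively at
  its upper end, and both ends are interior vertices, so the sum cancels.\<close>

lemma glue_jumps: "glue (jumps q) = 0"
proof
  fix l
  show "glue (jumps q) l = 0 l"
  proof (cases "l \<in> TE")
    case True
    hence l: "l \<in> LE" "lo l \<in> IV" "hi l \<in> IV" using TE_ends by auto
    have ends: "lo ` edges_of l \<subseteq> IV \<inter> l" "hi ` edges_of l \<subseteq> IV \<inter> l"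
      using edges_of_ends[OF l(1)] l(2,3) by force+
    have fin: "finite (IV \<inter> l)" using finite_IV by simp
    have "(\<Sum>A\<in>IV \<inter> l. jump q A l) = 0" unfolding jump_def sum_subtractf
      using sum.group[OF finite_edges_of fin ends(1), of q] sum.group[OF finite_edges_of fin ends(2), of q] by simp
    moreover have "(\<Sum>A\<in>IV \<inter> l. jumps q A l) = (\<Sum>A\<in>IV \<inter> l. jump q A l)"
      by (rule sum.cong) (simp_all add: jumps_def l(1))
    ultimately show ?thesis using True by (simp add: glue_def)
  qed (simp add: glue_def)
qed

section \<open>Recovering cofactors from their jumps\<close>

definition below :: "(point \<Rightarrow> poly_family) \<Rightarrow> point set \<Rightarrow> point \<Rightarrow> real poly poly" where
  "below y l B = (\<Sum>A\<in>{A \<in> IV \<inter> l. lexle A B}. y A l)"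

text \<open>Inverts \<^const>\<open>jumps\<close> up to a constant along each \<open>l\<close>-edge. Summation starts at an end that is
  an interior vertex; if the lower end is on the frontier, the total is subtracted, so that the
  cofactor beyond an interior upper end vanishes.\<close>

definition integrate :: "(point \<Rightarrow> poly_family) \<Rightarrow> poly_family" where
  "integrate y e = (if e \<in> IE then below y (le e) (lo e)
     - (if lo (le e) \<in> frontier \<Psi> then \<Sum>A\<in>IV \<inter> le e. y A (le e) else 0) else 0)"

lemma below_step:
  assumes "l \<in> LE" "e \<in> edges_of l" "hi e \<in> IV"
  shows "below y l (hi e) = y (hi e) l + below y l (lo e)"
proof -
  have "hi e \<in> l" using edges_of_ends(2)[OF assms(1,2)] .
  hence "{A \<in> IV \<inter> l. lexle A (hi e)} = insert (hi e) {A \<in> IV \<inter> l. lexle A (lo e)}"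
    using lexle_lo_step(1)[OF assms(1,2)] assms(3) unfolding IV_def by blast
  moreover have "hi e \<notin> {A \<in> IV \<inter> l. lexle A (lo e)}"
    using lexle_lo_step(2)[OF assms(1,2)] assms(3) \<open>hi e \<in> l\<close> unfolding IV_def by blast
  ultimately show ?thesis unfolding below_def using finite_IV by simp
qed

lemma below_top:
  assumes "l \<in> LE"
  shows "below y l (hi l) = (\<Sum>A\<in>IV \<inter> l. y A l)"
  unfolding below_def using lexle_l_edge(2)[OF assms] by (intro sum.cong) auto

lemma below_bot:
  assumes "l \<in> LE" "lo l \<in> IV"
  shows "below y l (lo l) = y (lo l) l"
proof -
  have "{A \<in> IV \<inter> l. lexle A (lo l)} = {lo l}"
    using lexle_l_edge(1)[OF assms(1)] l_edge_ends(2)[OF assms(1)] assms(2) lexl_asym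
    unfolding lexle_def by blast
  thus ?thesis unfolding below_def by simp
qed

text \<open>Successive partial sums differ by the value at the vertex between the edges. Only the
  ends of \<open>l\<close> need care: at an interior lower end the constant is zero and the partial
  sum has one term, and at an interior upper end the cofactor before it must be minus the prescribed
  value.\<close>

lemma jump_integrate:
  assumes y: "glue y = 0" and A: "A \<in> IV" "l \<in> LE" "A \<in> l"
  shows "jump (integrate y) A l = y A l"
proof -
  define c where "c = (if lo l \<in> frontier \<Psi> then \<Sum>A\<in>IV \<inter> l. y A l else 0)"
  have q: "integrate y e = below y l (lo e) - c" if "e \<in> edges_of l" for e
    unfolding integrate_def c_def using le_eq[OF A(2) that] edges_of_IE[OF that] by simp
  have V: "A \<in> \<Union>\<Delta>" using A(1) IV_def by blast
  note ns = next_set[OF A(2) V A(3)] and ps = prev_set[OF A(2) V A(3)]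
  show ?thesis
  proof (cases "A = lo l")
    case True
    hence "A \<noteq> hi l" using l_edge_ends(1)[OF A(2)] by auto
    then obtain e where e: "e \<in> edges_of l" "lo e = A" "{e \<in> edges_of l. lo e = A} = {e}" using ns(2) by blast
    have "c = 0" unfolding c_def using A(1) True l_edge_end_cases[OF A(2)] by simp
    thus ?thesis unfolding jump_def ps(1)[OF True] e(3) using q[OF e(1)] e(2) below_bot[OF A(2)] A(1) True by simp
  next
    case False
    then obtain f where f: "f \<in> edges_of l" "hi f = A" "{e \<in> edges_of l. hi e = A} = {f}" using ps(2) by blast
    have st: "below y l A = y A l + below y l (lo f)"
      using below_step[OF A(2) f(1), of y] f(2) A(1) by simp
    show ?thesis
    proof (cases "A = hi l")
      case True
      \<comment> \<open>If the lower end is on the frontier, this is the choice of the constant.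
        Otherwise \<open>l\<close> is truncated, and the global condition makes both sides
        zero.\<close>
      have "c = below y l A"
      proof (cases "lo l \<in> frontier \<Psi>")
        case True
        thus ?thesis unfolding c_def \<open>A = hi l\<close> below_top[OF A(2)] by simp
      next
        case False
        hence "l \<in> TE" unfolding truncated_eq using A \<open>A = hi l\<close> l_edge_end_cases[OF A(2)] by blast
        hence "(\<Sum>A\<in>IV \<inter> l. y A l) = 0" using fun_cong[OF y, of l] by (simp add: glue_def)
        thus ?thesis unfolding c_def \<open>A = hi l\<close> below_top[OF A(2)] by simp
      qed
      thus ?thesis unfolding jump_def ns(1)[OF True] f(3) using q[OF f(1)] st by simp
    next
      case False
      then obtain e where e: "e \<in> edges_of l" "lo e = A" "{e \<in> edges_of l. lo e = A} = {e}" using ns(2) by blast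
      show ?thesis unfolding jump_def f(3) e(3) using q[OF f(1)] q[OF e(1)] st e(2) by simp
    qed
  qed
qed

text \<open>The global conditions are necessary by cancellation along each truncated l-edge and
  sufficient because \<open>integrate\<close> yields a preimage.\<close>

lemma jumps_image: "jumps ` cofactors = {y \<in> Y. glue y = 0}"
proof (intro equalityI subsetI)
  fix y assume "y \<in> jumps ` cofactors"
  then obtain q where "q \<in> cofactors" "y = jumps q" by (rule imageE)
  moreover have "jumps q A = 0" if "A \<notin> IV" for q A using that by (simp add: fun_eq_iff jumps_def)
  ultimately show "y \<in> {y \<in> Y. glue y = 0}" using glue_jumps unfolding cofactors_def Y_def by simp
next
  fix y assume "y \<in> {y \<in> Y. glue y = 0}"
  hence y: "\<And>A. A \<in> IV \<Longrightarrow> y A \<in> W A" "\<And>A. A \<notin> IV \<Longrightarrow> y A = 0" "glue y = 0" unfolding Y_def by auto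
  have "jumps (integrate y) A l = y A l" for A l
  proof (cases "A \<in> IV \<and> l \<in> LE \<and> A \<in> l")
    case True
    thus ?thesis using jump_integrate[OF y(3)] by (simp add: jumps_def)
  next
    case False
    hence "y A l = 0" using y(1,2)[of A] W_zero[of "y A" A l] by (cases "A \<in> IV") auto
    thus ?thesis using False by (auto simp: jumps_def)
  qed
  hence eq: "jumps (integrate y) = y" by (simp add: fun_eq_iff)
  have yp: "y A l \<in> polys K" for A l
    using y(1,2)[of A] W_polys by (cases "A \<in> IV") auto
  have ip: "integrate y e \<in> polys K" for e
    unfolding integrate_def below_def by (simp add: polys_diff polys_sum yp)
  have "integrate y \<in> cofactors" unfolding cofactors_def eq mem_Collect_eq
    by (intro conjI ballI allI impI ip y(1)) (simp_all add: integrate_def empty_notin_IE)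
  thus "y \<in> jumps ` cofactors" using imageI[of "integrate y" cofactors jumps] eq by simp
qed

text \<open>Spreads one cofactor over all edges of a cross-cut and passes the global polynomial at
  index \<open>{}\<close> through.\<close>

definition extend :: "poly_family \<Rightarrow> poly_family" where
  "extend r e = (if e \<in> IE then (if le e \<in> CC then r (le e) else 0) else if e = {} then r {} else 0)"

lemma linear_extend: "Vector_Spaces.linear fsc fsc extend"
  by (rule linear_intro[OF vs_fsc vs_fsc]) (simp_all add: fun_eq_iff extend_def)

definition CCpolys :: "poly_family set" where
  "CCpolys = {r. (\<forall>l\<in>insert {} CC. r l \<in> (if l = {} then polys d else polys K)) \<and> (\<forall>l. l \<notin> insert {} CC \<longrightarrow> r l = 0)}"

lemma CC_LE: "CC \<subseteq> LE" and finite_CC: "finite CC"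
proof -
  show "CC \<subseteq> LE" unfolding cross_cuts_eq by blast
  thus "finite CC" using finite_LE finite_subset by blast
qed

lemma subspace_CCpolys: "families.subspace CCpolys"
  and dim_CCpolys: "families.dim CCpolys = ((d + 2) choose 2) + card CC * ((d - \<mu> + 1) choose 2)"
proof -
  interpret p: vec_sp psc unfolding vec_sp_def by (rule vs_psc)
  let ?U = "\<lambda>e. if e = {} then polys d else polys K"
  show "families.subspace CCpolys" unfolding CCpolys_def
    by (rule p.subspace_direct_sum) (simp add: subspace_polys)
  have "families.dim CCpolys = (\<Sum>l\<in>insert {} CC. p.V.dim (?U l))" unfolding CCpolys_def
    by (rule p.dim_direct_sum(1)) (simp_all add: finite_CC subspace_polys fin_dim_polys)
  also have "\<dots> = ((d + 2) choose 2) + (\<Sum>l\<in>CC. p.V.dim (?U l))"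
    using finite_CC CC_LE empty_notin_LE by (subst sum.insert) (auto simp: dim_polys)
  also have "(\<Sum>l\<in>CC. p.V.dim (?U l)) = (\<Sum>l\<in>CC. (d - \<mu> + 1) choose 2)"
  proof (rule sum.cong[OF refl])
    fix l assume "l \<in> CC"
    hence "l \<noteq> {}" using CC_LE empty_notin_LE by blast
    moreover have "K + 2 = d - \<mu> + 1" using md by (simp add: K_def)
    ultimately show "p.V.dim (?U l) = (d - \<mu> + 1) choose 2" using dim_polys[of K] by simp
  qed
  finally show "families.dim CCpolys = ((d + 2) choose 2) + card CC * ((d - \<mu> + 1) choose 2)" by simp
qed

lemma jumps_extend: "jumps (extend r) = 0"
proof -
  have "jump (extend r) A l = 0" if A: "A \<in> IV" "l \<in> LE" "A \<in> l" for A l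
  proof -
    have V: "A \<in> \<Union>\<Delta>" "A \<notin> frontier \<Psi>" using A(1) IV_def domain_frontier(1) by blast+
    have ex: "extend r e = (if l \<in> CC then r l else 0)" if "e \<in> edges_of l" for e
      unfolding extend_def using le_eq[OF A(2) that] edges_of_IE[OF that] by simp
    show ?thesis
    proof (cases "l \<in> CC")
      case True
      hence "A \<noteq> lo l" "A \<noteq> hi l" using V(2) unfolding cross_cuts_eq by auto
      then obtain e f where "{e \<in> edges_of l. lo e = A} = {e}" "e \<in> edges_of l"
        "{e \<in> edges_of l. hi e = A} = {f}" "f \<in> edges_of l"
        using next_set(2)[OF A(2) V(1) A(3)] prev_set(2)[OF A(2) V(1) A(3)] by blast
      thus ?thesis unfolding jump_def using ex by simp
    next
      case False
      thus ?thesis unfolding jump_def using ex by simp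
    qed
  qed
  thus ?thesis unfolding fun_eq_iff jumps_def by simp
qed

text \<open>Consecutive edges share an interior vertex, where the jump is the difference of their
  cofactors. The induction is on the number of edges that precede \<open>e\<close>.\<close>

lemma const_along:
  assumes q: "jumps q = 0" and l: "l \<in> LE" "e0 \<in> edges_of l" "lo e0 = lo l"
  shows "e \<in> edges_of l \<Longrightarrow> q e = q e0"
proof (induction "card {f \<in> edges_of l. lexl (lo f) (lo e)}" arbitrary: e rule: less_induct)
  case less
  show ?case
  proof (cases "lo e = lo l")
    case True
    thus ?thesis using edges_of_lo_unique[OF l(1) less.prems l(2)] l(3) by simp
  next
    case False
    have V: "lo e \<in> IV" "lo e \<in> l" "lo e \<in> \<Union>\<Delta>"
      using edges_of_ends[OF l(1) less.prems] False unfolding IV_def by blast+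
    obtain f where f: "f \<in> edges_of l" "hi f = lo e" "{f \<in> edges_of l. hi f = lo e} = {f}"
      using prev_set(2)[OF l(1) V(3,2) False] by blast
    have le: "lexl (lo f) (lo e)" using edge_lexl[OF edges_of_edge[OF f(1)]] f(2) by simp
    have "{g \<in> edges_of l. lexl (lo g) (lo f)} \<subset> {g \<in> edges_of l. lexl (lo g) (lo e)}"
      using le f(1) lexl_trans lexl_irrefl by blast
    hence "q f = q e0" using less.hyps[OF psubset_card_mono] finite_edges_of f(1) by simp
    moreover have "{g \<in> edges_of l. lo g = lo e} = {e}"
      using edges_of_lo_unique[OF l(1)] less.prems by blast
    hence "jump q (lo e) l = q e - q f" unfolding jump_def f(3) by simp
    moreover have "jump q (lo e) l = 0" using fun_cong[OF fun_cong[OF q], of "lo e" l] V l(1) by (simp add: jumps_def)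
    ultimately show ?thesis by simp
  qed
qed

text \<open>Without jumps the cofactor is constant along each l-edge. If an end of the l-edge is an
  interior vertex, the jump there is this constant up to sign, so it is zero; only cross-cuts have
  no such end.\<close>

lemma kernel_jumps: "extend ` CCpolys = {q \<in> cofactors. jumps q = 0}"
proof (intro equalityI subsetI)
  fix q assume "q \<in> extend ` CCpolys"
  then obtain r where r: "r \<in> CCpolys" "q = extend r" by (rule imageE)
  have rp: "r {} \<in> polys d" using r(1) unfolding CCpolys_def by simp
  have rl: "r l \<in> polys K" if "l \<in> CC" for l
  proof -
    have "l \<noteq> {}" using that CC_LE empty_notin_LE by blast
    moreover have "r l \<in> (if l = {} then polys d else polys K)" using r(1) that unfolding CCpolys_def by blast
    ultimately show ?thesis by (simp only: if_False)
  qed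
  have j0: "jumps (extend r) A = 0" for A using jumps_extend by simp
  have "extend r \<in> cofactors" unfolding cofactors_def mem_Collect_eq j0
    by (intro conjI ballI allI impI W_0) (simp_all add: extend_def empty_notin_IE rp rl)
  thus "q \<in> {q \<in> cofactors. jumps q = 0}" using jumps_extend r(2) by simp
next
  fix q assume "q \<in> {q \<in> cofactors. jumps q = 0}"
  hence q: "q \<in> cofactors" "jumps q = 0" by auto
  have bot: "\<exists>e0. e0 \<in> edges_of l \<and> lo e0 = lo l \<and> {e \<in> edges_of l. lo e = lo l} = {e0}" if "l \<in> LE" for l
    using next_set(2)[OF that l_edge_end_vertex(1)[OF that] l_edge_ends(2)[OF that] l_edge_ends(1)[OF that]] by blast
  define b where "b l = (SOME e0. e0 \<in> edges_of l \<and> lo e0 = lo l \<and> {e \<in> edges_of l. lo e = lo l} = {e0})" for l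
  have b: "b l \<in> edges_of l" "lo (b l) = lo l" "{e \<in> edges_of l. lo e = lo l} = {b l}" if "l \<in> LE" for l
    using someI_ex[OF bot[OF that]] unfolding b_def by blast+
  have const: "q e = q (b l)" if "l \<in> LE" "e \<in> edges_of l" for l e
    by (rule const_along[OF q(2) that(1) b(1,2)[OF that(1)] that(2)])
  have zero: "q (b l) = 0" if l: "l \<in> LE" "l \<notin> CC" for l
  proof -
    have "lo l \<in> IV \<or> hi l \<in> IV" using l l_edge_end_cases[OF l(1)] unfolding cross_cuts_eq by blast
    thus ?thesis
    proof
      assume A: "lo l \<in> IV"
      have "jump q (lo l) l = 0" using fun_cong[OF fun_cong[OF q(2)], of "lo l" l] A l(1) l_edge_ends(2)[OF l(1)] by (simp add: jumps_def)
      moreover have "{e \<in> edges_of l. hi e = lo l} = {}" using edges_of_ends(4)[OF l(1)] by auto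
      ultimately show ?thesis unfolding jump_def b(3)[OF l(1)] by simp
    next
      assume A: "hi l \<in> IV"
      have "jump q (hi l) l = 0" using fun_cong[OF fun_cong[OF q(2)], of "hi l" l] A l(1) l_edge_ends(3)[OF l(1)] by (simp add: jumps_def)
      moreover have "{e \<in> edges_of l. lo e = hi l} = {}" using edges_of_ends(3)[OF l(1)] by auto
      moreover obtain f where "f \<in> edges_of l" "{e \<in> edges_of l. hi e = hi l} = {f}"
        using prev_set(2)[OF l(1) l_edge_end_vertex(2)[OF l(1)] l_edge_ends(3)[OF l(1)] l_edge_ends(1)[OF l(1), symmetric]] by blast
      ultimately show ?thesis using const[OF l(1)] unfolding jump_def by simp
    qed
  qed
  define r where "r l = (if l = {} then q {} else if l \<in> CC then q (b l) else 0)" for l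
  have "extend r e = q e" for e
  proof (cases "e \<in> IE")
    case True
    have "q e = q (b (le e))" using const[OF le_in[OF True] le_edge[OF True]] .
    moreover have "le e \<noteq> {}" using le_in[OF True] empty_notin_LE by metis
    ultimately show ?thesis using True zero[OF le_in[OF True]] by (simp add: extend_def r_def)
  next
    case False
    thus ?thesis using q(1) by (simp add: extend_def r_def cofactors_def)
  qed
  hence "extend r = q" by (simp add: fun_eq_iff)
  moreover have "q (b l) \<in> polys K" if "l \<in> CC" for l
    using q(1) edges_of_IE[OF b(1)[of l]] CC_LE that unfolding cofactors_def by blast
  hence "r \<in> CCpolys" using q(1) unfolding CCpolys_def r_def cofactors_def by simp
  ultimately show "q \<in> extend ` CCpolys" using imageI[of r CCpolys extend] by simp
qed

lemma inj_extend: "inj_on extend CCpolys"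
proof (rule inj_onI)
  fix r s assume rs: "r \<in> CCpolys" "s \<in> CCpolys" "extend r = extend s"
  have "r l = s l" for l
  proof -
    consider "l = {}" | "l \<in> CC" | "l \<notin> insert {} CC" by blast
    thus ?thesis
    proof cases
      case 1
      thus ?thesis using fun_cong[OF rs(3), of "{}"] empty_notin_IE by (simp add: extend_def)
    next
      case 2
      hence l: "l \<in> LE" using CC_LE by blast
      obtain e where e: "e \<in> edges_of l" by (rule l_edge_cover[OF l l_edge_ends(2)[OF l]])
      thus ?thesis using fun_cong[OF rs(3), of e] 2 le_eq[OF l e] edges_of_IE[OF e] by (simp add: extend_def)
    next
      case 3
      thus ?thesis using rs(1,2) by (simp add: CCpolys_def)
    qed
  qed
  thus "r = s" by (simp add: fun_eq_iff)
qed

text \<open>Rank-nullity is used twice: for \<open>jumps\<close>, whose kernel comes from the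
  cross-cuts and the global polynomial, and for \<open>glue\<close>, whose kernel is the image of
  \<open>jumps\<close>.\<close>

lemma dim_cofactors:
  "int (families.dim cofactors) = int ((d + 2) choose 2) + int (card CC) * int ((d - \<mu> + 1) choose 2)
     + (\<Sum>A\<in>IV. k_dim d \<mu> (num_directions \<Delta> A)) - int (families.dim (glue ` Y))"
proof -
  interpret fy: vector_space_pair fsc ysc by (simp add: vector_space_pair_def vs_fsc vs_ysc)
  interpret yf: vector_space_pair ysc fsc by (simp add: vector_space_pair_def vs_fsc vs_ysc)
  interpret ff: vector_space_pair fsc fsc by (simp add: vector_space_pair_def vs_fsc)
  have "families.dim cofactors = vector_space.dim ysc {y \<in> Y. glue y = 0} + families.dim {q \<in> cofactors. jumps q = 0}"
    using fy.rank_nullity[OF linear_jumps subspace_cofactors fin_dim_cofactors] unfolding jumps_image .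
  moreover have "families.dim {q \<in> cofactors. jumps q = 0} = families.dim CCpolys"
    unfolding kernel_jumps[symmetric] by (rule ff.dim_image_inj[OF linear_extend subspace_CCpolys inj_extend])
  moreover have "vector_space.dim ysc Y = families.dim (glue ` Y) + vector_space.dim ysc {y \<in> Y. glue y = 0}"
    by (rule yf.rank_nullity[OF linear_glue subspace_Y fin_dim_Y])
  ultimately show ?thesis using dim_Y dim_CCpolys by simp
qed

text \<open>The columns are the coefficient vectors of \<open>glue\<close> applied to basis vectors
  of the spaces W[A]. These basis vectors span \<open>Y\<close>, and reading off the coefficients
  listed in \<open>eqs\<close> is injective on the image of \<open>glue\<close>.\<close>

lemma rank_conformality_matrix:
  assumes "conformality_matrix d \<mu> \<Psi> \<Delta> L M"
  shows "vec_space.rank (dim_row M) M = families.dim (glue ` Y)"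
proof -
  obtain B eqs unknowns where
    B: "\<forall>A\<in>IV. families.independent (B A) \<and> families.span (B A) = W A"
    and eqs: "distinct eqs" "set eqs = TE \<times> {(i, j). i + j \<le> K}"
    and unk: "distinct unknowns" "set unknowns = Sigma IV B"
    and M: "M = Matrix.mat (length eqs) (length unknowns)
          (\<lambda>(r, s). case eqs ! r of (l, i, j) \<Rightarrow> case unknowns ! s of (A, w) \<Rightarrow>
             if A \<in> l then coeff (coeff (w l) j) i else 0)"
    using assms unfolding conformality_matrix_def K_def[symmetric] by blast
  let ?s = "\<lambda>c (w :: nat \<Rightarrow> real) i. c * w i"
  interpret r: vector_space ?s by (rule vector_space_fun[OF vs_real])
  interpret y: vector_space ysc by (rule vs_ysc)
  interpret fy: vector_space_pair fsc ysc by (simp add: vector_space_pair_def vs_fsc vs_ysc)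
  interpret yf: vector_space_pair ysc fsc by (simp add: vector_space_pair_def vs_fsc vs_ysc)
  interpret fr: vector_space_pair fsc ?s by (simp add: vector_space_pair_def vs_fsc r.vector_space_axioms)
  \<comment> \<open>Coefficients in the order of the rows, continued by zero as in
    \<open>rank_eq_dim_cols\<close>.\<close>
  define \<kappa> where "\<kappa> g r = (if r < length eqs then (case eqs ! r of (l, i, j) \<Rightarrow> coeff (coeff (g l) j) i) else 0)"
    for g :: poly_family and r
  have lin\<kappa>: "Vector_Spaces.linear fsc ?s \<kappa>"
    by (rule linear_intro[OF vs_fsc r.vector_space_axioms]) (auto simp: fun_eq_iff \<kappa>_def split: prod.splits)
  have G: "g l \<in> polys K" "l \<notin> TE \<Longrightarrow> g l = 0" if "g \<in> glue ` Y" for g l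
  proof -
    obtain y where y: "y \<in> Y" "g = glue y" using \<open>g \<in> glue ` Y\<close> by (rule imageE)
    show "l \<notin> TE \<Longrightarrow> g l = 0" unfolding y(2) by (simp add: glue_def)
    have "y A l \<in> polys K" if "A \<in> IV" for A using y(1) that W_polys[of "y A" A l] unfolding Y_def by blast
    thus "g l \<in> polys K" unfolding y(2) glue_def by (auto intro!: polys_sum)
  qed
  have inj: "inj_on \<kappa> (glue ` Y)"
  proof (rule inj_onI)
    fix g h assume gh: "g \<in> glue ` Y" "h \<in> glue ` Y" "\<kappa> g = \<kappa> h"
    have "coeff (coeff (g l) j) i = coeff (coeff (h l) j) i" for l i j
    proof (cases "l \<in> TE \<and> i + j \<le> K")
      case True
      hence "(l, i, j) \<in> set eqs" unfolding eqs(2) by simp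
      then obtain r where "r < length eqs" "eqs ! r = (l, i, j)" unfolding in_set_conv_nth by blast
      thus ?thesis using fun_cong[OF gh(3), of r] by (simp add: \<kappa>_def)
    next
      case False
      show ?thesis
      proof (cases "l \<in> TE")
        case True
        hence "\<not> i + j \<le> K" using False by blast
        hence "coeff (coeff (g l) j) i = 0" "coeff (coeff (h l) j) i = 0"
          using G(1)[OF gh(1), of l] G(1)[OF gh(2), of l] unfolding polys_def by blast+
        thus ?thesis by simp
      next
        case False
        thus ?thesis using G(2)[OF gh(1)] G(2)[OF gh(2)] by simp
      qed
    qed
    thus "g = h" by (simp add: fun_eq_iff poly_eq_iff)
  qed
  define single where "single A w = (\<lambda>C. if C = A then w else 0)" for A :: point and w :: poly_family
  have lin_single: "Vector_Spaces.linear fsc ysc (single A)" for A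
    by (rule linear_intro[OF vs_fsc vs_ysc]) (auto simp: fun_eq_iff single_def)
  define S where "S = (\<lambda>(A, w). single A w) ` Sigma IV B"
  have single_Y: "single A w \<in> Y" if "A \<in> IV" "w \<in> W A" for A w
    using that W_0 unfolding Y_def single_def by auto
  have "y.span S = Y"
  proof (rule y.span_subspace[OF _ _ subspace_Y])
    show "S \<subseteq> Y" unfolding S_def
    proof (rule image_subsetI)
      fix x assume "x \<in> Sigma IV B"
      then obtain A w where x: "x = (A, w)" "A \<in> IV" "w \<in> B A" by auto
      have "w \<in> families.span (B A)" by (rule families.span_base[OF x(3)])
      hence "w \<in> W A" using B x(2) by simp
      thus "(case x of (A, w) \<Rightarrow> single A w) \<in> Y" using single_Y[OF x(2)] x(1) by simp
    qed
    show "Y \<subseteq> y.span S"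
    proof
      fix v assume v: "v \<in> Y"
      have "v = (\<Sum>A\<in>IV. single A (v A))"
      proof
        fix C
        have "(\<Sum>A\<in>IV. single A (v A)) C = (\<Sum>A\<in>IV. single A (v A) C)"
          by (rule sum_fun_apply)
        also have "\<dots> = (if C \<in> IV then v C else 0)" using finite_IV unfolding single_def by (simp add: sum.delta)
        also have "\<dots> = v C"
        proof (cases "C \<in> IV")
          case False
          hence "v C = 0" using v unfolding Y_def by blast
          thus ?thesis using False by simp
        qed simp
        finally show "v C = (\<Sum>A\<in>IV. single A (v A)) C" by simp
      qed
      moreover have "single A (v A) \<in> y.span S" if A: "A \<in> IV" for A
      proof -
        have "v A \<in> families.span (B A)" using B v A unfolding Y_def by simp
        hence "single A (v A) \<in> single A ` families.span (B A)" by (rule imageI)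
        hence "single A (v A) \<in> y.span (single A ` B A)"
          unfolding fy.linear_span_image[OF lin_single] .
        moreover have "single A ` B A \<subseteq> S" unfolding S_def using A by force
        ultimately show ?thesis using y.span_mono by blast
      qed
      ultimately show "v \<in> y.span S" by (metis (no_types, lifting) y.span_sum)
    qed
  qed
  hence "\<kappa> ` glue ` Y = r.span (\<kappa> ` glue ` S)"
    using yf.linear_span_image[OF linear_glue, of S] fr.linear_span_image[OF lin\<kappa>, of "glue ` S"] by simp
  moreover have "families.subspace (glue ` Y)" by (rule yf.linear_subspace_image[OF linear_glue subspace_Y])
  hence "r.dim (\<kappa> ` glue ` Y) = families.dim (glue ` Y)" by (rule fr.dim_image_inj[OF lin\<kappa> _ inj])
  ultimately have dim: "families.dim (glue ` Y) = r.dim (\<kappa> ` glue ` S)" using r.dim_span by simp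
  have col: "\<kappa> (glue (single A w)) = (\<lambda>i. if i < dim_row M then M $$ (i, s) else 0)"
    if s: "s < length unknowns" "unknowns ! s = (A, w)" for s A w
  proof
    fix i
    have "A \<in> IV" using s nth_mem[OF s(1)] unfolding unk(2) by simp
    hence g: "glue (single A w) l = (if A \<in> l then w l else 0)" if "l \<in> TE" for l
      using that finite_IV unfolding glue_def single_def by (simp add: sum.delta if_distrib[of "\<lambda>f. f l"] cong: if_cong)
    show "\<kappa> (glue (single A w)) i = (if i < dim_row M then M $$ (i, s) else 0)"
    proof (cases "i < length eqs")
      case True
      obtain l a b where e: "eqs ! i = (l, a, b)" by (cases "eqs ! i")
      have "l \<in> TE" using nth_mem[OF True] e unfolding eqs(2) by simp
      thus ?thesis using True s e g unfolding \<kappa>_def M by simp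
    qed (simp add: \<kappa>_def M)
  qed
  have "\<kappa> ` glue ` S = (\<lambda>j i. if i < dim_row M then M $$ (i, j) else 0) ` {..<dim_col M}"
  proof -
    have "Sigma IV B = (\<lambda>s. unknowns ! s) ` {..<length unknowns}"
      unfolding unk(2)[symmetric] using nth_image[of "length unknowns" unknowns] by (simp add: lessThan_atLeast0)
    hence "\<kappa> ` glue ` S = (\<lambda>s. \<kappa> (glue (case unknowns ! s of (A, w) \<Rightarrow> single A w))) ` {..<length unknowns}"
      by (simp only: S_def image_image)
    also have "\<dots> = (\<lambda>j i. if i < dim_row M then M $$ (i, j) else 0) ` {..<length unknowns}"
      by (rule image_cong[OF refl]) (use col in \<open>simp split: prod.splits\<close>)
    finally show ?thesis unfolding M by simp
  qed
  thus ?thesis unfolding rank_eq_dim_cols[of M] dim by simp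
qed

end

subsection \<open>Piecewise polynomials and smoothness across edges\<close>

text \<open>The direction from \<open>lo e\<close> to \<open>hi e\<close> turned counterclockwise by
  a right angle, not normalised. Hence \<open>side\<close> is positive to the left of the edge; in
  \<open>pl\<close> and \<open>pr\<close> the letters l and r stand for left and right.\<close>

definition nrm :: "point set \<Rightarrow> point" where
  "nrm e = (- (snd (hi e) - snd (lo e)), fst (hi e) - fst (lo e))"

definition side :: "point set \<Rightarrow> point \<Rightarrow> real" where
  "side e w = nrm e \<bullet> (w - lo e)"

lemma convex_side_pos: "convex {w. 0 < side e w}" and convex_side_neg: "convex {w. side e w < 0}"
  and open_side_pos: "open {w. 0 < side e w}" and open_side_neg: "open {w. side e w < 0}"
proof -
  have *: "{w. 0 < side e w} = {w. nrm e \<bullet> w > nrm e \<bullet> lo e}" "{w. side e w < 0} = {w. nrm e \<bullet> w < nrm e \<bullet> lo e}"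
    by (auto simp: side_def inner_diff_right)
  show "convex {w. 0 < side e w}" "convex {w. side e w < 0}" "open {w. 0 < side e w}" "open {w. side e w < 0}"
    unfolding * by (rule convex_halfspace_gt convex_halfspace_lt open_halfspace_gt open_halfspace_lt)+
qed

lemma side_add: "side e (w + t *\<^sub>R nrm e) = side e w + t * (nrm e \<bullet> nrm e)"
  by (simp add: side_def inner_simps algebra_simps)

lemma tendsto_Union_within:
  assumes "finite F" "\<And>S. S \<in> F \<Longrightarrow> (f \<longlongrightarrow> l) (at z within S)"
  shows "(f \<longlongrightarrow> l) (at z within \<Union>F)"
  using assms
proof (induction F rule: finite_induct)
  case (insert S F)
  thus ?case by (simp add: Lim_Un)
qed simp

text \<open>A limit may be tested on each of finitely many pieces. A closed piece that does not
  contain \<open>z\<close> does not accumulate at \<open>z\<close>, so the limit along it is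
  trivial.\<close>

lemma tendsto_at_local_cover:
  assumes F: "finite F" and r: "r > 0" "ball z r \<subseteq> \<Union>F" and cl: "\<And>S. S \<in> F \<Longrightarrow> closed S"
    and lim: "\<And>S. S \<in> F \<Longrightarrow> z \<in> S \<Longrightarrow> (f \<longlongrightarrow> l) (at z within S \<inter> ball z r)"
  shows "(f \<longlongrightarrow> l) (at z)"
proof -
  have "(f \<longlongrightarrow> l) (at z within \<Union>((\<lambda>S. S \<inter> ball z r) ` F))"
  proof (rule tendsto_Union_within)
    fix S' assume "S' \<in> (\<lambda>S. S \<inter> ball z r) ` F"
    then obtain S where S: "S \<in> F" "S' = S \<inter> ball z r" by blast
    show "(f \<longlongrightarrow> l) (at z within S')"
    proof (cases "z \<in> S")
      case False
      have "\<not> z islimpt S" using cl[OF S(1)] False closed_limpt by blast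
      hence "\<not> z islimpt S'" unfolding S(2) using islimpt_subset by blast
      hence "at z within S' = bot" using trivial_limit_within by blast
      thus ?thesis by simp
    qed (use lim[OF S(1)] S(2) in simp)
  qed (use F in simp)
  moreover have "\<Union>((\<lambda>S. S \<inter> ball z r) ` F) = ball z r" using r(2) by blast
  ultimately show ?thesis using r(1) by (simp add: at_within_open[OF _ open_ball])
qed

lemma closure_finite_Union: "finite F \<Longrightarrow> closure (\<Union>F) = \<Union>(closure ` F)"
  by (induction F rule: finite_induct) simp_all

text \<open>Vanishing of all iterated directional derivatives up to order k at one point, in the
  recursion pattern of \<open>C_on\<close>.\<close>

fun vanish :: "nat \<Rightarrow> real poly poly \<Rightarrow> point \<Rightarrow> bool" where
  "vanish 0 p z \<longleftrightarrow> poly2 p z = 0"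
| "vanish (Suc k) p z \<longleftrightarrow> poly2 p z = 0 \<and> (\<forall>h. vanish k (dirp h p) z)"

lemma vanish_imp_0: "vanish k p z \<Longrightarrow> poly2 p z = 0"
  by (cases k) auto

lemma vanish_power:
  assumes "poly2 L z = 0" "L ^ Suc k dvd p"
  shows "vanish k p z"
  using assms(2)
proof (induction k arbitrary: p)
  case 0
  then show ?case using assms(1) by (auto elim!: dvdE)
next
  case (Suc k)
  have "poly2 p z = 0" using Suc.prems assms(1) by (auto elim!: dvdE)
  thus ?case using Suc.IH[OF power_dvd_dirp[OF Suc.prems]] by simp
qed

lemma C_on_cong:
  assumes "open S" "\<And>z. z \<in> S \<Longrightarrow> f z = g z"
  shows "C_on k S f \<longleftrightarrow> C_on k S g"
proof (cases k)
  case 0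
  thus ?thesis using continuous_on_cong[OF refl assms(2)] by simp
next
  case (Suc k')
  have "(f has_derivative D) (at z) \<longleftrightarrow> (g has_derivative D) (at z)" if "z \<in> S" for z D
    using has_derivative_transform_within_open[OF _ assms(1) that, of f D UNIV g]
      has_derivative_transform_within_open[OF _ assms(1) that, of g D UNIV f] assms(2) by auto
  thus ?thesis unfolding Suc by simp
qed

section \<open>Local structure of the cells and piecewise polynomials\<close>

context partition
begin

definition Om :: "point set" where
  "Om = \<Psi> - \<Union>{convex hull e |e. e \<in> \<Delta>}"

lemma Om_eq: "Om = \<Psi> - (\<Union>e\<in>\<Delta>. seg e)"
  unfolding Om_def by blast

lemma closed_segs: "X \<subseteq> \<Delta> \<Longrightarrow> closed (\<Union>e\<in>X. seg e)"
proof (rule closed_UN)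
  assume X: "X \<subseteq> \<Delta>"
  show "finite X" using X finite_edges finite_subset by blast
  show "\<forall>e\<in>X. closed (seg e)" using X seg_eq by auto
qed

lemma open_Om: "open Om"
  unfolding Om_eq by (intro open_Diff open_domain closed_segs) simp

lemma good_ball:
  assumes "z \<in> \<Psi>"
  obtains r where "r > 0" "ball z r \<subseteq> \<Psi>" "\<And>f w. f \<in> \<Delta> \<Longrightarrow> w \<in> ball z r \<Longrightarrow> w \<in> seg f \<Longrightarrow> z \<in> seg f"
proof -
  define X where "X = {f \<in> \<Delta>. z \<notin> seg f}"
  have "open (\<Psi> - (\<Union>f\<in>X. seg f))" unfolding X_def by (intro open_Diff open_domain closed_segs) auto
  moreover have "z \<in> \<Psi> - (\<Union>f\<in>X. seg f)" using assms unfolding X_def by blast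
  ultimately obtain r where r: "r > 0" "ball z r \<subseteq> \<Psi> - (\<Union>f\<in>X. seg f)" by (rule openE)
  show ?thesis
  proof (rule that[OF r(1)])
    show "ball z r \<subseteq> \<Psi>" using r(2) by blast
    show "z \<in> seg f" if "f \<in> \<Delta>" "w \<in> ball z r" "w \<in> seg f" for f w
      using that r(2) unfolding X_def by blast
  qed
qed

lemma nrm_nonzero: "e \<in> \<Delta> \<Longrightarrow> nrm e \<noteq> 0"
  using lo_ne_hi by (auto simp: nrm_def prod_eq_iff)

lemma side_lo_hi: "side e (lo e) = 0" "side e (hi e) = 0"
  by (simp_all add: side_def nrm_def inner_prod_def algebra_simps)

lemma side_seg:
  assumes "e \<in> \<Delta>" "w \<in> seg e"
  shows "side e w = 0"
proof -
  obtain t where "w = (1 - t) *\<^sub>R lo e + t *\<^sub>R hi e"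
    using assms(2) unfolding seg_eq[OF assms(1)] closed_segment_def by blast
  hence "w - lo e = t *\<^sub>R (hi e - lo e)" by (simp add: algebra_simps)
  hence "side e w = t * side e (hi e)" unfolding side_def by simp
  thus ?thesis using side_lo_hi by simp
qed

text \<open>The full lines through the edges, not only the edges, cut the ball into regions of
  constant sign. These are convex and avoid all edges. What they leave out lies on finitely many
  lines, so their closures fill the ball.\<close>

lemma local_cover:
  assumes "z \<in> \<Psi>"
  obtains r F where "r > 0" "ball z r \<subseteq> \<Psi>" "finite F" "\<And>R. R \<in> F \<Longrightarrow> convex R \<and> R \<subseteq> Om"
    "ball z r \<subseteq> \<Union>(closure ` F)"
proof -
  obtain r where r: "r > 0" "ball z r \<subseteq> \<Psi>" "\<And>f w. f \<in> \<Delta> \<Longrightarrow> w \<in> ball z r \<Longrightarrow> w \<in> seg f \<Longrightarrow> z \<in> seg f"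
    by (rule good_ball[OF assms]) blast
  define R where "R T = ball z r \<inter> (\<Inter>e\<in>T. {w. 0 < side e w}) \<inter> (\<Inter>e\<in>\<Delta> - T. {w. side e w < 0})" for T
  define F where "F = R ` Pow \<Delta>"
  have fin: "finite F" unfolding F_def using finite_edges by simp
  have "convex S \<and> S \<subseteq> Om" if "S \<in> F" for S
  proof -
    obtain T where T: "T \<subseteq> \<Delta>" "S = R T" using \<open>S \<in> F\<close> unfolding F_def by blast
    have "convex S" unfolding T(2) R_def
      by (intro convex_Int convex_ball convex_INT convex_side_pos convex_side_neg)
    moreover have "w \<in> Om" if "w \<in> S" for w
    proof -
      have w: "\<And>e. e \<in> T \<Longrightarrow> 0 < side e w" "\<And>e. e \<in> \<Delta> - T \<Longrightarrow> side e w < 0"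
        using \<open>w \<in> S\<close> unfolding T(2) R_def by blast+
      have "side e w \<noteq> 0" if "e \<in> \<Delta>" for e
        using w(1)[of e] w(2)[of e] that by (cases "e \<in> T") auto
      hence "w \<notin> seg e" if "e \<in> \<Delta>" for e using side_seg that by blast
      moreover have "w \<in> \<Psi>" using \<open>w \<in> S\<close> r(2) unfolding T(2) R_def by blast
      ultimately show ?thesis unfolding Om_eq by blast
    qed
    ultimately show ?thesis by blast
  qed
  moreover have "ball z r \<subseteq> \<Union>(closure ` F)"
  proof -
    \<comment> \<open>The union of the lines is negligible, hence contains no nonempty open
      set.\<close>
    define N where "N = (\<Union>e\<in>\<Delta>. {w. nrm e \<bullet> w = nrm e \<bullet> lo e})"
    have negl: "negligible N" unfolding N_def
      using finite_edges nrm_nonzero by (intro negligible_Union) (auto intro: negligible_hyperplane)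
    have sub: "ball z r - N \<subseteq> \<Union>F"
    proof
      fix w assume w: "w \<in> ball z r - N"
      define T where "T = {e \<in> \<Delta>. 0 < side e w}"
      have "side e w \<noteq> 0" if "e \<in> \<Delta>" for e
        using w that unfolding N_def side_def by (auto simp: inner_diff_right)
      hence neg: "side e w < 0" if "e \<in> \<Delta> - T" for e
        using that unfolding T_def by (cases "side e w" "0 :: real" rule: linorder_cases) auto
      have pos: "0 < side e w" if "e \<in> T" for e using that unfolding T_def by blast
      have "w \<in> R T" unfolding R_def
        by (intro IntI INT_I CollectI) (use w pos neg in simp_all)
      moreover have "R T \<in> F" unfolding F_def T_def by blast
      ultimately show "w \<in> \<Union>F" by blast
    qed
    have "\<Union>(closure ` F) = closure (\<Union>F)" by (rule closure_finite_Union[OF fin, symmetric])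
    moreover have "ball z r \<subseteq> closure (\<Union>F)"
    proof (rule ccontr)
      assume "\<not> ball z r \<subseteq> closure (\<Union>F)"
      hence ne: "ball z r - closure (\<Union>F) \<noteq> {}" by blast
      have "open (ball z r - closure (\<Union>F))" by (intro open_Diff) auto
      moreover have "ball z r - closure (\<Union>F) \<subseteq> N" using sub closure_subset by blast
      ultimately show False using ne negl negligible_subset open_not_negligible by blast
    qed
    ultimately show ?thesis by simp
  qed
  ultimately show ?thesis using that r(1,2) fin by blast
qed

lemma Om_dense: "\<Psi> \<subseteq> closure Om"
proof
  fix z assume z: "z \<in> \<Psi>"
  obtain r F where rF: "r > 0" "ball z r \<subseteq> \<Psi>" "finite F" "\<And>R. R \<in> F \<Longrightarrow> convex R \<and> R \<subseteq> Om"
    "ball z r \<subseteq> \<Union>(closure ` F)" by (rule local_cover[OF z]) blast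
  then obtain R where "R \<in> F" "z \<in> closure R" using centre_in_ball by blast
  thus "z \<in> closure Om" using rF(4) closure_mono by blast
qed

text \<open>The coefficients are frozen at \<open>w\<close>, which gives the polynomial that
  represents the function near \<open>w\<close>, even though the \<theta> i themselves are not
  constant.\<close>

definition psum :: "'i set \<Rightarrow> ('i \<Rightarrow> point \<Rightarrow> real) \<Rightarrow> ('i \<Rightarrow> real poly poly) \<Rightarrow> point \<Rightarrow> real poly poly" where
  "psum I \<theta> J w = (\<Sum>i\<in>I. Polynomial.smult [:\<theta> i w:] (J i))"

lemma poly2_psum: "poly2 (psum I \<theta> J w) z = (\<Sum>i\<in>I. \<theta> i w * poly2 (J i) z)"
  unfolding psum_def poly2_sum by simp

text \<open>Local constancy on the union of the cells, stated through convex subsets because balls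
  and the sign regions of \<open>local_cover\<close> are convex; \<open>piecewise_connected\<close>
  passes to whole cells.\<close>

definition piecewise :: "(point \<Rightarrow> 'a) \<Rightarrow> bool" where
  "piecewise P \<longleftrightarrow> (\<forall>C. convex C \<and> C \<subseteq> Om \<longrightarrow> (\<forall>w\<in>C. \<forall>w'\<in>C. P w = P w'))"

lemma piecewiseD: "piecewise P \<Longrightarrow> convex C \<Longrightarrow> C \<subseteq> Om \<Longrightarrow> w \<in> C \<Longrightarrow> w' \<in> C \<Longrightarrow> P w = P w'"
  unfolding piecewise_def by blast

lemma psum_closure:
  assumes pw: "piecewise (psum I \<theta> J)" and R: "convex R" "R \<subseteq> Om" "w0 \<in> R" "z \<in> closure R"
    and c: "\<And>i. i \<in> I \<Longrightarrow> isCont (\<theta> i) z \<or> poly2 (J i) z = 0"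
  shows "poly2 (psum I \<theta> J w0) z = (\<Sum>i\<in>I. \<theta> i z * poly2 (J i) z)"
proof (cases "z \<in> R")
  case True
  have "psum I \<theta> J w0 = psum I \<theta> J z" by (rule piecewiseD[OF pw R(1,2,3) True])
  thus ?thesis by (simp add: poly2_psum)
next
  case False
  hence lp: "z islimpt R" using R(4) closure_def by blast
  hence nt: "at z within R \<noteq> bot" using trivial_limit_within by blast
  have A: "((\<lambda>w. \<Sum>i\<in>I. \<theta> i w * poly2 (J i) z) \<longlongrightarrow> (\<Sum>i\<in>I. \<theta> i z * poly2 (J i) z)) (at z within R)"
  proof (rule tendsto_sum)
    fix i assume "i \<in> I"
    from c[OF this] show "((\<lambda>w. \<theta> i w * poly2 (J i) z) \<longlongrightarrow> \<theta> i z * poly2 (J i) z) (at z within R)"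
    proof
      assume "isCont (\<theta> i) z"
      hence "(\<theta> i \<longlongrightarrow> \<theta> i z) (at z within R)"
        unfolding isCont_def by (rule tendsto_within_subset) simp
      thus ?thesis by (intro tendsto_mult tendsto_const)
    qed simp
  qed
  have "eventually (\<lambda>w. (\<Sum>i\<in>I. \<theta> i w * poly2 (J i) z) = poly2 (psum I \<theta> J w0) z) (at z within R)"
    unfolding eventually_at_filter
  proof (rule always_eventually, intro allI impI)
    fix w assume "w \<in> R"
    have "psum I \<theta> J w0 = psum I \<theta> J w" by (rule piecewiseD[OF pw R(1,2,3) \<open>w \<in> R\<close>])
    thus "(\<Sum>i\<in>I. \<theta> i w * poly2 (J i) z) = poly2 (psum I \<theta> J w0) z" by (simp add: poly2_psum)
  qed
  hence B: "((\<lambda>w. \<Sum>i\<in>I. \<theta> i w * poly2 (J i) z) \<longlongrightarrow> poly2 (psum I \<theta> J w0) z) (at z within R)"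
    by (rule tendsto_eventually)
  show ?thesis by (rule tendsto_unique[OF nt B A])
qed

lemma piecewise_dirp:
  assumes "piecewise (psum I \<theta> J)"
  shows "piecewise (psum I \<theta> (\<lambda>i. dirp h (J i)))"
proof -
  have "psum I \<theta> (\<lambda>i. dirp h (J i)) = (\<lambda>w. dirp h (psum I \<theta> J w))"
    unfolding psum_def by (simp add: dirp_sum dirp_smult)
  moreover have "piecewise (\<lambda>w. dirp h (psum I \<theta> J w))"
    unfolding piecewise_def
    by (intro allI impI ballI arg_cong[where f = "dirp h"]) (rule piecewiseD[OF assms], auto)
  ultimately show ?thesis by simp
qed

text \<open>Discontinuities of \<open>\<theta>\<close> are harmless where the polynomial factor vanishes to sufficient order:
  near any point the function coincides with finitely many polynomials on closed sets, and the
  formula for the derivatives does not depend on the piece.\<close>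

lemma C_on_psum:
  assumes "piecewise (psum I \<theta> J)" "\<And>i z. i \<in> I \<Longrightarrow> z \<in> \<Psi> \<Longrightarrow> isCont (\<theta> i) z \<or> vanish k (J i) z"
  shows "C_on k \<Psi> (\<lambda>z. \<Sum>i\<in>I. \<theta> i z * poly2 (J i) z)"
  using assms
proof (induction k arbitrary: J)
  case 0
  have "((\<lambda>z. \<Sum>i\<in>I. \<theta> i z * poly2 (J i) z) \<longlongrightarrow> (\<Sum>i\<in>I. \<theta> i z * poly2 (J i) z)) (at z)" if z: "z \<in> \<Psi>" for z
  proof -
    obtain r F where rF: "r > 0" "ball z r \<subseteq> \<Psi>" "finite F" "\<And>R. R \<in> F \<Longrightarrow> convex R \<and> R \<subseteq> Om"
      "ball z r \<subseteq> \<Union>(closure ` F)" by (rule local_cover[OF z]) blast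
    show ?thesis
    proof (rule tendsto_at_local_cover[OF _ rF(1,5)])
      fix S assume "S \<in> closure ` F" "z \<in> S"
      then obtain R where R: "R \<in> F" "S = closure R" by blast
      then obtain w0 where w0: "w0 \<in> R" using \<open>z \<in> S\<close> by (metis closure_empty equals0I empty_iff)
      have eq: "(\<Sum>i\<in>I. \<theta> i y * poly2 (J i) y) = poly2 (psum I \<theta> J w0) y" if y: "y \<in> S \<inter> ball z r" for y
      proof (rule psum_closure[symmetric, OF 0(1) _ _ w0])
        show "isCont (\<theta> i) y \<or> poly2 (J i) y = 0" if "i \<in> I" for i
          using 0(2)[OF that, of y] y rF(2) by auto
      qed (use rF(4)[OF R(1)] y R(2) in auto)
      have "(poly2 (psum I \<theta> J w0) \<longlongrightarrow> poly2 (psum I \<theta> J w0) z) (at z within S \<inter> ball z r)"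
        using has_derivative_continuous[OF has_derivative_poly2] unfolding continuous_within .
      moreover have "eventually (\<lambda>y. poly2 (psum I \<theta> J w0) y = (\<Sum>i\<in>I. \<theta> i y * poly2 (J i) y)) (at z within S \<inter> ball z r)"
        unfolding eventually_at_filter by (rule always_eventually) (simp add: eq)
      ultimately show "((\<lambda>z. \<Sum>i\<in>I. \<theta> i z * poly2 (J i) z) \<longlongrightarrow> (\<Sum>i\<in>I. \<theta> i z * poly2 (J i) z)) (at z within S \<inter> ball z r)"
        using eq[of z] \<open>z \<in> S\<close> rF(1) by (simp add: Lim_transform_eventually)
    qed (use rF(3) in auto)
  qed
  thus ?case by (simp add: continuous_on_eq_continuous_at[OF open_domain] isCont_def)
next
  case (Suc k)
  define f where "f z = (\<Sum>i\<in>I. \<theta> i z * poly2 (J i) z)" for z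
  \<comment> \<open>The \<theta> i are treated as constants: only the polynomial factors are
    differentiated.\<close>
  define f' where "f' z h = (\<Sum>i\<in>I. \<theta> i z * poly2 (dirp h (J i)) z)" for z h
  have "(f has_derivative f' z) (at z)" if z: "z \<in> \<Psi>" for z
  proof -
    obtain r F where rF: "r > 0" "ball z r \<subseteq> \<Psi>" "finite F" "\<And>R. R \<in> F \<Longrightarrow> convex R \<and> R \<subseteq> Om"
      "ball z r \<subseteq> \<Union>(closure ` F)" by (rule local_cover[OF z]) blast
    have D: "(f has_derivative f' z) (at z within S \<inter> ball z r)" if "S \<in> closure ` F" "z \<in> S" for S
    proof -
      obtain R where R: "R \<in> F" "S = closure R" using \<open>S \<in> closure ` F\<close> by blast
      then obtain w0 where w0: "w0 \<in> R" using \<open>z \<in> S\<close> by (metis closure_empty equals0I empty_iff)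
      have eq: "f y = poly2 (psum I \<theta> J w0) y" if y: "y \<in> S \<inter> ball z r" for y
        unfolding f_def
      proof (rule psum_closure[symmetric, OF Suc.prems(1) _ _ w0])
        show "isCont (\<theta> i) y \<or> poly2 (J i) y = 0" if "i \<in> I" for i
          using Suc.prems(2)[OF that, of y] y rF(2) by auto
      qed (use rF(4)[OF R(1)] y R(2) in auto)
      have eq': "poly2 (dirp h (psum I \<theta> J w0)) z = f' z h" for h
      proof -
        have "dirp h (psum I \<theta> J w0) = psum I \<theta> (\<lambda>i. dirp h (J i)) w0"
          unfolding psum_def by (simp add: dirp_sum dirp_smult)
        moreover have "poly2 (psum I \<theta> (\<lambda>i. dirp h (J i)) w0) z = f' z h"
          unfolding f'_def
        proof (rule psum_closure[OF piecewise_dirp[OF Suc.prems(1)] _ _ w0])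
          show "isCont (\<theta> i) z \<or> poly2 (dirp h (J i)) z = 0" if "i \<in> I" for i
            using Suc.prems(2)[OF that z] vanish_imp_0 unfolding vanish.simps by blast
        qed (use rF(4)[OF R(1)] \<open>z \<in> S\<close> R(2) in auto)
        ultimately show ?thesis by simp
      qed
      have "(poly2 (psum I \<theta> J w0) has_derivative f' z) (at z within S \<inter> ball z r)"
        using has_derivative_poly2[of "psum I \<theta> J w0" z "S \<inter> ball z r"] unfolding eq' .
      thus ?thesis
        by (rule has_derivative_transform[rotated 2]) (use eq \<open>z \<in> S\<close> rF(1) in auto)
    qed
    obtain S where S: "S \<in> closure ` F" "z \<in> S" using rF(1,5) centre_in_ball by blast
    have "bounded_linear (f' z)" using D[OF S] by (rule has_derivative_bounded_linear)
    moreover have "((\<lambda>y. (1 / norm (y - z)) *\<^sub>R (f y - (f z + f' z (y - z)))) \<longlongrightarrow> 0) (at z)"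
      by (rule tendsto_at_local_cover[OF _ rF(1,5)]) (use rF(3) D in \<open>auto simp: has_derivative_within\<close>)
    ultimately show ?thesis unfolding has_derivative_within by blast
  qed
  moreover have "C_on k \<Psi> (\<lambda>z. f' z h)" for h
    unfolding f'_def
  proof (rule Suc.IH[OF piecewise_dirp[OF Suc.prems(1)]])
    show "isCont (\<theta> i) z \<or> vanish k (dirp h (J i)) z" if "i \<in> I" "z \<in> \<Psi>" for i z
      using Suc.prems(2)[OF that] unfolding vanish.simps by blast
  qed
  ultimately show ?case unfolding f_def[symmetric] by (auto intro: exI[of _ f'])
qed

section \<open>Values on the two sides of an edge\<close>

definition sides :: "(point \<Rightarrow> 'a) \<Rightarrow> point set \<Rightarrow> 'a \<Rightarrow> 'a \<Rightarrow> bool" where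
  "sides P e pl pr \<longleftrightarrow> (\<forall>z\<in>open_segment (lo e) (hi e). \<exists>r>0. ball z r \<subseteq> \<Psi> \<and>
     (\<forall>w\<in>ball z r. (0 < side e w \<longrightarrow> w \<in> Om \<and> P w = pl) \<and> (side e w < 0 \<longrightarrow> w \<in> Om \<and> P w = pr)))"

lemma side_ball:
  assumes "e \<in> IE" "z \<in> open_segment (lo e) (hi e)"
  obtains r where "r > 0" "ball z r \<subseteq> \<Psi>" "\<And>w. w \<in> ball z r \<Longrightarrow> side e w \<noteq> 0 \<Longrightarrow> w \<in> Om"
proof -
  have e: "e \<in> \<Delta>" using assms(1) IE_subset by blast
  have z: "z \<in> \<Psi>" "z \<in> seg e" "z \<notin> e"
    using open_seg_domain[OF assms(1)] assms(2) seg_eq[OF e] edge_eq[OF e] unfolding open_segment_def by auto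
  obtain r where r: "r > 0" "ball z r \<subseteq> \<Psi>" "\<And>f w. f \<in> \<Delta> \<Longrightarrow> w \<in> ball z r \<Longrightarrow> w \<in> seg f \<Longrightarrow> z \<in> seg f"
    by (rule good_ball[OF z(1)]) blast
  show ?thesis
  proof (rule that[OF r(1,2)])
    fix w assume w: "w \<in> ball z r" "side e w \<noteq> 0"
    have "w \<notin> seg f" if f: "f \<in> \<Delta>" for f
    proof
      assume wf: "w \<in> seg f"
      have "f \<noteq> e" using wf w(2) side_seg[OF e] by blast
      thus False using r(3)[OF f w(1) wf] seg_Int[OF e f] z by blast
    qed
    thus "w \<in> Om" unfolding Om_eq using w(1) r(2) by blast
  qed
qed

lemma side_pts:
  assumes "e \<in> \<Delta>" "r > 0" "side e z = 0"
  shows "\<exists>w\<in>ball z r. 0 < side e w" "\<exists>w\<in>ball z r. side e w < 0"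
proof -
  define t where "t = r / (2 * norm (nrm e))"
  have n: "norm (nrm e) > 0" "nrm e \<bullet> nrm e > 0" using nrm_nonzero[OF assms(1)] by auto
  hence t: "t > 0" using assms(2) by (simp add: t_def)
  have "norm (t *\<^sub>R nrm e) < r" using n(1) assms(2) unfolding t_def by simp
  hence "z + t *\<^sub>R nrm e \<in> ball z r" "z + (- t) *\<^sub>R nrm e \<in> ball z r" by (simp_all add: dist_norm)
  moreover have "0 < side e (z + t *\<^sub>R nrm e)" "side e (z + (- t) *\<^sub>R nrm e) < 0"
    unfolding side_add assms(3) using t n(2) by auto
  ultimately show "\<exists>w\<in>ball z r. 0 < side e w" "\<exists>w\<in>ball z r. side e w < 0" by blast+
qed

text \<open>Near a point of the open edge both half-discs are convex and free of edges, so
  \<open>P\<close> takes one value on each. The pair of values is locally constant along the open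
  edge, which is connected.\<close>

lemma sides_exist:
  assumes pw: "piecewise P" and e: "e \<in> IE"
  obtains pl pr where "sides P e pl pr"
proof -
  have eD: "e \<in> \<Delta>" using e IE_subset by blast
  let ?S = "open_segment (lo e) (hi e)"
  define Q where "Q z p \<longleftrightarrow> (\<exists>r>0. ball z r \<subseteq> \<Psi> \<and> (\<forall>w\<in>ball z r. (0 < side e w \<longrightarrow> w \<in> Om \<and> P w = fst p) \<and> (side e w < 0 \<longrightarrow> w \<in> Om \<and> P w = snd p)))" for z p
  have s0: "side e z = 0" if "z \<in> ?S" for z
    using side_seg[OF eD] that unfolding seg_eq[OF eD] open_segment_def by blast
  have ex: "\<exists>p. Q z p" if z: "z \<in> ?S" for z
  proof -
    obtain r where r: "r > 0" "ball z r \<subseteq> \<Psi>" "\<And>w. w \<in> ball z r \<Longrightarrow> side e w \<noteq> 0 \<Longrightarrow> w \<in> Om"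
      by (rule side_ball[OF e z]) blast
    obtain a b where ab: "a \<in> ball z r" "0 < side e a" "b \<in> ball z r" "side e b < 0"
      using side_pts[OF eD r(1) s0[OF z]] by blast
    have c: "convex (ball z r \<inter> {w. 0 < side e w})" "convex (ball z r \<inter> {w. side e w < 0})"
      by (intro convex_Int convex_ball convex_side_pos convex_side_neg)+
    have s: "ball z r \<inter> {w. 0 < side e w} \<subseteq> Om" "ball z r \<inter> {w. side e w < 0} \<subseteq> Om" using r(3) by auto
    have "P w = P a" if "w \<in> ball z r" "0 < side e w" for w
      by (rule piecewiseD[OF pw c(1) s(1)]) (use that ab in auto)
    moreover have "P w = P b" if "w \<in> ball z r" "side e w < 0" for w
      by (rule piecewiseD[OF pw c(2) s(2)]) (use that ab in auto)
    ultimately have "Q z (P a, P b)" unfolding Q_def using r by auto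
    thus ?thesis by blast
  qed
  have uniq: "p = q" if zS: "z \<in> ?S" and zp: "Q z p" and zq: "Q z q" for z p q
  proof -
    obtain r where r: "r > 0" "\<forall>w\<in>ball z r. (0 < side e w \<longrightarrow> w \<in> Om \<and> P w = fst p) \<and> (side e w < 0 \<longrightarrow> w \<in> Om \<and> P w = snd p)"
      using zp unfolding Q_def by blast
    obtain s where s: "s > 0" "\<forall>w\<in>ball z s. (0 < side e w \<longrightarrow> w \<in> Om \<and> P w = fst q) \<and> (side e w < 0 \<longrightarrow> w \<in> Om \<and> P w = snd q)"
      using zq unfolding Q_def by blast
    have m: "min r s > 0" using r(1) s(1) by simp
    obtain a b where "a \<in> ball z (min r s)" "0 < side e a" "b \<in> ball z (min r s)" "side e b < 0"
      using side_pts[OF eD m s0[OF zS]] by blast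
    hence "fst p = fst q" "snd p = snd q" using r(2) s(2) by auto
    thus ?thesis by (simp add: prod_eq_iff)
  qed
  have near: "\<exists>r>0. \<forall>z'\<in>ball z r. Q z' p" if zp: "Q z p" for z p
  proof -
    obtain r where r: "r > 0" "ball z r \<subseteq> \<Psi>" "\<forall>w\<in>ball z r. (0 < side e w \<longrightarrow> w \<in> Om \<and> P w = fst p) \<and> (side e w < 0 \<longrightarrow> w \<in> Om \<and> P w = snd p)"
      using zp unfolding Q_def by blast
    have "Q z' p" if z': "z' \<in> ball z r" for z'
    proof -
      obtain r' where "r' > 0" "ball z' r' \<subseteq> ball z r" using z' by (rule openE[OF open_ball])
      thus ?thesis unfolding Q_def using r(2,3) by (intro exI[of _ r']) blast
    qed
    thus ?thesis using r(1) by blast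
  qed
  define g where "g z = (SOME p. Q z p)" for z
  have g: "Q z (g z)" if "z \<in> ?S" for z unfolding g_def by (rule someI_ex[OF ex[OF that]])
  have "g z = g z'" if zz: "z \<in> ?S" "z' \<in> ?S" for z z'
  proof (rule connected_local_const[OF _ zz])
    show "connected ?S" by (rule convex_connected) simp
    show "\<forall>a\<in>?S. \<forall>\<^sub>F b in at a within ?S. g a = g b"
    proof
      fix a assume a: "a \<in> ?S"
      obtain r where r: "r > 0" "\<forall>z'\<in>ball a r. Q z' (g a)" using near[OF g[OF a]] by blast
      have "g a = g b" if "b \<in> ?S" "dist b a < r" for b
        by (rule uniq[OF that(1) _ g[OF that(1)]]) (use r(2) that(2) in \<open>simp add: dist_commute\<close>)
      thus "\<forall>\<^sub>F b in at a within ?S. g a = g b" unfolding eventually_at using r(1) by blast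
    qed
  qed
  moreover obtain z0 where "z0 \<in> ?S" using lo_ne_hi[OF eD] by (metis open_segment_eq_empty ex_in_conv)
  ultimately have "sides P e (fst (g z0)) (snd (g z0))"
    using g unfolding sides_def Q_def by metis
  thus ?thesis by (rule that)
qed

text \<open>Induction on the order. Continuity makes \<open>pl - pr\<close> zero along the edge, so
  \<open>L\<close> divides it. The directional derivatives of \<open>f\<close> are one order less
  smooth and have the derivatives of \<open>pl\<close> and \<open>pr\<close> as their values on the
  two sides; \<open>power_dvd_step\<close> turns divisibility of these into one more power of
  \<open>L\<close>.\<close>

lemma C_on_imp_dvd:
  assumes e: "e \<in> IE" and L: "L = [:[:a, b:], [:c:]:]" "b \<noteq> 0 \<or> c \<noteq> 0"
    and L0: "\<And>z. z \<in> open_segment (lo e) (hi e) \<Longrightarrow> poly2 L z = 0"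
  shows "C_on k \<Psi> f \<Longrightarrow> (\<And>z. z \<in> open_segment (lo e) (hi e) \<Longrightarrow> \<exists>r>0. ball z r \<subseteq> \<Psi> \<and> (\<forall>w\<in>ball z r.
      (0 < side e w \<longrightarrow> f w = poly2 pl w) \<and> (side e w < 0 \<longrightarrow> f w = poly2 pr w)))
    \<Longrightarrow> L ^ Suc k dvd pl - pr"
proof -
  let ?S = "open_segment (lo e) (hi e)"
  have eD: "e \<in> \<Delta>" using e IE_subset by blast
  have s0: "side e z = 0" if "z \<in> ?S" for z
    using side_seg[OF eD] that unfolding seg_eq[OF eD] open_segment_def by blast
  have inf: "infinite ?S" using lo_ne_hi[OF eD] by simp
  have base: "L dvd pl - pr"
    if cont: "continuous_on \<Psi> f" and loc: "\<And>z. z \<in> ?S \<Longrightarrow> \<exists>r>0. ball z r \<subseteq> \<Psi> \<and> (\<forall>w\<in>ball z r.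
      (0 < side e w \<longrightarrow> f w = poly2 pl w) \<and> (side e w < 0 \<longrightarrow> f w = poly2 pr w))" for f pl pr
  proof (rule linear_dvd_if_zeros[OF L inf L0])
    fix z assume z: "z \<in> ?S"
    obtain r where r: "r > 0" "ball z r \<subseteq> \<Psi>" "\<forall>w\<in>ball z r. (0 < side e w \<longrightarrow> f w = poly2 pl w) \<and> (side e w < 0 \<longrightarrow> f w = poly2 pr w)"
      using loc[OF z] by blast
    have "z \<in> \<Psi>" using r(1,2) by auto
    hence cf: "isCont f z" using cont continuous_on_eq_continuous_at[OF open_domain] by blast
    have n: "nrm e \<bullet> nrm e > 0" using nrm_nonzero[OF eD] by simp
    have lim: "poly2 p z = f z" if s: "s \<noteq> 0" "\<And>w. w \<in> ball z r \<Longrightarrow> 0 < s * side e w \<Longrightarrow> f w = poly2 p w" for p s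
    proof -
      \<comment> \<open>The point \<open>z\<close> is approached along the normal, on the side given
        by the sign of s.\<close>
      define w where "w t = z + (s * t) *\<^sub>R nrm e" for t :: real
      have w: "(w \<longlongrightarrow> z) (at_right 0)" unfolding w_def by (auto intro!: tendsto_eq_intros)
      have "eventually (\<lambda>t. w t \<in> ball z r) (at_right 0)"
        using w r(1) by (metis centre_in_ball open_ball topological_tendstoD)
      moreover have "eventually (\<lambda>t. (0::real) < t) (at_right 0)" by (simp add: eventually_at_right_less)
      ultimately have ev: "eventually (\<lambda>t. poly2 p (w t) = f (w t)) (at_right 0)"
      proof eventually_elim
        case (elim t)
        have eq: "s * side e (w t) = (s * s) * (t * (nrm e \<bullet> nrm e))" unfolding w_def side_add s0[OF z] by simp
        have "0 < s * s" unfolding power2_eq_square[symmetric] using s(1) by simp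
        hence "0 < s * side e (w t)" unfolding eq by (rule mult_pos_pos[OF _ mult_pos_pos[OF elim(2) n]])
        thus ?case using s(2)[OF elim(1)] by simp
      qed
      have "((\<lambda>t. f (w t)) \<longlongrightarrow> f z) (at_right 0)" using isCont_tendsto_compose[OF cf w] .
      moreover have "isCont (poly2 p) z" by (rule has_derivative_continuous[OF has_derivative_poly2])
      hence "((\<lambda>t. poly2 p (w t)) \<longlongrightarrow> poly2 p z) (at_right 0)" using isCont_tendsto_compose[OF _ w] by blast
      hence "((\<lambda>t. f (w t)) \<longlongrightarrow> poly2 p z) (at_right 0)" by (rule Lim_transform_eventually[OF _ ev])
      ultimately show ?thesis using tendsto_unique[OF trivial_limit_at_right_real] by blast
    qed
    have "poly2 pl z = f z" by (rule lim[of 1]) (use r(3) in auto)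
    moreover have "poly2 pr z = f z" by (rule lim[of "- 1"]) (use r(3) in auto)
    ultimately show "poly2 (pl - pr) z = 0" by simp
  qed
  show "C_on k \<Psi> f \<Longrightarrow> (\<And>z. z \<in> ?S \<Longrightarrow> \<exists>r>0. ball z r \<subseteq> \<Psi> \<and> (\<forall>w\<in>ball z r.
      (0 < side e w \<longrightarrow> f w = poly2 pl w) \<and> (side e w < 0 \<longrightarrow> f w = poly2 pr w)))
    \<Longrightarrow> L ^ Suc k dvd pl - pr"
  proof (induction k arbitrary: f pl pr)
    case 0
    show ?case using base[OF _ 0(2)] 0(1) by simp
  next
    case (Suc k)
    obtain f' where f': "\<And>z. z \<in> \<Psi> \<Longrightarrow> (f has_derivative f' z) (at z)" "\<And>h. C_on k \<Psi> (\<lambda>z. f' z h)"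
      using Suc.prems(1) by auto
    have "continuous_on \<Psi> f"
      using f'(1) by (auto intro!: continuous_at_imp_continuous_on has_derivative_continuous)
    hence "L dvd pl - pr" using base Suc.prems(2) by blast
    moreover have "L ^ Suc k dvd dirp h (pl - pr)" for h
      unfolding dirp_diff
    proof (rule Suc.IH[OF f'(2)])
      fix z assume "z \<in> ?S"
      then obtain r where r: "r > 0" "ball z r \<subseteq> \<Psi>" "\<forall>w\<in>ball z r. (0 < side e w \<longrightarrow> f w = poly2 pl w) \<and> (side e w < 0 \<longrightarrow> f w = poly2 pr w)"
        using Suc.prems(2) by blast
      have der: "f' w h = poly2 (dirp h p) w"
        if "open X" "w \<in> X" "X \<subseteq> ball z r" "\<And>v. v \<in> X \<Longrightarrow> f v = poly2 p v" for X w p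
      proof -
        have "(f has_derivative f' w) (at w)" using f'(1) that(2,3) r(2) by blast
        hence "(poly2 p has_derivative f' w) (at w)"
          by (rule has_derivative_transform_within_open[OF _ that(1,2)]) (rule that(4))
        thus ?thesis by (rule poly2_derivative_eq)
      qed
      have "f' w h = poly2 (dirp h pl) w" if "w \<in> ball z r" "0 < side e w" for w
        by (rule der[of "ball z r \<inter> {w. 0 < side e w}"]) (use that r(3) open_side_pos in auto)
      moreover have "f' w h = poly2 (dirp h pr) w" if "w \<in> ball z r" "side e w < 0" for w
        by (rule der[of "ball z r \<inter> {w. side e w < 0}"]) (use that r(3) open_side_neg in auto)
      ultimately show "\<exists>r>0. ball z r \<subseteq> \<Psi> \<and> (\<forall>w\<in>ball z r.
        (0 < side e w \<longrightarrow> f' w h = poly2 (dirp h pl) w) \<and> (side e w < 0 \<longrightarrow> f' w h = poly2 (dirp h pr) w))"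
        using r(1,2) by blast
    qed
    ultimately show ?case by (rule power_dvd_step[OF L])
  qed
qed

end

subsection \<open>Monodromy around a vertex\<close>

abbreviation "dir (t :: real) \<equiv> (cos t, sin t)"

lemma polar_form:
  assumes "b \<noteq> (0 :: point)"
  obtains r t where "r > 0" "b = r *\<^sub>R dir t"
proof -
  obtain r a where ra: "fst b = r * cos a" "snd b = r * sin a" using polar_Ex by blast
  have b: "b = r *\<^sub>R dir a" using ra by (simp add: prod_eq_iff)
  have "r \<noteq> 0"
  proof
    assume "r = 0"
    hence "b = 0" using b by (simp only: scaleR_zero_left)
    thus False using assms by simp
  qed
  thus ?thesis
  proof (cases "r > 0")
    case False
    hence "- r > 0" using \<open>r \<noteq> 0\<close> by simp
    moreover have "b = (- r) *\<^sub>R dir (a + pi)" using b by simp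
    ultimately show ?thesis by (rule that)
  qed (use that b in blast)
qed

lemma dir_eq_iff: "dir s = dir t \<longleftrightarrow> (\<exists>k::int. s = t + 2 * pi * k)"
  using sin_cos_eq_iff[of s t] by auto

lemma norm_dir [simp]: "norm (dir t) = 1"
  by (simp add: norm_Pair real_norm_def)

lemma eventually_floor_const:
  assumes "\<And>k :: int. s0 \<noteq> T + 2 * pi * k"
  shows "\<forall>\<^sub>F s in at s0. \<lfloor>(s - T) / (2 * pi)\<rfloor> = \<lfloor>(s0 - T) / (2 * pi)\<rfloor>"
proof -
  define k where "k = \<lfloor>(s0 - T) / (2 * pi)\<rfloor>"
  have "of_int k \<noteq> (s0 - T) / (2 * pi)" using assms[of k] by (auto simp: field_simps)
  hence k: "of_int k < (s0 - T) / (2 * pi)" "(s0 - T) / (2 * pi) < of_int k + 1"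
    unfolding k_def by linarith+
  have lim: "((\<lambda>s. (s - T) / (2 * pi)) \<longlongrightarrow> (s0 - T) / (2 * pi)) (at s0)"
    by (intro tendsto_intros) simp
  show ?thesis
    using order_tendstoD(1)[OF lim k(1)] order_tendstoD(2)[OF lim k(2)]
    by eventually_elim (simp add: k_def[symmetric] floor_unique)
qed

text \<open>The floor increases by one exactly when s passes the direction T modulo 2 pi, and the
  sign of the sine tells on which side of the corresponding ray the point lies.\<close>

lemma eventually_floor_jump:
  fixes k :: int
  assumes s0: "s0 = T + 2 * pi * k"
  shows "\<forall>\<^sub>F s in at_right s0. \<lfloor>(s - T) / (2 * pi)\<rfloor> = k \<and> 0 < sin (s - T)"
    "\<forall>\<^sub>F s in at_left s0. \<lfloor>(s - T) / (2 * pi)\<rfloor> = k - 1 \<and> sin (s - T) < 0"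
proof -
  have sinp: "sin (s - T) = sin (s - s0)" for s
  proof -
    have "sin (s - T) = sin (s - s0) \<and> cos (s - T) = cos (s - s0)"
      unfolding sin_cos_eq_iff by (rule exI[of _ k]) (simp add: s0)
    thus ?thesis by simp
  qed
  have "\<forall>\<^sub>F s in at_right s0. s \<in> {s0<..<s0 + pi}" by (rule eventually_at_right_real) simp
  thus "\<forall>\<^sub>F s in at_right s0. \<lfloor>(s - T) / (2 * pi)\<rfloor> = k \<and> 0 < sin (s - T)"
  proof eventually_elim
    case (elim s)
    have "0 < sin (s - s0)" using elim by (intro sin_gt_zero) auto
    moreover have "\<lfloor>(s - T) / (2 * pi)\<rfloor> = k"
      using elim s0 pi_gt_zero by (intro floor_unique) (auto simp: field_simps)
    ultimately show ?case unfolding sinp by blast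
  qed
  have "\<forall>\<^sub>F s in at_left s0. s \<in> {s0 - pi<..<s0}" by (rule eventually_at_left_real) simp
  thus "\<forall>\<^sub>F s in at_left s0. \<lfloor>(s - T) / (2 * pi)\<rfloor> = k - 1 \<and> sin (s - T) < 0"
  proof eventually_elim
    case (elim s)
    have "0 < sin (s0 - s)" using elim by (intro sin_gt_zero) auto
    hence "sin (s - s0) < 0" using sin_minus[of "s0 - s"] by simp
    moreover have "\<lfloor>(s - T) / (2 * pi)\<rfloor> = k - 1"
      using elim s0 pi_gt_zero by (intro floor_unique) (auto simp: field_simps)
    ultimately show ?case unfolding sinp by blast
  qed
qed

context partition
begin

lemma piecewise_connected:
  assumes pw: "piecewise P" and C: "connected C" "C \<subseteq> Om" "a \<in> C" "b \<in> C"
  shows "P a = P b"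
proof (rule connected_local_const[OF C(1,3,4)], rule ballI)
  fix a assume "a \<in> C"
  hence "a \<in> Om" using C(2) by blast
  then obtain r where r: "r > 0" "ball a r \<subseteq> Om" by (rule openE[OF open_Om])
  have "P a = P b" if "dist b a < r" for b
    by (rule piecewiseD[OF pw convex_ball r(2)]) (use r(1) that in \<open>auto simp: dist_commute\<close>)
  thus "\<forall>\<^sub>F b in at a within C. P a = P b" unfolding eventually_at using r(1) by blast
qed

text \<open>Every point of \<Psi> that is not a vertex has a neighbourhood in which \<open>P\<close>
  takes a single value off the edges, also when the point lies on an edge. Removing finitely many
  points leaves an open connected set in the plane connected, so these values agree
  globally.\<close>

lemma no_jump_const:
  assumes pw: "piecewise P" and nj: "\<And>e. e \<in> IE \<Longrightarrow> \<exists>p. sides P e p p"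
  obtains p where "\<And>w. w \<in> Om \<Longrightarrow> P w = p"
proof -
  define Q where "Q z p \<longleftrightarrow> (\<exists>r>0. \<forall>w\<in>ball z r. w \<in> Om \<longrightarrow> P w = p)" for z p
  define X where "X = \<Psi> - \<Union>\<Delta>"
  have ex: "\<exists>p. Q z p" if z: "z \<in> X" for z
  proof (cases "z \<in> Om")
    case True
    obtain r where r: "r > 0" "ball z r \<subseteq> Om" by (rule openE[OF open_Om True])
    have "P w = P z" if "w \<in> ball z r" for w
      by (rule piecewiseD[OF pw convex_ball r(2) that]) (use r(1) in simp)
    hence "Q z (P z)" unfolding Q_def using r(1) by blast
    thus ?thesis by blast
  next
    case False
    then obtain e where e: "e \<in> \<Delta>" "z \<in> seg e" using z unfolding X_def Om_eq by blast
    have IE: "e \<in> IE" unfolding interior_edges_def using e z domain_frontier(1) unfolding X_def by blast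
    have "z \<in> open_segment (lo e) (hi e)"
      using e z seg_eq[OF e(1)] edge_eq[OF e(1)] unfolding X_def open_segment_def by blast
    moreover obtain p where "sides P e p p" using nj[OF IE] by blast
    ultimately obtain r where r: "r > 0" "\<forall>w\<in>ball z r. (0 < side e w \<longrightarrow> w \<in> Om \<and> P w = p) \<and> (side e w < 0 \<longrightarrow> w \<in> Om \<and> P w = p)"
      unfolding sides_def by blast
    have "P w = p" if w: "w \<in> ball z r" "w \<in> Om" for w
    proof (cases "side e w = 0")
      case True
      \<comment> \<open>The ball may reach beyond the end points of \<open>e\<close>, and then
        \<open>w\<close> can lie on the line of \<open>e\<close> without lying on an edge. Moving
        slightly to the left does not change \<open>P\<close>.\<close>
      have "w \<in> Om \<inter> ball z r" "open (Om \<inter> ball z r)" using w open_Om by auto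
      then obtain s where s: "s > 0" "ball w s \<subseteq> Om \<inter> ball z r" using openE by blast
      obtain w' where w': "w' \<in> ball w s" "0 < side e w'" using side_pts(1)[OF e(1) s(1) True] by blast
      have "ball w s \<subseteq> Om" "w \<in> ball w s" using s by auto
      from piecewiseD[OF pw convex_ball this w'(1)] have "P w = P w'" .
      also have "\<dots> = p" using r(2) w' s(2) by blast
      finally show ?thesis .
    next
      case False
      thus ?thesis using r(2) w(1) by (metis linorder_neqE_linordered_idom)
    qed
    hence "Q z p" unfolding Q_def using r(1) by blast
    thus ?thesis by blast
  qed
  have uniq: "p = q" if zX: "z \<in> X" and zp: "Q z p" and zq: "Q z q" for z p q
  proof -
    obtain r where r: "r > 0" "\<forall>w\<in>ball z r. w \<in> Om \<longrightarrow> P w = p" using zp unfolding Q_def by blast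
    obtain s where s: "s > 0" "\<forall>w\<in>ball z s. w \<in> Om \<longrightarrow> P w = q" using zq unfolding Q_def by blast
    have "z \<in> closure Om" using zX Om_dense unfolding X_def by blast
    moreover have "min r s > 0" using r(1) s(1) by simp
    ultimately obtain w where "w \<in> Om" "dist w z < min r s" unfolding closure_approachable by blast
    thus ?thesis using r(2) s(2) by (metis dist_commute mem_ball min_less_iff_conj)
  qed
  have near: "\<exists>r>0. \<forall>z'\<in>ball z r. Q z' p" if zp: "Q z p" for z p
  proof -
    obtain r where r: "r > 0" "\<forall>w\<in>ball z r. w \<in> Om \<longrightarrow> P w = p" using zp unfolding Q_def by blast
    have "Q z' p" if z': "z' \<in> ball z r" for z'
    proof -
      obtain r' where "r' > 0" "ball z' r' \<subseteq> ball z r" using z' by (rule openE[OF open_ball])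
      thus ?thesis unfolding Q_def using r(2) by blast
    qed
    thus ?thesis using r(1) by blast
  qed
  define g where "g z = (SOME p. Q z p)" for z
  have g: "Q z (g z)" if "z \<in> X" for z unfolding g_def by (rule someI_ex[OF ex[OF that]])
  have "finite (\<Union>\<Delta>)" by (rule finite_Union[OF finite_edges]) (use card_edge card_ge_0_finite in force)
  hence "connected X" unfolding X_def
    by (intro connected_open_diff_countable open_domain connected_domain countable_finite) simp
  hence const: "g z = g z'" if "z \<in> X" "z' \<in> X" for z z'
  proof (rule connected_local_const[OF _ that], intro ballI)
    fix a assume a: "a \<in> X"
    obtain r where r: "r > 0" "\<forall>z'\<in>ball a r. Q z' (g a)" using near[OF g[OF a]] by blast
    have "g a = g b" if "b \<in> X" "dist b a < r" for b
      by (rule uniq[OF that(1) _ g[OF that(1)]]) (use r(2) that(2) in \<open>simp add: dist_commute\<close>)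
    thus "\<forall>\<^sub>F b in at a within X. g a = g b" unfolding eventually_at using r(1) by blast
  qed
  have OX: "w \<in> X" if "w \<in> Om" for w
  proof -
    have "w \<notin> e" if "e \<in> \<Delta>" for e using \<open>w \<in> Om\<close> that hull_inc[of w e convex] unfolding Om_eq by blast
    thus ?thesis using that unfolding X_def Om_eq by blast
  qed
  have Pg: "P w = g w" if w: "w \<in> Om" for w
  proof -
    obtain r where "r > 0" "\<forall>v\<in>ball w r. v \<in> Om \<longrightarrow> P v = g w" using g[OF OX[OF w]] unfolding Q_def by blast
    thus ?thesis using w by auto
  qed
  show ?thesis
  proof (cases "Om = {}")
    case True
    thus ?thesis using that by blast
  next
    case False
    then obtain w0 where "w0 \<in> Om" by blast
    hence "P w = g w0" if "w \<in> Om" for w using Pg[OF that] const[OF OX[OF that] OX] by simp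
    thus ?thesis by (rule that)
  qed
qed

text \<open>Going once around the vertex, the value of the piecewise polynomial returns to itself, although
  it picks up all jumps at the edges; the floor functions count how often each edge was crossed.\<close>

lemma vertex_condition_aux:
  assumes pw: "piecewise P" and sd: "\<And>e. e \<in> IE \<Longrightarrow> sides P e (pl e) (pr e)" and A: "A \<in> IV"
  shows "(\<Sum>e\<in>{e \<in> \<Delta>. A \<in> e}. (if lo e = A then 1 else - 1) * poly2 (pl e - pr e) x) = 0"
proof -
  define E where "E = {e \<in> \<Delta>. A \<in> e}"
  have A\<Psi>: "A \<in> \<Psi>" "A \<in> \<Union>\<Delta>" using A unfolding IV_def by auto
  have finE: "finite E" unfolding E_def using finite_edges by simp
  have E: "e \<in> \<Delta>" "e \<in> IE" if "e \<in> E" for e using that edge_at_interior[of e A] A\<Psi>(1) unfolding E_def by simp_all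
  have ends: "A = lo e \<or> A = hi e" if "e \<in> E" for e
    using that edge_eq unfolding E_def by blast
  define oth where "oth e = (if lo e = A then hi e else lo e)" for e
  have oth: "e = {A, oth e}" "oth e \<noteq> A" if "e \<in> E" for e
  proof -
    have e: "e = {lo e, hi e}" "lo e \<noteq> hi e" using edge_eq[OF E(1)[OF that]] lo_ne_hi[OF E(1)[OF that]] by blast+
    have "{lo e, hi e} = {A, oth e}" using ends[OF that] unfolding oth_def by auto
    thus "e = {A, oth e}" using e(1) by simp
    show "oth e \<noteq> A" using ends[OF that] e(2) unfolding oth_def by auto
  qed
  have "\<exists>r t. e \<in> E \<longrightarrow> r > 0 \<and> oth e = A + r *\<^sub>R dir t" for e
  proof (cases "e \<in> E")
    case True
    then obtain r t where "r > 0" "oth e - A = r *\<^sub>R dir t" using polar_form[of "oth e - A"] oth(2) by auto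
    thus ?thesis by (metis add.commute diff_add_cancel)
  qed simp
  then obtain \<rho> T where \<rho>T: "\<And>e. e \<in> E \<Longrightarrow> \<rho> e > 0" "\<And>e. e \<in> E \<Longrightarrow> oth e = A + \<rho> e *\<^sub>R dir (T e)" by metis
  \<comment> \<open>With this sign a counterclockwise crossing leads from right to left if the edge
    starts at \<open>A\<close> and from left to right if it ends there.\<close>
  define \<sigma> where "\<sigma> e = (if lo e = A then 1 else - 1 :: real)" for e
  have side_dir: "side e (A + r *\<^sub>R dir s) = \<sigma> e * (\<rho> e * r) * sin (s - T e)" if e: "e \<in> E" for e r s
  proof (cases "lo e = A")
    case True
    hence "hi e = A + \<rho> e *\<^sub>R dir (T e)" using \<rho>T(2)[OF e] by (simp add: oth_def)
    thus ?thesis using True by (simp add: side_def nrm_def inner_prod_def \<sigma>_def sin_diff algebra_simps)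
  next
    case False
    hence "hi e = A" using ends[OF e] by auto
    moreover have "lo e = A + \<rho> e *\<^sub>R dir (T e)" using \<rho>T(2)[OF e] False by (simp add: oth_def)
    ultimately show ?thesis using False by (simp add: side_def nrm_def inner_prod_def \<sigma>_def sin_diff algebra_simps)
  qed
  obtain r0 where r0: "r0 > 0" "ball A r0 \<subseteq> \<Psi>" "\<And>f w. f \<in> \<Delta> \<Longrightarrow> w \<in> ball A r0 \<Longrightarrow> w \<in> seg f \<Longrightarrow> A \<in> seg f"
    by (rule good_ball[OF A\<Psi>(1)]) blast
  \<comment> \<open>The circle of this radius meets only edges at \<open>A\<close> and stays short
    of their other ends; halving makes the bounds strict.\<close>
  define R where "R = Min (insert r0 (\<rho> ` E)) / 2"
  have "Min (insert r0 (\<rho> ` E)) > 0" using finE r0(1) \<rho>T(1) by (subst Min_gr_iff) auto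
  hence R: "R > 0" unfolding R_def by simp
  have "Min (insert r0 (\<rho> ` E)) \<le> r0" "\<And>e. e \<in> E \<Longrightarrow> Min (insert r0 (\<rho> ` E)) \<le> \<rho> e" using finE by auto
  hence R': "R < r0" "\<And>e. e \<in> E \<Longrightarrow> R < \<rho> e" using R unfolding R_def by force+
  define \<phi> where "\<phi> s = A + R *\<^sub>R dir s" for s
  have \<phi>ball: "\<phi> s \<in> ball A r0" for s
  proof -
    have "dist (\<phi> s) A = norm (R *\<^sub>R dir s)" by (simp only: \<phi>_def dist_norm add_diff_cancel_left')
    also have "\<dots> = R" unfolding norm_scaleR norm_dir using R by simp
    finally show ?thesis using R'(1) by (simp add: dist_commute)
  qed
  have on_edge: "\<exists>k::int. s = T f + 2 * pi * k" if f: "f \<in> \<Delta>" "\<phi> s \<in> seg f" and fE: "f \<in> E" for f s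
  proof -
    have "seg f = closed_segment A (oth f)" using oth(1)[OF fE] segment_convex_hull by metis
    then obtain u where u: "0 \<le> u" "\<phi> s = (1 - u) *\<^sub>R A + u *\<^sub>R oth f" using f(2) unfolding closed_segment_def by auto
    hence eq: "R *\<^sub>R dir s = (u * \<rho> f) *\<^sub>R dir (T f)" unfolding \<phi>_def \<rho>T(2)[OF fE] by (simp add: algebra_simps)
    hence "norm (R *\<^sub>R dir s) = norm ((u * \<rho> f) *\<^sub>R dir (T f))" by simp
    hence Ru: "R = u * \<rho> f" using R u(1) \<rho>T(1)[OF fE] unfolding norm_scaleR norm_dir by simp
    have "dir s = dir (T f)" by (rule scaleR_left_imp_eq[OF _ eq[folded Ru]]) (use R in simp)
    thus ?thesis unfolding dir_eq_iff .
  qed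
  have inE: "f \<in> E" if "f \<in> \<Delta>" "\<phi> s \<in> seg f" for f s
    using r0(3)[OF that(1) \<phi>ball that(2)] vertex_on_edge[OF A\<Psi>(2) that(1)] that(1) unfolding E_def by blast
  have uniqE: "e = f" if "e \<in> E" "f \<in> E" "dir (T e) = dir (T f)" for e f
  proof -
    have "f = {A, A + (\<rho> f / \<rho> e) *\<^sub>R (\<rho> e *\<^sub>R dir (T e))}"
      using oth(1)[OF that(2)] \<rho>T(1)[OF that(1)] \<rho>T(2)[OF that(2)] that(3) by simp
    moreover have "e = {A, A + \<rho> e *\<^sub>R dir (T e)}" using oth(1)[OF that(1)] \<rho>T(2)[OF that(1)] by simp
    moreover have "0 < \<rho> f / \<rho> e" using \<rho>T(1) that by simp
    ultimately show ?thesis using same_ray_same_edge[of A "\<rho> e *\<^sub>R dir (T e)" "\<rho> f / \<rho> e"] E(1) that(1,2) by metis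
  qed
  define J where "J e = \<sigma> e * poly2 (pl e - pr e) x" for e
  \<comment> \<open>The value on the circle minus all jumps picked up so far, hence without jumps of
    its own.\<close>
  define G where "G s = poly2 (P (\<phi> s)) x - (\<Sum>e\<in>E. of_int \<lfloor>(s - T e) / (2 * pi)\<rfloor> * J e)" for s
  have \<phi>lim: "(\<phi> \<longlongrightarrow> \<phi> s0) (at s0)" for s0 unfolding \<phi>_def by (intro tendsto_intros)
  have ex: "\<exists>g. \<forall>\<^sub>F s in at s0. G s = g" for s0
  proof (cases "\<exists>e0\<in>E. \<exists>k::int. s0 = T e0 + 2 * pi * k")
    case False
    have "\<phi> s0 \<in> Om" unfolding Om_eq using \<phi>ball r0(2) on_edge inE False by blast
    then obtain r where r: "r > 0" "ball (\<phi> s0) r \<subseteq> Om" by (rule openE[OF open_Om])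
    have "\<forall>\<^sub>F s in at s0. \<phi> s \<in> ball (\<phi> s0) r"
      using topological_tendstoD[OF \<phi>lim open_ball] r(1) centre_in_ball by blast
    moreover have "\<forall>\<^sub>F s in at s0. \<forall>e\<in>E. \<lfloor>(s - T e) / (2 * pi)\<rfloor> = \<lfloor>(s0 - T e) / (2 * pi)\<rfloor>"
      by (rule eventually_ball_finite[OF finE]) (use eventually_floor_const False in blast)
    ultimately have "\<forall>\<^sub>F s in at s0. G s = G s0"
    proof eventually_elim
      case (elim s)
      have "P (\<phi> s) = P (\<phi> s0)" by (rule piecewiseD[OF pw convex_ball r(2) elim(1)]) (use r(1) in simp)
      thus ?case unfolding G_def using elim(2) by simp
    qed
    thus ?thesis by blast
  next
    case True
    then obtain e0 and k :: int where e0: "e0 \<in> E" "s0 = T e0 + 2 * pi * k" by blast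
    have others: "s0 \<noteq> T e + 2 * pi * k'" if e: "e \<in> E - {e0}" for e and k' :: int
    proof
      assume "s0 = T e + 2 * pi * k'"
      hence "dir s0 = dir (T e)" "dir s0 = dir (T e0)" using e0(2) unfolding dir_eq_iff by blast+
      hence "e = e0" using uniqE[of e e0] e e0(1) by simp
      thus False using e by blast
    qed
    have "dir s0 = dir (T e0)" using e0(2) unfolding dir_eq_iff by blast
    hence "\<phi> s0 = (1 - R / \<rho> e0) *\<^sub>R A + (R / \<rho> e0) *\<^sub>R oth e0"
      unfolding \<phi>_def \<rho>T(2)[OF e0(1)] using \<rho>T(1)[OF e0(1)] by (simp add: algebra_simps)
    moreover have "0 < R / \<rho> e0" "R / \<rho> e0 < 1" using R R'(2)[OF e0(1)] \<rho>T(1)[OF e0(1)] by auto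
    ultimately have "\<phi> s0 \<in> open_segment A (oth e0)" using oth(2)[OF e0(1)] unfolding in_segment by metis
    also have "open_segment A (oth e0) = open_segment (lo e0) (hi e0)"
    proof (cases "lo e0 = A")
      case False
      hence "hi e0 = A" using ends[OF e0(1)] by auto
      thus ?thesis using False by (simp add: oth_def open_segment_commute)
    qed (simp add: oth_def)
    finally obtain r where r: "r > 0" "\<forall>w\<in>ball (\<phi> s0) r. (0 < side e0 w \<longrightarrow> w \<in> Om \<and> P w = pl e0) \<and> (side e0 w < 0 \<longrightarrow> w \<in> Om \<and> P w = pr e0)"
      using sd[OF E(2)[OF e0(1)]] unfolding sides_def by blast
    define c where "c = (\<Sum>e\<in>E - {e0}. of_int \<lfloor>(s0 - T e) / (2 * pi)\<rfloor> * J e)"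
    define g where "g = (if lo e0 = A then poly2 (pl e0) x else poly2 (pr e0) x) - of_int k * J e0 - c"
    have near: "\<forall>\<^sub>F s in at s0. \<phi> s \<in> ball (\<phi> s0) r"
      using topological_tendstoD[OF \<phi>lim open_ball] r(1) centre_in_ball by blast
    have fl: "\<forall>\<^sub>F s in at s0. \<forall>e\<in>E - {e0}. \<lfloor>(s - T e) / (2 * pi)\<rfloor> = \<lfloor>(s0 - T e) / (2 * pi)\<rfloor>"
      by (rule eventually_ball_finite) (use finE eventually_floor_const others in auto)
    have Gs: "G s = poly2 (P (\<phi> s)) x - of_int \<lfloor>(s - T e0) / (2 * pi)\<rfloor> * J e0 - c"
      if "\<forall>e\<in>E - {e0}. \<lfloor>(s - T e) / (2 * pi)\<rfloor> = \<lfloor>(s0 - T e) / (2 * pi)\<rfloor>" for s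
      unfolding G_def c_def sum.remove[OF finE e0(1)] using that by simp
    have pos: "0 < \<rho> e0 * R" using R \<rho>T(1)[OF e0(1)] by simp
    have rt: "\<forall>\<^sub>F s in at_right s0. G s = g"
      using eventually_floor_jump(1)[OF e0(2)]
        filter_leD[OF at_le[OF subset_UNIV] near] filter_leD[OF at_le[OF subset_UNIV] fl]
    proof eventually_elim
      case (elim s)
      have "P (\<phi> s) = (if lo e0 = A then pl e0 else pr e0)"
        using r(2) elim(1,2) pos side_dir[OF e0(1), of R s]
        unfolding \<phi>_def[symmetric] \<sigma>_def by (auto simp: zero_less_mult_iff)
      thus ?case unfolding Gs[OF elim(3)] g_def using elim(1) by simp
    qed
    have lt: "\<forall>\<^sub>F s in at_left s0. G s = g"
      using eventually_floor_jump(2)[OF e0(2)]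
        filter_leD[OF at_le[OF subset_UNIV] near] filter_leD[OF at_le[OF subset_UNIV] fl]
    proof eventually_elim
      case (elim s)
      have "P (\<phi> s) = (if lo e0 = A then pr e0 else pl e0)"
        using r(2) elim(1,2) pos side_dir[OF e0(1), of R s]
        unfolding \<phi>_def[symmetric] \<sigma>_def by (auto simp: mult_less_0_iff zero_less_mult_iff)
      moreover have "\<lfloor>(s - T e0) / (2 * pi)\<rfloor> = k - 1" using elim(1) by blast
      ultimately show ?case unfolding Gs[OF elim(3)] g_def J_def \<sigma>_def
        by (simp only: of_int_diff) (simp add: left_diff_distrib)
    qed
    show ?thesis using rt lt eventually_at_split by blast
  qed
  \<comment> \<open>At a crossing the point lies on an edge, where \<open>P\<close> is not
    controlled. The constant value of \<open>G\<close> in a punctured neighbourhood is used in place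
    of \<open>G s0\<close>.\<close>
  define gv where "gv s0 = (SOME g. \<forall>\<^sub>F s in at s0. G s = g)" for s0
  have gv: "\<forall>\<^sub>F s in at s0. G s = gv s0" for s0 unfolding gv_def by (rule someI_ex[OF ex])
  have const: "gv a = gv b" for a b
  proof (rule connected_local_const[where f = gv and A = UNIV])
    show "\<forall>a\<in>UNIV. \<forall>\<^sub>F b in at a within UNIV. gv a = gv b"
    proof
      fix a
      obtain \<delta> where \<delta>: "\<delta> > 0" "\<And>s. s \<noteq> a \<Longrightarrow> dist s a < \<delta> \<Longrightarrow> G s = gv a"
        using gv[of a] unfolding eventually_at by blast
      have "gv a = gv b" if b: "b \<noteq> a" "dist b a < \<delta>" for b
      proof -
        have "b \<in> ball a \<delta> - {a}" "open (ball a \<delta> - {a})" using b by (auto simp: dist_commute)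
        then have "\<forall>\<^sub>F s in at b. s \<in> ball a \<delta> - {a}" by (intro eventually_at_in_open')
        hence "\<forall>\<^sub>F s in at b. G s = gv a" by eventually_elim (use \<delta>(2) in \<open>auto simp: dist_commute\<close>)
        hence "\<forall>\<^sub>F s in at b. gv a = gv b" using gv[of b] by eventually_elim simp
        thus ?thesis by simp
      qed
      thus "\<forall>\<^sub>F b in at a within UNIV. gv a = gv b" unfolding eventually_at using \<delta>(1) by blast
    qed
  qed auto
  \<comment> \<open>A full turn restores the point, while every floor increases by one.\<close>
  have shift: "G (s + 2 * pi) = G s - (\<Sum>e\<in>E. J e)" for s
  proof -
    have "(s + 2 * pi - T e) / (2 * pi) = (s - T e) / (2 * pi) + 1" for e by (simp add: field_simps)
    hence "\<lfloor>(s + 2 * pi - T e) / (2 * pi)\<rfloor> = \<lfloor>(s - T e) / (2 * pi)\<rfloor> + 1" for e by simp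
    moreover have "\<phi> (s + 2 * pi) = \<phi> s" unfolding \<phi>_def by simp
    ultimately show ?thesis unfolding G_def by (simp add: distrib_right sum.distrib)
  qed
  obtain \<delta>1 where d1: "\<delta>1 > 0" "\<And>s. s \<noteq> 0 \<Longrightarrow> dist s 0 < \<delta>1 \<Longrightarrow> G s = gv 0"
    using gv[of 0] unfolding eventually_at by blast
  obtain \<delta>2 where d2: "\<delta>2 > 0" "\<And>s. s \<noteq> 2 * pi \<Longrightarrow> dist s (2 * pi) < \<delta>2 \<Longrightarrow> G s = gv (2 * pi)"
    using gv[of "2 * pi"] unfolding eventually_at by blast
  define s where "s = min \<delta>1 \<delta>2 / 2"
  have s: "s > 0" "s < \<delta>1" "s < \<delta>2" unfolding s_def using d1(1) d2(1) by auto
  have "G s = gv 0" by (rule d1(2)) (use s in auto)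
  moreover have "G (s + 2 * pi) = gv (2 * pi)" by (rule d2(2)) (use s in \<open>auto simp: dist_real_def\<close>)
  ultimately have "(\<Sum>e\<in>E. J e) = 0" using shift[of s] const[of 0 "2 * pi"] by simp
  thus ?thesis unfolding J_def \<sigma>_def E_def .
qed

lemma vertex_condition:
  fixes P :: "point \<Rightarrow> real poly poly"
  assumes "piecewise P" "\<And>e. e \<in> IE \<Longrightarrow> sides P e (pl e) (pr e)" "A \<in> IV"
  shows "(\<Sum>e\<in>{e \<in> IE. lo e = A}. pl e - pr e) - (\<Sum>e\<in>{e \<in> IE. hi e = A}. pl e - pr e) = 0"
proof (rule poly2_eqI)
  fix x
  have A: "A \<in> \<Psi>" using assms(3) IV_def by blast
  have eq: "{e \<in> \<Delta>. A \<in> e} = {e \<in> IE. lo e = A} \<union> {e \<in> IE. hi e = A}"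
  proof (intro equalityI subsetI)
    fix e assume "e \<in> {e \<in> \<Delta>. A \<in> e}"
    hence e: "e \<in> \<Delta>" "A \<in> e" by auto
    have "A = lo e \<or> A = hi e" using edge_eq[OF e(1)] e(2) by blast
    thus "e \<in> {e \<in> IE. lo e = A} \<union> {e \<in> IE. hi e = A}" using edge_at_interior[OF e A] by auto
  next
    fix e assume "e \<in> {e \<in> IE. lo e = A} \<union> {e \<in> IE. hi e = A}"
    thus "e \<in> {e \<in> \<Delta>. A \<in> e}" using lo_in[of e] hi_in[of e] subsetD[OF IE_subset, of e] by auto
  qed
  have dj: "{e \<in> IE. lo e = A} \<inter> {e \<in> IE. hi e = A} = {}"
    using lo_ne_hi subsetD[OF IE_subset] by fastforce
  have "0 = (\<Sum>e\<in>{e \<in> \<Delta>. A \<in> e}. (if lo e = A then 1 else - 1) * poly2 (pl e - pr e) x)"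
    using vertex_condition_aux[OF assms, of x] by simp
  also have "\<dots> = (\<Sum>e\<in>{e \<in> IE. lo e = A}. (if lo e = A then 1 else - 1) * poly2 (pl e - pr e) x)
      + (\<Sum>e\<in>{e \<in> IE. hi e = A}. (if lo e = A then 1 else - 1) * poly2 (pl e - pr e) x)"
    unfolding eq using finite_IE dj by (intro sum.union_disjoint) auto
  also have "(\<Sum>e\<in>{e \<in> IE. lo e = A}. (if lo e = A then 1 else - 1) * poly2 (pl e - pr e) x)
     = (\<Sum>e\<in>{e \<in> IE. lo e = A}. poly2 (pl e - pr e) x)" by (intro sum.cong) auto
  also have "(\<Sum>e\<in>{e \<in> IE. hi e = A}. (if lo e = A then 1 else - 1) * poly2 (pl e - pr e) x)
     = (\<Sum>e\<in>{e \<in> IE. hi e = A}. - poly2 (pl e - pr e) x)"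
    using dj by (intro sum.cong) auto
  also have "\<dots> = - (\<Sum>e\<in>{e \<in> IE. hi e = A}. poly2 (pl e - pr e) x)" by (rule sum_negf)
  finally show "poly2 ((\<Sum>e\<in>{e \<in> IE. lo e = A}. pl e - pr e) - (\<Sum>e\<in>{e \<in> IE. hi e = A}. pl e - pr e)) x = poly2 0 x"
    by (simp add: poly2_sum)
qed

end

subsection \<open>Winding functions of edges\<close>

definition cx :: "point \<Rightarrow> complex" where "cx z = Complex (fst z) (snd z)"

lemma cx_simps [simp]: "Re (cx z) = fst z" "Im (cx z) = snd z"
  by (simp_all add: cx_def)

lemma cx_eq_iff [simp]: "cx z = cx w \<longleftrightarrow> z = w"
  by (simp add: complex_eq_iff prod_eq_iff)

lemma continuous_on_cx [continuous_intros]: "continuous_on S f \<Longrightarrow> continuous_on S (\<lambda>x. cx (f x))"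
  unfolding cx_def Complex_eq by (intro continuous_intros)

lemma isCont_cx: "isCont cx z"
  unfolding cx_def[abs_def] Complex_eq by (intro continuous_intros)

text \<open>The values of \<open>H\<close> lie in the discrete set of multiples of 2 pi i. Applied
  to the difference of two continuous logarithms of one function, this shows that they differ by a
  constant.\<close>

lemma exp_eq_1_const:
  assumes "connected C" "continuous_on C H" "\<And>w. w \<in> C \<Longrightarrow> exp (H w) = (1 :: complex)" "a \<in> C" "b \<in> C"
  shows "H a = H b"
proof -
  have "H constant_on C"
  proof (rule continuous_discrete_range_constant[OF assms(1,2)])
    fix x assume x: "x \<in> C"
    have "2 * pi \<le> cmod (H y - H x)" if y: "y \<in> C" "H y \<noteq> H x" for y
    proof (rule ccontr)
      assume "\<not> 2 * pi \<le> cmod (H y - H x)"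
      hence "\<bar>Im (H y) - Im (H x)\<bar> < 2 * pi" using abs_Im_le_cmod[of "H y - H x"] by simp
      hence "H y = H x" by (rule exp_complex_eqI) (simp add: assms(3) x y(1))
      thus False using y(2) by simp
    qed
    thus "\<exists>e>0. \<forall>y. y \<in> C \<and> H y \<noteq> H x \<longrightarrow> e \<le> cmod (H y - H x)"
      by (intro exI[of _ "2 * pi"]) simp
  qed
  thus ?thesis using assms(4,5) unfolding constant_on_def by auto
qed

lemma log_exists:
  assumes "simply_connected S" "locally path_connected S" "v \<notin> S"
  shows "\<exists>g. continuous_on S g \<and> (\<forall>z\<in>S. cx z - cx v = exp (g z))"
proof -
  have "continuous_on S (\<lambda>z. cx z - cx v)" by (intro continuous_intros)
  moreover have "cx z - cx v \<noteq> 0" if "z \<in> S" for z using that assms(3) by auto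
  ultimately obtain g where "continuous_on S g" "\<And>z. z \<in> S \<Longrightarrow> cx z - cx v = exp (g z)"
    by (rule continuous_logarithm_on_simply_connected[OF _ assms(1,2)]) blast+
  thus ?thesis by blast
qed

text \<open>\<open>zeta e\<close> maps the edge onto the cut of the principal logarithm, so the angle at which the edge
  is seen is continuous off the edge and jumps across it.\<close>

definition zeta :: "point set \<Rightarrow> point \<Rightarrow> complex" where
  "zeta e z = (cx z - cx (hi e)) / (cx z - cx (lo e))"

definition winding :: "point set \<Rightarrow> point \<Rightarrow> real" where
  "winding e z = Im (Ln (zeta e z)) / (2 * pi)"

context partition
begin

lemma zeta_off_edge:
  assumes e: "e \<in> \<Delta>" and z: "z \<notin> seg e"
  shows "zeta e z \<notin> \<real>\<^sub>\<le>\<^sub>0" "cx z - cx (lo e) \<noteq> 0" "zeta e z \<noteq> 0"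
proof -
  have zl: "z \<noteq> lo e" using z seg_eq[OF e] by auto
  thus 0: "cx z - cx (lo e) \<noteq> 0" by simp
  show 1: "zeta e z \<notin> \<real>\<^sub>\<le>\<^sub>0"
  proof
    assume "zeta e z \<in> \<real>\<^sub>\<le>\<^sub>0"
    then obtain t where t: "zeta e z = of_real t" "t \<le> 0" by (auto elim: nonpos_Reals_cases)
    hence "cx z - cx (hi e) = of_real t * (cx z - cx (lo e))" unfolding zeta_def using 0 by (simp add: field_simps)
    hence c: "fst z - fst (hi e) = t * (fst z - fst (lo e))" "snd z - snd (hi e) = t * (snd z - snd (lo e))"
      by (simp_all add: complex_eq_iff)
    \<comment> \<open>Solving z - hi e = t (z - lo e) for z gives a combination of
      \<open>lo e\<close> and \<open>hi e\<close> with weight 1 / (1 - t) at \<open>hi e\<close>.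
      For t at most 0 it is convex, so z lies on the edge.\<close>
    define u where "u = 1 / (1 - t)"
    have u: "0 \<le> u" "u \<le> 1" "u * (1 - t) = 1" using t(2) unfolding u_def by auto
    have ut: "u * t = u - 1" using u(3) by (simp add: algebra_simps)
    have comp: "x = (1 - u) * l + u * h" if "x - h = t * (x - l)" for x l h
    proof -
      have "x * (1 - t) = h - t * l" using that by (simp add: algebra_simps)
      hence "u * (h - t * l) = x * (u * (1 - t))" by (simp only: mult.left_commute)
      hence "x = u * h - (u * t) * l" unfolding u(3) by (simp add: algebra_simps)
      thus ?thesis unfolding ut by (simp add: algebra_simps)
    qed
    have "z = (1 - u) *\<^sub>R lo e + u *\<^sub>R hi e"
      using comp[OF c(1)] comp[OF c(2)] by (simp add: prod_eq_iff)
    hence "z \<in> closed_segment (lo e) (hi e)" unfolding closed_segment_def using u by auto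
    thus False using z seg_eq[OF e] by simp
  qed
  show "zeta e z \<noteq> 0" using 1 by auto
qed

lemma isCont_zeta: "e \<in> \<Delta> \<Longrightarrow> z \<notin> seg e \<Longrightarrow> isCont (zeta e) z"
  unfolding zeta_def[abs_def] using zeta_off_edge(2)[of e z] by (intro continuous_intros isCont_cx) auto

lemma isCont_Ln_zeta: "e \<in> \<Delta> \<Longrightarrow> z \<notin> seg e \<Longrightarrow> isCont (\<lambda>z. Ln (zeta e z)) z"
  by (rule isCont_o2[OF isCont_zeta continuous_at_Ln[OF zeta_off_edge(1)]])

lemma isCont_winding: "e \<in> \<Delta> \<Longrightarrow> z \<notin> seg e \<Longrightarrow> isCont (winding e) z"
  unfolding winding_def[abs_def] by (intro isCont_divide isCont_Im isCont_Ln_zeta continuous_const) auto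

text \<open>On \<open>C\<close> both \<open>Ln (zeta e z)\<close> and \<open>gh z - gl z\<close> are
  continuous logarithms of \<open>zeta e\<close>, so they differ by a constant, which drops out of
  the increment.\<close>

lemma winding_diff:
  assumes C: "convex C" "C \<subseteq> Om" and e: "e \<in> \<Delta>"
    and gh: "continuous_on C gh" "\<And>z. z \<in> C \<Longrightarrow> cx z - cx (hi e) = exp (gh z)"
    and gl: "continuous_on C gl" "\<And>z. z \<in> C \<Longrightarrow> cx z - cx (lo e) = exp (gl z)"
    and w: "w \<in> C" "w' \<in> C"
  shows "2 * pi * (winding e w - winding e w') = (Im (gh w) - Im (gh w')) - (Im (gl w) - Im (gl w'))"
proof -
  define H where "H z = Ln (zeta e z) - (gh z - gl z)" for z
  have off: "z \<notin> seg e" if "z \<in> C" for z using that C(2) e unfolding Om_eq by blast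
  have "continuous_on C (\<lambda>z. Ln (zeta e z))"
    using isCont_Ln_zeta[OF e off] by (simp add: continuous_at_imp_continuous_on)
  hence "continuous_on C H" unfolding H_def by (intro continuous_on_diff gh(1) gl(1))
  moreover have "exp (H z) = 1" if z: "z \<in> C" for z
    unfolding H_def exp_diff using zeta_off_edge(3)[OF e off[OF z]] gh(2)[OF z, symmetric] gl(2)[OF z, symmetric]
    by (simp add: zeta_def)
  ultimately have "H w = H w'" by (rule exp_eq_1_const[OF convex_connected[OF C(1)] _ _ w])
  hence "Ln (zeta e w) - Ln (zeta e w') = (gh w - gh w') - (gl w - gl w')" unfolding H_def by (simp add: algebra_simps)
  hence "Im (Ln (zeta e w)) - Im (Ln (zeta e w')) = (Im (gh w) - Im (gh w')) - (Im (gl w) - Im (gl w'))"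
    by (metis minus_complex.sel(2))
  moreover have "2 * pi * (a / (2 * pi) - b / (2 * pi)) = a - b" for a b :: real by (simp add: field_simps)
  ultimately show ?thesis unfolding winding_def by simp
qed

text \<open>At distance t from the midpoint along the normal \<open>zeta e\<close> equals
  \<open>- \<eta> t\<close>, where \<eta> tends to 1. So \<open>zeta e\<close> tends to -1 from
  opposite sides of the cut, where the arguments are near pi and -pi.\<close>

lemma winding_jump:
  assumes e: "e \<in> \<Delta>"
  defines "z \<equiv> midpoint (lo e) (hi e)"
  shows "((\<lambda>t. winding e (z + t *\<^sub>R nrm e) - winding e (z + (- t) *\<^sub>R nrm e)) \<longlongrightarrow> 1) (at_right 0)"
proof -
  define u where "u = cx (hi e) - cx (lo e)"
  have u: "u \<noteq> 0" unfolding u_def using lo_ne_hi[OF e] by simp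
  \<comment> \<open>After removing the sign, the logarithm is continuous at the limit 1;
    \<open>Ln_minus\<close> accounts for the sign by adding or subtracting pi i.\<close>
  define \<eta> where "\<eta> t = (1/2 - \<i> * of_real t) / (1/2 + \<i> * of_real t)" for t :: real
  have den: "1/2 + \<i> * of_real t \<noteq> 0" for t :: real by (simp add: complex_eq_iff)
  have cz: "cx (z + t *\<^sub>R nrm e) - cx (lo e) = u * (1/2 + \<i> * of_real t)"
    "cx (z + t *\<^sub>R nrm e) - cx (hi e) = u * (- (1/2 - \<i> * of_real t))" for t
    unfolding z_def u_def midpoint_def nrm_def by (simp_all add: complex_eq_iff field_simps)
  have zt: "zeta e (z + t *\<^sub>R nrm e) = - \<eta> t" for t
    unfolding zeta_def cz \<eta>_def by (simp only: nonzero_mult_divide_mult_cancel_left[OF u] minus_divide_left)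
  have Im\<eta>: "Im (\<eta> t) = - t / ((1/2)\<^sup>2 + t\<^sup>2)" for t
    unfolding \<eta>_def by (simp add: Im_divide)
  have pos: "(1/2)\<^sup>2 + t\<^sup>2 > (0 :: real)" for t by (rule add_pos_nonneg) auto
  have \<eta>0: "\<eta> t \<noteq> 0" for t unfolding \<eta>_def using den[of t] den[of "- t"] by simp
  have "winding e (z + t *\<^sub>R nrm e) - winding e (z + (- t) *\<^sub>R nrm e) = 1 + (Im (Ln (\<eta> t)) - Im (Ln (\<eta> (- t)))) / (2 * pi)"
    if t: "t > 0" for t
  proof -
    have "Im (\<eta> t) < 0" unfolding Im\<eta> using t pos[of t] by (simp add: divide_neg_pos)
    hence "Ln (- \<eta> t) = Ln (\<eta> t) + \<i> * pi" using Ln_minus[OF \<eta>0[of t]] by simp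
    hence a: "Im (Ln (- \<eta> t)) = Im (Ln (\<eta> t)) + pi" by simp
    have "Im (\<eta> (- t)) > 0" unfolding Im\<eta> using t pos[of t] by simp
    hence "Ln (- \<eta> (- t)) = Ln (\<eta> (- t)) - \<i> * pi" using Ln_minus[OF \<eta>0[of "- t"]] by simp
    hence b: "Im (Ln (- \<eta> (- t))) = Im (Ln (\<eta> (- t))) - pi" by simp
    show ?thesis unfolding winding_def zt a b by (simp add: field_simps)
  qed
  hence ev: "\<forall>\<^sub>F t in at_right 0. 1 + (Im (Ln (\<eta> t)) - Im (Ln (\<eta> (- t)))) / (2 * pi) = winding e (z + t *\<^sub>R nrm e) - winding e (z + (- t) *\<^sub>R nrm e)"
    unfolding eventually_at_filter by (intro always_eventually) auto
  have lim\<eta>: "((\<lambda>t. \<eta> (s * t)) \<longlongrightarrow> 1) (at_right 0)" for s :: real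
    unfolding \<eta>_def by (auto intro!: tendsto_eq_intros)
  have "((\<lambda>t. Ln (\<eta> (s * t))) \<longlongrightarrow> Ln 1) (at_right 0)" for s :: real
    by (rule tendsto_Ln[OF lim\<eta>]) auto
  from tendsto_Im[OF this[of 1]] tendsto_Im[OF this[of "- 1"]]
  have l: "((\<lambda>t. Im (Ln (\<eta> t))) \<longlongrightarrow> Im (Ln 1)) (at_right 0)" "((\<lambda>t. Im (Ln (\<eta> (- t)))) \<longlongrightarrow> Im (Ln 1)) (at_right 0)"
    by simp_all
  have "((\<lambda>t. 1 + (Im (Ln (\<eta> t)) - Im (Ln (\<eta> (- t)))) / (2 * pi)) \<longlongrightarrow> 1 + (Im (Ln 1) - Im (Ln 1)) / (2 * pi)) (at_right 0)"
    by (intro tendsto_add tendsto_const tendsto_divide tendsto_diff l) simp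
  hence "((\<lambda>t. 1 + (Im (Ln (\<eta> t)) - Im (Ln (\<eta> (- t)))) / (2 * pi)) \<longlongrightarrow> 1) (at_right 0)" by simp
  thus ?thesis by (rule Lim_transform_eventually[OF _ ev])
qed

end

section \<open>Cofactors as jumps of a piecewise polynomial\<close>

locale simply_connected_conformality = conformality +
  assumes sc: "simply_connected \<Psi>"
begin

text \<open>The ends of interior edges on the frontier. Since they lie outside \<Psi>, z - v has a
  logarithm on all of \<Psi>.\<close>

definition BV :: "point set" where "BV = \<Union>IE - \<Psi>"

definition Lg :: "point \<Rightarrow> point \<Rightarrow> complex" where
  "Lg v = (SOME g. continuous_on \<Psi> g \<and> (\<forall>z\<in>\<Psi>. cx z - cx v = exp (g z)))"

lemma Lg:
  assumes "v \<in> BV"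
  shows "continuous_on \<Psi> (Lg v)" "\<And>z. z \<in> \<Psi> \<Longrightarrow> cx z - cx v = exp (Lg v z)"
proof -
  have "v \<notin> \<Psi>" using assms unfolding BV_def by blast
  from someI_ex[OF log_exists[OF sc open_imp_locally_path_connected[OF open_domain] this]]
  show "continuous_on \<Psi> (Lg v)" "\<And>z. z \<in> \<Psi> \<Longrightarrow> cx z - cx v = exp (Lg v z)" unfolding Lg_def by auto
qed

lemma finite_V0: "finite (\<Union>IE)"
  by (rule finite_Union[OF finite_IE]) (use IE_subset card_edge card_ge_0_finite in force)

lemma finite_BV: "finite BV"
  unfolding BV_def using finite_V0 by simp

text \<open>The jump prescribed across \<open>e\<close>, left minus right; see
  \<open>jump_Pq\<close>.\<close>

definition Jq :: "poly_family \<Rightarrow> point set \<Rightarrow> real poly poly" where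
  "Jq q e = q e * L (le e) ^ (\<mu> + 1)"

text \<open>The coefficient, up to the factor 2 pi, of the argument of z - v after each
  \<open>winding e\<close> is written as the difference of the arguments at \<open>hi e\<close> and
  \<open>lo e\<close>.\<close>

definition cq :: "poly_family \<Rightarrow> point \<Rightarrow> real poly poly" where
  "cq q v = (\<Sum>e\<in>{e \<in> IE. hi e = v}. Jq q e) - (\<Sum>e\<in>{e \<in> IE. lo e = v}. Jq q e)"

text \<open>Index sets of the terms of the spline: \<open>{}\<close> for the global polynomial, the edges, and the
  singletons of the boundary vertices for the correcting logarithms.\<close>

definition idx :: "point set set" where
  "idx = insert {} (IE \<union> (\<lambda>v. {v}) ` BV)"

definition theta :: "point set \<Rightarrow> point \<Rightarrow> real" where
  "theta i = (if i = {} then (\<lambda>_. 1) else if i \<in> IE then winding i else (\<lambda>z. - Im (Lg (the_elem i) z) / (2 * pi)))"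

definition JJ :: "poly_family \<Rightarrow> point set \<Rightarrow> real poly poly" where
  "JJ q i = (if i = {} then q {} else if i \<in> IE then Jq q i else cq q (the_elem i))"

lemma singleton_notin_IE: "{v} \<notin> IE"
  using IE_subset card_edge[of "{v}"] by auto

lemma finite_idx: "finite idx"
  unfolding idx_def using finite_IE finite_BV by simp

lemma sum_idx:
  fixes F :: "point set \<Rightarrow> 'b::comm_monoid_add"
  shows "(\<Sum>i\<in>idx. F i) = F {} + ((\<Sum>e\<in>IE. F e) + (\<Sum>v\<in>BV. F {v}))"
proof -
  have "(\<Sum>i\<in>idx. F i) = F {} + (\<Sum>i\<in>IE \<union> (\<lambda>v. {v}) ` BV. F i)"
    unfolding idx_def using finite_IE finite_BV empty_notin_IE by (intro sum.insert) auto
  also have "(\<Sum>i\<in>IE \<union> (\<lambda>v. {v}) ` BV. F i) = (\<Sum>i\<in>IE. F i) + (\<Sum>i\<in>(\<lambda>v. {v}) ` BV. F i)"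
    using finite_IE finite_BV singleton_notin_IE by (intro sum.union_disjoint) auto
  also have "(\<Sum>i\<in>(\<lambda>v. {v}) ` BV. F i) = (\<Sum>v\<in>BV. F {v})"
    by (subst sum.reindex) (auto simp: inj_on_def)
  finally show ?thesis .
qed

definition Pq :: "poly_family \<Rightarrow> point \<Rightarrow> real poly poly" where
  "Pq q = psum idx theta (JJ q)"

lemma poly2_Pq: "poly2 (Pq q w) x = poly2 (q {}) x
    + ((\<Sum>e\<in>IE. winding e w * poly2 (Jq q e) x) + (\<Sum>v\<in>BV. - Im (Lg v w) / (2 * pi) * poly2 (cq q v) x))"
proof -
  have "poly2 (Pq q w) x = (\<Sum>i\<in>idx. theta i w * poly2 (JJ q i) x)" unfolding Pq_def poly2_psum ..
  also have "\<dots> = theta {} w * poly2 (JJ q {}) x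
    + ((\<Sum>e\<in>IE. theta e w * poly2 (JJ q e) x) + (\<Sum>v\<in>BV. theta {v} w * poly2 (JJ q {v}) x))"
    by (rule sum_idx)
  also have "(\<Sum>e\<in>IE. theta e w * poly2 (JJ q e) x) = (\<Sum>e\<in>IE. winding e w * poly2 (Jq q e) x)"
    using empty_notin_IE by (intro sum.cong) (auto simp: theta_def JJ_def)
  finally show ?thesis using singleton_notin_IE by (simp add: theta_def JJ_def)
qed

text \<open>The edges ending or starting at \<open>A\<close> are grouped by their l-edges, along
  each of which \<open>L\<close> is the same. Thus the syzygy in the definition of W[A] is the
  vanishing of the vertex sum.\<close>

lemma vertex_sum:
  assumes "A \<in> IV"
  shows "(\<Sum>l | l \<in> LE \<and> A \<in> l. jumps q A l * L l ^ (\<mu> + 1)) = - cq q A"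
proof -
  define T where "T = {l. l \<in> LE \<and> A \<in> l}"
  have fin: "finite T" unfolding T_def using finite_LE by simp
  have ends: "lo e \<in> le e" "hi e \<in> le e" if "e \<in> IE" for e
    using edges_of_ends(1,2)[OF le_in[OF that] le_edge[OF that]] .
  have set_eq: "{e \<in> {e \<in> IE. en e = A}. le e = l} = {e \<in> edges_of l. en e = A}" if "l \<in> LE" for l and en :: "point set \<Rightarrow> point"
    using le_eq[OF that] le_edge edges_of_IE by auto
  have grp: "(\<Sum>l\<in>T. (\<Sum>e\<in>{e \<in> edges_of l. en e = A}. q e) * L l ^ (\<mu> + 1)) = (\<Sum>e\<in>{e \<in> IE. en e = A}. Jq q e)"
    if "\<And>e. e \<in> IE \<Longrightarrow> en e \<in> le e" for en
  proof -
    have "(\<Sum>l\<in>T. \<Sum>e\<in>{e \<in> {e \<in> IE. en e = A}. le e = l}. Jq q e) = (\<Sum>e\<in>{e \<in> IE. en e = A}. Jq q e)"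
      by (rule sum.group) (use finite_IE fin le_in that in \<open>auto simp: T_def\<close>)
    moreover have "(\<Sum>e\<in>{e \<in> {e \<in> IE. en e = A}. le e = l}. Jq q e) = (\<Sum>e\<in>{e \<in> edges_of l. en e = A}. q e) * L l ^ (\<mu> + 1)"
      if "l \<in> T" for l
    proof -
      have l: "l \<in> LE" using that unfolding T_def by blast
      show ?thesis unfolding set_eq[OF l] sum_distrib_right
        by (rule sum.cong) (auto simp: Jq_def le_eq[OF l])
    qed
    ultimately show ?thesis by simp
  qed
  have "(\<Sum>l\<in>T. jumps q A l * L l ^ (\<mu> + 1)) = (\<Sum>l\<in>T. jump q A l * L l ^ (\<mu> + 1))"
    by (rule sum.cong) (auto simp: jumps_def T_def assms)
  also have "\<dots> = (\<Sum>e\<in>{e \<in> IE. lo e = A}. Jq q e) - (\<Sum>e\<in>{e \<in> IE. hi e = A}. Jq q e)"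
    unfolding jump_def left_diff_distrib sum_subtractf using grp[of lo] grp[of hi] ends by simp
  finally show ?thesis unfolding T_def cq_def by simp
qed

lemma cq_interior: "q \<in> cofactors \<Longrightarrow> A \<in> IV \<Longrightarrow> cq q A = 0"
  using vertex_sum[of A q] unfolding cofactors_def conformality_space_def by simp

text \<open>By conformality the multivalued parts of the logarithms cancel at the interior vertices, and
  at the boundary vertices they are compensated by the global logarithms.\<close>

lemma piecewise_Pq:
  assumes q: "q \<in> cofactors"
  shows "piecewise (Pq q)"
  unfolding piecewise_def
proof (intro allI impI ballI)
  fix C w w' assume C: "convex C \<and> C \<subseteq> Om" and w: "w \<in> C" "w' \<in> C"
  have "\<exists>g. v \<in> \<Union>IE \<longrightarrow> continuous_on C g \<and> (\<forall>z\<in>C. cx z - cx v = exp (g z))" for v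
  proof (cases "v \<in> \<Union>IE")
    case True
    then obtain e where e: "e \<in> IE" "v \<in> e" by blast
    have "v \<in> seg e" using hull_inc[OF e(2)] .
    hence "v \<notin> C" using C e(1) IE_subset unfolding Om_eq by blast
    thus ?thesis using log_exists[OF convex_imp_simply_connected convex_imp_locally_path_connected] C by blast
  qed simp
  then obtain g where g: "\<And>v. v \<in> \<Union>IE \<Longrightarrow> continuous_on C (g v)" "\<And>v z. v \<in> \<Union>IE \<Longrightarrow> z \<in> C \<Longrightarrow> cx z - cx v = exp (g v z)"
    by metis
  define \<gamma> where "\<gamma> v = Im (g v w) - Im (g v w')" for v
  have inV: "lo e \<in> \<Union>IE" "hi e \<in> \<Union>IE" "e \<in> \<Delta>" if "e \<in> IE" for e
    using that IE_subset lo_in hi_in by blast+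
  have winding: "2 * pi * (winding e w - winding e w') = \<gamma> (hi e) - \<gamma> (lo e)" if "e \<in> IE" for e
    unfolding \<gamma>_def using C by (intro winding_diff[OF _ _ inV(3)[OF that] g(1)[OF inV(2)[OF that]] g(2)[OF inV(2)[OF that]]
      g(1)[OF inV(1)[OF that]] g(2)[OF inV(1)[OF that]] w]) auto
  have Lam: "Im (Lg v w) - Im (Lg v w') = \<gamma> v" if v: "v \<in> BV" for v
  proof -
    have vV: "v \<in> \<Union>IE" using v unfolding BV_def by blast
    have C\<Psi>: "C \<subseteq> \<Psi>" using C unfolding Om_eq by blast
    have "Lg v w - g v w = Lg v w' - g v w'"
    proof (rule exp_eq_1_const[OF convex_connected[of C] _ _ w])
      show "continuous_on C (\<lambda>z. Lg v z - g v z)"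
        by (intro continuous_intros g(1)[OF vV] continuous_on_subset[OF Lg(1)[OF v] C\<Psi>])
      show "exp (Lg v z - g v z) = 1" if "z \<in> C" for z
        unfolding exp_diff using Lg(2)[OF v, of z] g(2)[OF vV that] C\<Psi> that by auto
    qed (use C in blast)
    hence "Lg v w - Lg v w' = g v w - g v w'" by (simp add: algebra_simps)
    thus ?thesis unfolding \<gamma>_def by (metis minus_complex.sel(2))
  qed
  show "Pq q w = Pq q w'"
  proof (rule poly2_eqI)
    fix x
    \<comment> \<open>Regrouping by end points turns the sum over edges into a sum over vertices, as
      in summation by parts; the coefficients then combine to \<open>cq\<close>.\<close>
    have grp: "(\<Sum>e\<in>IE. \<gamma> (en e) * poly2 (Jq q e) x) = (\<Sum>v\<in>\<Union>IE. \<gamma> v * poly2 (\<Sum>e\<in>{e \<in> IE. en e = v}. Jq q e) x)"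
      if "\<And>e. e \<in> IE \<Longrightarrow> en e \<in> \<Union>IE" for en
    proof -
      have "(\<Sum>v\<in>\<Union>IE. \<Sum>e\<in>{e \<in> IE. en e = v}. \<gamma> (en e) * poly2 (Jq q e) x) = (\<Sum>e\<in>IE. \<gamma> (en e) * poly2 (Jq q e) x)"
        by (rule sum.group[OF finite_IE finite_V0]) (use that in auto)
      moreover have "(\<Sum>e\<in>{e \<in> IE. en e = v}. \<gamma> (en e) * poly2 (Jq q e) x) = \<gamma> v * poly2 (\<Sum>e\<in>{e \<in> IE. en e = v}. Jq q e) x" for v
        unfolding poly2_sum sum_distrib_left by (rule sum.cong) auto
      ultimately show ?thesis by simp
    qed
    have "2 * pi * (\<Sum>e\<in>IE. (winding e w - winding e w') * poly2 (Jq q e) x)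
        = (\<Sum>e\<in>IE. \<gamma> (hi e) * poly2 (Jq q e) x) - (\<Sum>e\<in>IE. \<gamma> (lo e) * poly2 (Jq q e) x)"
      unfolding sum_distrib_left sum_subtractf[symmetric]
      by (rule sum.cong) (simp_all add: winding mult.assoc[symmetric] left_diff_distrib[symmetric])
    also have "\<dots> = (\<Sum>v\<in>\<Union>IE. \<gamma> v * poly2 (cq q v) x)"
      using grp[of hi] grp[of lo] inV(1,2) unfolding cq_def by (simp add: right_diff_distrib sum_subtractf)
    also have "\<dots> = (\<Sum>v\<in>BV. \<gamma> v * poly2 (cq q v) x)"
    proof (rule sum.mono_neutral_right[OF finite_V0])
      show "\<forall>v\<in>\<Union>IE - BV. \<gamma> v * poly2 (cq q v) x = 0"
      proof
        fix v assume "v \<in> \<Union>IE - BV"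
        hence "v \<in> IV" unfolding BV_def IV_def using IE_subset by blast
        thus "\<gamma> v * poly2 (cq q v) x = 0" using cq_interior[OF q] by simp
      qed
    qed (auto simp: BV_def)
    also have "\<dots> = 2 * pi * (\<Sum>v\<in>BV. (Im (Lg v w) - Im (Lg v w')) / (2 * pi) * poly2 (cq q v) x)"
      unfolding sum_distrib_left by (rule sum.cong) (simp_all add: Lam)
    finally have "(\<Sum>e\<in>IE. (winding e w - winding e w') * poly2 (Jq q e) x) = (\<Sum>v\<in>BV. (Im (Lg v w) - Im (Lg v w')) / (2 * pi) * poly2 (cq q v) x)"
      by simp
    hence "(\<Sum>e\<in>IE. winding e w * poly2 (Jq q e) x) - (\<Sum>e\<in>IE. winding e w' * poly2 (Jq q e) x)
      = (\<Sum>v\<in>BV. Im (Lg v w) / (2 * pi) * poly2 (cq q v) x) - (\<Sum>v\<in>BV. Im (Lg v w') / (2 * pi) * poly2 (cq q v) x)"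
      by (simp add: left_diff_distrib diff_divide_distrib sum_subtractf)
    thus "poly2 (Pq q w) x = poly2 (Pq q w') x" unfolding poly2_Pq by (simp add: sum_negf)
  qed
qed

text \<open>At the midpoint of \<open>e\<close> every term except \<open>winding e\<close> is
  continuous: other edges miss this point, and the logarithms are continuous on \<Psi>. The
  difference of the two sides therefore tends to the jump 1 of \<open>winding e\<close> times its
  polynomial.\<close>

lemma jump_Pq:
  assumes e: "e \<in> IE" and s: "sides (Pq q) e pl pr"
  shows "pl - pr = Jq q e"
proof (rule poly2_eqI)
  fix x
  have eD: "e \<in> \<Delta>" using e IE_subset by blast
  define z where "z = midpoint (lo e) (hi e)"
  have z: "z \<in> open_segment (lo e) (hi e)" unfolding z_def using lo_ne_hi[OF eD] by simp
  have z\<Psi>: "z \<in> \<Psi>" using open_seg_domain[OF e] z by blast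
  have ze: "z \<in> seg e" "z \<notin> e" using z seg_eq[OF eD] edge_eq[OF eD] unfolding open_segment_def by auto
  obtain r where r: "r > 0" "\<forall>w\<in>ball z r. (0 < side e w \<longrightarrow> w \<in> Om \<and> Pq q w = pl) \<and> (side e w < 0 \<longrightarrow> w \<in> Om \<and> Pq q w = pr)"
    using s z unfolding sides_def by blast
  have n: "nrm e \<bullet> nrm e > 0" using nrm_nonzero[OF eD] by simp
  have lim: "((\<lambda>t. z + (c * t) *\<^sub>R nrm e) \<longlongrightarrow> z) (at_right 0)" for c :: real by (auto intro!: tendsto_eq_intros)
  have inb: "\<forall>\<^sub>F t in at_right 0. z + (c * t) *\<^sub>R nrm e \<in> ball z r" for c
    using lim[of c] r(1) by (metis centre_in_ball open_ball topological_tendstoD)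
  have sz: "side e z = 0" by (rule side_seg[OF eD ze(1)])
  have ev: "\<forall>\<^sub>F t in at_right 0. poly2 (pl - pr) x = (\<Sum>i\<in>idx. (theta i (z + t *\<^sub>R nrm e) - theta i (z + (- t) *\<^sub>R nrm e)) * poly2 (JJ q i) x)"
    using inb[of 1] inb[of "- 1"] eventually_at_right_less[of 0]
  proof eventually_elim
    case (elim t)
    have "0 < side e (z + t *\<^sub>R nrm e)" "side e (z + (- t) *\<^sub>R nrm e) < 0"
      unfolding side_add sz using elim(3) n by auto
    hence "Pq q (z + t *\<^sub>R nrm e) = pl" "Pq q (z + (- t) *\<^sub>R nrm e) = pr" using r(2) elim(1,2) by auto
    hence "poly2 (pl - pr) x = poly2 (Pq q (z + t *\<^sub>R nrm e)) x - poly2 (Pq q (z + (- t) *\<^sub>R nrm e)) x" by simp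
    thus ?case unfolding Pq_def poly2_psum by (simp add: left_diff_distrib sum_subtractf)
  qed
  have cont: "isCont (theta i) z" if i: "i \<in> idx - {e}" for i
  proof -
    consider "i = {}" | "i \<in> IE" "i \<noteq> {}" | v where "i = {v}" "v \<in> BV" using i empty_notin_IE unfolding idx_def by blast
    thus ?thesis
    proof cases
      case 2
      hence "i \<in> \<Delta>" using IE_subset by blast
      moreover have "z \<notin> seg i" using seg_Int[OF eD \<open>i \<in> \<Delta>\<close>] i ze by blast
      ultimately show ?thesis using isCont_winding 2 by (simp add: theta_def)
    next
      case (3 v)
      have "isCont (Lg v) z" using Lg(1)[OF 3(2)] z\<Psi> continuous_on_eq_continuous_at[OF open_domain] by blast
      hence "isCont (\<lambda>z. - Im (Lg v z) / (2 * pi)) z" by (intro continuous_intros) auto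
      thus ?thesis using 3(1) singleton_notin_IE by (simp add: theta_def)
    qed (simp add: theta_def)
  qed
  have "((\<lambda>t. \<Sum>i\<in>idx. (theta i (z + t *\<^sub>R nrm e) - theta i (z + (- t) *\<^sub>R nrm e)) * poly2 (JJ q i) x)
     \<longlongrightarrow> (\<Sum>i\<in>idx. (if i = e then 1 else 0) * poly2 (JJ q i) x)) (at_right 0)"
  proof (intro tendsto_sum tendsto_mult tendsto_const)
    fix i assume i: "i \<in> idx"
    show "((\<lambda>t. theta i (z + t *\<^sub>R nrm e) - theta i (z + (- t) *\<^sub>R nrm e)) \<longlongrightarrow> (if i = e then 1 else 0)) (at_right 0)"
    proof (cases "i = e")
      case True
      have "theta e = winding e" using e empty_notin_IE by (auto simp: theta_def)
      thus ?thesis using winding_jump[OF eD] True unfolding z_def by simp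
    next
      case False
      have "((\<lambda>t. theta i (z + (c * t) *\<^sub>R nrm e)) \<longlongrightarrow> theta i z) (at_right 0)" for c :: real
        by (rule isCont_tendsto_compose[OF cont lim]) (use i False in blast)
      from tendsto_diff[OF this[of 1] this[of "- 1"]] show ?thesis using False by simp
    qed
  qed
  moreover have "(\<Sum>i\<in>idx. (if i = e then 1 else 0) * poly2 (JJ q i) x) = poly2 (JJ q e) x"
    using finite_idx e by (simp add: if_distrib[of "\<lambda>a. a * _"] sum.delta idx_def cong: if_cong)
  moreover have "JJ q e = Jq q e" using e empty_notin_IE by (auto simp: JJ_def)
  ultimately have "((\<lambda>t. poly2 (pl - pr) x) \<longlongrightarrow> poly2 (Jq q e) x) (at_right (0 :: real))"
    using Lim_transform_eventually[OF _ eventually_mono[OF ev sym]] by simp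
  thus "poly2 (pl - pr) x = poly2 (Jq q e) x"
    using tendsto_unique[OF trivial_limit_at_right_real tendsto_const] by blast
qed

end

subsection \<open>The spline of a family of cofactors\<close>

lemma C_on_continuous:
  assumes "C_on k S f"
  shows "continuous_on S f"
proof (cases k)
  case (Suc k')
  then obtain f' where "\<And>z. z \<in> S \<Longrightarrow> (f has_derivative f' z) (at z)" using assms by auto
  thus ?thesis by (auto intro!: continuous_at_imp_continuous_on has_derivative_continuous)
qed (use assms in simp)

lemma in_some_polys: "\<exists>N. Q \<in> polys N"
proof
  define N where "N = degree Q + (\<Sum>j\<le>degree Q. degree (coeff Q j))"
  show "Q \<in> polys N" unfolding polys_def
  proof (intro CollectI allI impI)
    fix i j assume nz: "coeff (coeff Q j) i \<noteq> 0"
    hence j: "j \<le> degree Q" by (intro le_degree) auto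
    have "i \<le> degree (coeff Q j)" using nz by (rule le_degree)
    also have "\<dots> \<le> (\<Sum>j\<le>degree Q. degree (coeff Q j))"
      using j by (intro member_le_sum) auto
    finally show "i + j \<le> N" using j unfolding N_def by simp
  qed
qed

text \<open>The coefficients of \<open>L * Q\<close> one degree above the top part of
  \<open>Q\<close> involve only this top part and (b, c). As long as that degree exceeds k + 1 they
  are zero, and solving them one after another, by induction on the power of y if b is nonzero,
  kills the top part.\<close>

lemma polys_linear_cancel:
  assumes L: "L = [:[:a, b:], [:c:]:]" "b \<noteq> 0 \<or> c \<noteq> 0" and LQ: "L * Q \<in> polys (k + 1)"
  shows "Q \<in> polys k"
proof -
  have cf: "coeff (coeff (L * Q) j) i = a * coeff (coeff Q j) i + (if i = 0 then 0 else b * coeff (coeff Q j) (i - 1))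
      + (if j = 0 then 0 else c * coeff (coeff Q (j - 1)) i)" for i j
    unfolding L(1) by (simp add: coeff_pCons split: nat.splits)
  have step: "Q \<in> polys m" if Q: "Q \<in> polys (Suc m)" and m: "k \<le> m" for m
  proof -
    have top: "coeff (coeff (L * Q) j) i = 0" if "i + j > k + 1" for i j
      using LQ that unfolding polys_def by (metis (mono_tags, lifting) mem_Collect_eq not_le)
    have hi: "coeff (coeff Q j) i = 0" if "i + j > Suc m" for i j
      using Q that unfolding polys_def by (metis (mono_tags, lifting) mem_Collect_eq not_le)
    have z: "coeff (coeff Q j) i = 0" if "i + j = Suc m" for i j
    proof (cases "b = 0")
      case True
      hence "c * coeff (coeff Q j) i = 0"
        using cf[of "Suc j" i] top[of i "Suc j"] hi[of i "Suc j"] that m True by (simp split: if_splits)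
      thus ?thesis using L(2) True by simp
    next
      case False
      show ?thesis using that
      proof (induction j arbitrary: i)
        case 0
        hence "b * coeff (coeff Q 0) i = 0" using cf[of 0 "Suc i"] top[of "Suc i" 0] hi[of "Suc i" 0] m by simp
        thus ?case using False by simp
      next
        case (Suc j)
        have "coeff (coeff Q j) (Suc i) = 0" using Suc by simp
        hence "b * coeff (coeff Q (Suc j)) i = 0"
          using cf[of "Suc j" "Suc i"] top[of "Suc i" "Suc j"] hi[of "Suc i" "Suc j"] Suc.prems m by simp
        thus ?case using False by simp
      qed
    qed
    show ?thesis unfolding polys_def
    proof (intro CollectI allI impI)
      fix i j assume "coeff (coeff Q j) i \<noteq> 0"
      hence "\<not> i + j > Suc m" "i + j \<noteq> Suc m" using hi z by blast+
      thus "i + j \<le> m" by simp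
    qed
  qed
  \<comment> \<open>Some degree bound holds for any polynomial; it is lowered one by one down to
    k.\<close>
  obtain N where "Q \<in> polys N" using in_some_polys by blast
  hence "Q \<in> polys (k + N)" by (rule polys_mono) simp
  moreover have "Q \<in> polys (k + n) \<Longrightarrow> Q \<in> polys k" for n
    by (induction n) (use step in auto)
  ultimately show ?thesis by blast
qed

lemma polys_linear_power_cancel:
  assumes L: "L = [:[:a, b:], [:c:]:]" "b \<noteq> 0 \<or> c \<noteq> 0"
  shows "L ^ n * Q \<in> polys (k + n) \<Longrightarrow> Q \<in> polys k"
proof (induction n)
  case (Suc n)
  hence "L * (L ^ n * Q) \<in> polys ((k + n) + 1)" by (simp add: mult.assoc)
  thus ?case using Suc.IH polys_linear_cancel[OF L] by blast
qed simp

context partition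
begin

lemma sides_diff:
  assumes "sides P e pl pr" "sides Q e ql qr"
  shows "sides (\<lambda>w. P w - Q w) e (pl - ql) (pr - qr)"
  unfolding sides_def
proof
  fix z assume z: "z \<in> open_segment (lo e) (hi e)"
  obtain r where r: "r > 0" "ball z r \<subseteq> \<Psi>" "\<forall>w\<in>ball z r. (0 < side e w \<longrightarrow> w \<in> Om \<and> P w = pl) \<and> (side e w < 0 \<longrightarrow> w \<in> Om \<and> P w = pr)"
    using assms(1) z unfolding sides_def by blast
  obtain s where s: "s > 0" "\<forall>w\<in>ball z s. (0 < side e w \<longrightarrow> w \<in> Om \<and> Q w = ql) \<and> (side e w < 0 \<longrightarrow> w \<in> Om \<and> Q w = qr)"
    using assms(2) z unfolding sides_def by blast
  have sub: "ball z (min r s) \<subseteq> ball z r" "ball z (min r s) \<subseteq> ball z s" by auto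
  show "\<exists>r>0. ball z r \<subseteq> \<Psi> \<and> (\<forall>w\<in>ball z r. (0 < side e w \<longrightarrow> w \<in> Om \<and> P w - Q w = pl - ql) \<and>
      (side e w < 0 \<longrightarrow> w \<in> Om \<and> P w - Q w = pr - qr))"
  proof (intro exI[of _ "min r s"] conjI ballI)
    show "min r s > 0" using r(1) s(1) by simp
    show "ball z (min r s) \<subseteq> \<Psi>" using sub(1) r(2) by blast
    fix w assume w: "w \<in> ball z (min r s)"
    have "w \<in> ball z r" "w \<in> ball z s" using w by auto
    thus "0 < side e w \<longrightarrow> w \<in> Om \<and> P w - Q w = pl - ql" "side e w < 0 \<longrightarrow> w \<in> Om \<and> P w - Q w = pr - qr"
      using r(3) s(2) by auto
  qed
qed

lemma Om_nonempty: "Om \<noteq> {}"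
  using Om_dense domain_ne by auto

lemma cells_eq: "cells \<Psi> \<Delta> = components Om"
  unfolding cells_def Om_def ..

lemma eq_on_domain:
  assumes "continuous_on \<Psi> f" "continuous_on \<Psi> g" "\<And>w. w \<in> Om \<Longrightarrow> f w = g w" "z \<in> \<Psi>"
  shows "f z = (g z :: real)"
proof -
  obtain x where x: "\<And>n. x n \<in> Om" "x \<longlonglongrightarrow> z"
    using subsetD[OF Om_dense assms(4)] unfolding closure_sequential by blast
  have c: "isCont f z" "isCont g z" using assms(1,2,4) continuous_on_eq_continuous_at[OF open_domain] by blast+
  have "(\<lambda>n. f (x n)) \<longlonglongrightarrow> f z" by (rule isCont_tendsto_compose[OF c(1) x(2)])
  moreover have "(\<lambda>n. f (x n)) \<longlonglongrightarrow> g z"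
    using isCont_tendsto_compose[OF c(2) x(2)] assms(3)[OF x(1)] by simp
  ultimately show ?thesis by (rule LIMSEQ_unique)
qed

end

context simply_connected_conformality
begin

definition spline_of :: "poly_family \<Rightarrow> point \<Rightarrow> real" where
  "spline_of q z = (if z \<in> \<Psi> then \<Sum>i\<in>idx. theta i z * poly2 (JJ q i) z else 0)"

lemma spline_of_Pq: "z \<in> \<Psi> \<Longrightarrow> spline_of q z = poly2 (Pq q z) z"
  unfolding spline_of_def Pq_def poly2_psum by simp

lemma linear_spline_of: "Vector_Spaces.linear fsc (\<lambda>c f z. c * f z) spline_of"
proof (rule linear_intro[OF vs_fsc funs.vector_space_axioms])
  have add: "JJ (x + y) i = JJ x i + JJ y i" for x y i
    by (simp add: JJ_def cq_def Jq_def sum.distrib distrib_right)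
  have scale: "JJ (fsc c x) i = psc c (JJ x i)" for c x i
    by (simp add: JJ_def cq_def Jq_def smult_sum_right smult_diff_right)
  show "spline_of (x + y) = spline_of x + spline_of y" for x y
    unfolding fun_eq_iff spline_of_def by (simp add: add distrib_left sum.distrib)
  show "spline_of (fsc c x) = (\<lambda>z. c * spline_of x z)" for c x
    unfolding fun_eq_iff spline_of_def scale by (simp add: sum_distrib_left mult.left_commute)
qed

lemma L_form:
  assumes "l \<in> LE"
  obtains a b c where "L l = [:[:a, b:], [:c:]:]" "b \<noteq> 0 \<or> c \<noteq> 0"
proof -
  obtain a b c where L: "L l = [:[:a, b:], [:c:]:]" by (rule polys_1D[OF L_poly[OF assms]])
  have "b \<noteq> 0 \<or> c \<noteq> 0"
  proof (rule ccontr)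
    assume "\<not> (b \<noteq> 0 \<or> c \<noteq> 0)"
    hence bc: "b = 0" "c = 0" by auto
    have "lo l \<in> affine hull l" using l_edge_ends(2)[OF assms] by (rule hull_inc)
    hence "poly2 (L l) (lo l) = 0" using L_zero[OF assms] by blast
    hence "a = 0" unfolding L bc by simp
    thus False using L_nonzero[OF assms] unfolding L bc by simp
  qed
  thus ?thesis using that L by blast
qed

lemma L_zero_edge:
  assumes "e \<in> IE" "z \<in> seg e"
  shows "poly2 (L (le e)) z = 0"
proof -
  have "z \<in> le e" using edges_of_subset[OF le_edge[OF assms(1)]] assms(2) by blast
  hence "z \<in> affine hull (le e)" by (rule hull_inc)
  thus ?thesis using L_zero[OF le_in[OF assms(1)]] by blast
qed

lemma JJ_polys:
  assumes q: "q \<in> cofactors"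
  shows "JJ q i \<in> polys d"
proof -
  have "Jq q e \<in> polys d" if "e \<in> IE" for e
  proof -
    have "Jq q e \<in> polys (K + (\<mu> + 1) * 1)" unfolding Jq_def
      using q that L_poly[OF le_in[OF that]] unfolding cofactors_def by (intro polys_mult polys_power) auto
    moreover have "K + (\<mu> + 1) * 1 = d" using md by (simp add: K_def)
    ultimately show ?thesis by simp
  qed
  moreover have "q {} \<in> polys d" using q unfolding cofactors_def by blast
  ultimately show ?thesis unfolding JJ_def cq_def by (auto intro!: polys_diff polys_sum)
qed

lemma Pq_polys: "q \<in> cofactors \<Longrightarrow> Pq q w \<in> polys d"
  unfolding Pq_def psum_def by (intro polys_sum polys_smult JJ_polys)

lemma spline_of_spline:
  assumes q: "q \<in> cofactors"
  shows "spline_of q \<in> spline_space d \<mu> \<Psi> \<Delta>"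
  unfolding spline_space_def
proof (intro CollectI conjI allI impI ballI)
  show "spline_of q z = 0" if "z \<notin> \<Psi>" for z using that by (simp add: spline_of_def)
  have "C_on \<mu> \<Psi> (\<lambda>z. \<Sum>i\<in>idx. theta i z * poly2 (JJ q i) z)"
  proof (rule C_on_psum[OF piecewise_Pq[OF q, unfolded Pq_def]])
    fix i z assume i: "i \<in> idx" and z: "z \<in> \<Psi>"
    consider "i = {}" | "i \<in> IE" "i \<noteq> {}" | v where "i = {v}" "v \<in> BV" using i empty_notin_IE unfolding idx_def by blast
    thus "isCont (theta i) z \<or> vanish \<mu> (JJ q i) z"
    proof cases
      case 1
      thus ?thesis by (simp add: theta_def)
    next
      case 2
      show ?thesis
      proof (cases "z \<in> seg i")
        case True
        have "L (le i) ^ Suc \<mu> dvd JJ q i" using 2 by (simp add: JJ_def Jq_def)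
        from vanish_power[OF L_zero_edge[OF 2(1) True] this] show ?thesis by blast
      next
        case False
        have "i \<in> \<Delta>" using 2(1) IE_subset by blast
        thus ?thesis using isCont_winding[OF _ False] 2 by (simp add: theta_def)
      qed
    next
      case (3 v)
      have "isCont (Lg v) z" using Lg(1)[OF 3(2)] z continuous_on_eq_continuous_at[OF open_domain] by blast
      hence "isCont (\<lambda>z. - Im (Lg v z) / (2 * pi)) z" by (intro continuous_intros) auto
      thus ?thesis using 3(1) singleton_notin_IE by (simp add: theta_def)
    qed
  qed
  thus "C_on \<mu> \<Psi> (spline_of q)"
    by (subst C_on_cong[OF open_domain, of "spline_of q"]) (auto simp: spline_of_def)
  fix \<psi> assume "\<psi> \<in> cells \<Psi> \<Delta>"
  hence \<psi>: "\<psi> \<noteq> {}" "\<psi> \<subseteq> Om" "connected \<psi>"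
    unfolding cells_eq using in_components_nonempty in_components_subset in_components_connected by blast+
  then obtain w0 where w0: "w0 \<in> \<psi>" by blast
  have "spline_of q z = poly2 (Pq q w0) z" if z: "z \<in> \<psi>" for z
  proof -
    have "z \<in> \<Psi>" using z \<psi>(2) unfolding Om_eq by blast
    moreover have "Pq q z = Pq q w0" by (rule piecewise_connected[OF piecewise_Pq[OF q] \<psi>(3,2) z w0])
    ultimately show ?thesis using spline_of_Pq[of z q] by simp
  qed
  thus "\<exists>p\<in>polys d. \<forall>z\<in>\<psi>. spline_of q z = poly2 p z" using Pq_polys[OF q] by blast
qed

text \<open>A zero spline has zero polynomials on all cells, hence zero jumps and zero cofactors on
  the edges; only the global polynomial is left, and it equals the spline.\<close>

lemma spline_of_kernel:
  assumes q: "q \<in> cofactors" "spline_of q = 0"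
  shows "q = 0"
proof -
  have P0: "Pq q w = 0" if w: "w \<in> Om" for w
  proof -
    obtain r where r: "r > 0" "ball w r \<subseteq> Om" by (rule openE[OF open_Om w])
    show ?thesis
    proof (rule poly2_zero_on_open[of "ball w r"])
      fix z assume z: "z \<in> ball w r"
      have "Pq q w = Pq q z" by (rule piecewiseD[OF piecewise_Pq[OF q(1)] convex_ball r(2)]) (use r(1) z in auto)
      moreover have "z \<in> \<Psi>" using z r(2) unfolding Om_eq by blast
      ultimately show "poly2 (Pq q w) z = 0" using spline_of_Pq[of z q] q(2) by simp
    qed (use r(1) in auto)
  qed
  have q0: "q e = 0" if e: "e \<in> IE" for e
  proof -
    have eD: "e \<in> \<Delta>" using e IE_subset by blast
    obtain pl pr where s: "sides (Pq q) e pl pr" by (rule sides_exist[OF piecewise_Pq[OF q(1)] e])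
    obtain z where z: "z \<in> open_segment (lo e) (hi e)" using lo_ne_hi[OF eD] by (metis open_segment_eq_empty ex_in_conv)
    have "z \<in> seg e" using z unfolding seg_eq[OF eD] open_segment_def by blast
    hence sz: "side e z = 0" by (rule side_seg[OF eD])
    obtain r where r: "r > 0" "\<forall>w\<in>ball z r. (0 < side e w \<longrightarrow> w \<in> Om \<and> Pq q w = pl) \<and> (side e w < 0 \<longrightarrow> w \<in> Om \<and> Pq q w = pr)"
      using s z unfolding sides_def by blast
    obtain a b where "a \<in> ball z r" "0 < side e a" "b \<in> ball z r" "side e b < 0" using side_pts[OF eD r(1) sz] by blast
    with r(2) have "a \<in> Om \<and> Pq q a = pl" "b \<in> Om \<and> Pq q b = pr" by simp_all
    hence "pl = 0" "pr = 0" using P0[of a] P0[of b] by simp_all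
    hence "Jq q e = 0" using jump_Pq[OF e s] by simp
    thus ?thesis using L_nonzero[OF le_in[OF e]] by (simp add: Jq_def)
  qed
  obtain w where w: "w \<in> Om" using Om_nonempty by blast
  have "Jq q e = 0" if "e \<in> IE" for e using q0[OF that] by (simp add: Jq_def)
  hence "poly2 (Pq q w) x = poly2 (q {}) x" for x unfolding poly2_Pq cq_def by simp
  hence "q {} = 0" using P0[OF w] poly2_eqI[of "q {}" 0] by simp
  hence "q e = 0" for e using q(1) q0 unfolding cofactors_def by (cases "e \<in> insert {} IE") auto
  thus ?thesis by (simp add: fun_eq_iff)
qed

lemma cell_polys:
  assumes f: "f \<in> spline_space d \<mu> \<Psi> \<Delta>"
  obtains P where "piecewise P" "\<And>w. w \<in> Om \<Longrightarrow> P w \<in> polys d" "\<And>w. w \<in> Om \<Longrightarrow> f w = poly2 (P w) w"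
proof -
  \<comment> \<open>The choice depends on \<open>w\<close> only through its component, so it agrees
    at all points of a cell.\<close>
  define P where "P w = (SOME p. p \<in> polys d \<and> (\<forall>z\<in>connected_component_set Om w. f z = poly2 p z))" for w
  have P: "P w \<in> polys d \<and> (\<forall>z\<in>connected_component_set Om w. f z = poly2 (P w) z)" if "w \<in> Om" for w
  proof -
    have "connected_component_set Om w \<in> cells \<Psi> \<Delta>" unfolding cells_eq components_def using that by blast
    hence "\<exists>p. p \<in> polys d \<and> (\<forall>z\<in>connected_component_set Om w. f z = poly2 p z)"
      using f unfolding spline_space_def by blast
    thus ?thesis unfolding P_def by (rule someI_ex)
  qed
  have "piecewise P" unfolding piecewise_def
  proof (intro allI impI ballI)
    fix C w w' assume C: "convex C \<and> C \<subseteq> Om" and w: "w \<in> C" "w' \<in> C"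
    have "connected_component Om w w'" unfolding connected_component_def using C w convex_connected by blast
    hence "connected_component_set Om w = connected_component_set Om w'"
      using connected_component_eq by (metis mem_Collect_eq)
    thus "P w = P w'" unfolding P_def by simp
  qed
  moreover have "f w = poly2 (P w) w" if "w \<in> Om" for w
    using P[OF that] connected_component_refl[OF that] by blast
  ultimately show ?thesis using that P by blast
qed

text \<open>The jumps of \<open>f\<close> determine cofactors on the edges, and the vertex
  conditions for them come from going around each vertex. Subtracting the piecewise polynomial built
  from these cofactors removes all jumps, so a single polynomial remains, which becomes the global
  term.\<close>

lemma spline_in_image:
  assumes f: "f \<in> spline_space d \<mu> \<Psi> \<Delta>"
  shows "f \<in> spline_of ` cofactors"
proof -
  obtain P where P: "piecewise P" "\<And>w. w \<in> Om \<Longrightarrow> P w \<in> polys d" "\<And>w. w \<in> Om \<Longrightarrow> f w = poly2 (P w) w"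
    by (rule cell_polys[OF f]) blast
  have Cf: "C_on \<mu> \<Psi> f" and f0: "\<And>z. z \<notin> \<Psi> \<Longrightarrow> f z = 0" using f unfolding spline_space_def by auto
  have "\<exists>x. e \<in> IE \<longrightarrow> sides P e (fst x) (snd x)" for e
  proof (cases "e \<in> IE")
    case True
    obtain pl pr where "sides P e pl pr" by (rule sides_exist[OF P(1) True])
    thus ?thesis by (intro exI[of _ "(pl, pr)"]) simp
  qed simp
  then obtain \<beta> where \<beta>: "\<And>e. e \<in> IE \<Longrightarrow> sides P e (fst (\<beta> e)) (snd (\<beta> e))" by metis
  define pl where "pl e = fst (\<beta> e)" for e
  define pr where "pr e = snd (\<beta> e)" for e
  have sd: "sides P e (pl e) (pr e)" if "e \<in> IE" for e using \<beta>[OF that] unfolding pl_def pr_def .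
  have "\<exists>Q. e \<in> IE \<longrightarrow> Q \<in> polys K \<and> pl e - pr e = Q * L (le e) ^ (\<mu> + 1)" for e
  proof (cases "e \<in> IE")
    case True
    have eD: "e \<in> \<Delta>" using True IE_subset by blast
    obtain a b c where L: "L (le e) = [:[:a, b:], [:c:]:]" "b \<noteq> 0 \<or> c \<noteq> 0" by (rule L_form[OF le_in[OF True]])
    have "L (le e) ^ Suc \<mu> dvd pl e - pr e"
    proof (rule C_on_imp_dvd[OF True L _ Cf])
      show "poly2 (L (le e)) z = 0" if "z \<in> open_segment (lo e) (hi e)" for z
        by (rule L_zero_edge[OF True]) (use that in \<open>simp add: seg_eq[OF eD] open_segment_def\<close>)
      fix z assume "z \<in> open_segment (lo e) (hi e)"
      then obtain r where r: "r > 0" "ball z r \<subseteq> \<Psi>" "\<forall>w\<in>ball z r. (0 < side e w \<longrightarrow> w \<in> Om \<and> P w = pl e) \<and> (side e w < 0 \<longrightarrow> w \<in> Om \<and> P w = pr e)"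
        using sd[OF True] unfolding sides_def by blast
      show "\<exists>r>0. ball z r \<subseteq> \<Psi> \<and> (\<forall>w\<in>ball z r. (0 < side e w \<longrightarrow> f w = poly2 (pl e) w) \<and> (side e w < 0 \<longrightarrow> f w = poly2 (pr e) w))"
        using r P(3) by (intro exI[of _ r]) auto
    qed
    then obtain Q where Q: "pl e - pr e = L (le e) ^ Suc \<mu> * Q" by (rule dvdE)
    have "pl e \<in> polys d" "pr e \<in> polys d"
    proof -
      obtain z where z: "z \<in> open_segment (lo e) (hi e)" using lo_ne_hi[OF eD] by (metis open_segment_eq_empty ex_in_conv)
      have "z \<in> seg e" using z unfolding seg_eq[OF eD] open_segment_def by blast
      hence sz: "side e z = 0" by (rule side_seg[OF eD])
      obtain r where r: "r > 0" "\<forall>w\<in>ball z r. (0 < side e w \<longrightarrow> w \<in> Om \<and> P w = pl e) \<and> (side e w < 0 \<longrightarrow> w \<in> Om \<and> P w = pr e)"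
        using sd[OF True] z unfolding sides_def by blast
      obtain a b where "a \<in> ball z r" "0 < side e a" "b \<in> ball z r" "side e b < 0" using side_pts[OF eD r(1) sz] by blast
      with r(2) have "a \<in> Om \<and> P a = pl e" "b \<in> Om \<and> P b = pr e" by simp_all
      thus "pl e \<in> polys d" "pr e \<in> polys d" using P(2)[of a] P(2)[of b] by simp_all
    qed
    hence "L (le e) ^ Suc \<mu> * Q \<in> polys d" unfolding Q[symmetric] by (rule polys_diff)
    moreover have "d = K + Suc \<mu>" using md by (simp add: K_def)
    ultimately have "Q \<in> polys K" using polys_linear_power_cancel[OF L, of "Suc \<mu>" Q K] by simp
    thus ?thesis using Q by (intro exI[of _ Q]) (simp add: mult.commute)
  qed simp
  then obtain Q where Q: "\<And>e. e \<in> IE \<Longrightarrow> Q e \<in> polys K" "\<And>e. e \<in> IE \<Longrightarrow> pl e - pr e = Q e * L (le e) ^ (\<mu> + 1)" by metis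
  \<comment> \<open>The global polynomial p is left open: the family is used with p = 0 first, and
    the p that is needed is found by comparison with \<open>P\<close>.\<close>
  define q where "q p e = (if e \<in> IE then Q e else if e = {} then p else 0)" for p e
  have Jq: "Jq (q p) e = pl e - pr e" if "e \<in> IE" for p e using Q(2)[OF that] that by (simp add: Jq_def q_def)
  have cq: "cq (q p) v = (\<Sum>e\<in>{e \<in> IE. hi e = v}. pl e - pr e) - (\<Sum>e\<in>{e \<in> IE. lo e = v}. pl e - pr e)" for p v
    unfolding cq_def using Jq by (intro arg_cong2[where f = minus] sum.cong) auto
  have qC: "q p \<in> cofactors" if p: "p \<in> polys d" for p
    unfolding cofactors_def
  proof (intro CollectI conjI ballI allI impI)
    show "q p {} \<in> polys d" using p empty_notin_IE by (simp add: q_def)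
    show "q p e \<in> polys K" if "e \<in> IE" for e using Q(1)[OF that] that by (simp add: q_def)
    show "q p e = 0" if "e \<notin> insert {} IE" for e using that by (simp add: q_def)
    fix A assume A: "A \<in> IV"
    have "jumps (q p) A l \<in> polys K" for l
      unfolding jumps_def jump_def using Q(1) edges_of_IE
      by (auto intro!: polys_diff polys_sum simp: q_def)
    moreover have "jumps (q p) A l = 0" if "\<not> (l \<in> LE \<and> A \<in> l)" for l using that by (auto simp: jumps_def)
    moreover have "cq (q p) A = 0"
      using vertex_condition[OF P(1) sd A] unfolding cq by (simp add: algebra_simps)
    hence "(\<Sum>l | l \<in> LE \<and> A \<in> l. jumps (q p) A l * L l ^ (\<mu> + 1)) = 0"
      unfolding vertex_sum[OF A] by simp
    ultimately show "jumps (q p) A \<in> W A" unfolding conformality_space_def K_def by simp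
  qed
  have q0: "q 0 \<in> cofactors" by (rule qC) simp
  have pwD: "piecewise (\<lambda>w. P w - Pq (q 0) w)"
    unfolding piecewise_def
  proof (intro allI impI ballI)
    fix C w w' assume C: "convex C \<and> C \<subseteq> Om" and w: "w \<in> C" "w' \<in> C"
    have "P w = P w'" "Pq (q 0) w = Pq (q 0) w'"
      using piecewiseD[OF P(1) _ _ w] piecewiseD[OF piecewise_Pq[OF q0] _ _ w] C by blast+
    thus "P w - Pq (q 0) w = P w' - Pq (q 0) w'" by simp
  qed
  have "\<exists>p. sides (\<lambda>w. P w - Pq (q 0) w) e p p" if e: "e \<in> IE" for e
  proof -
    obtain a b where s: "sides (Pq (q 0)) e a b" by (rule sides_exist[OF piecewise_Pq[OF q0] e])
    have "a - b = pl e - pr e" using jump_Pq[OF e s] Jq[OF e] by simp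
    hence "pl e - a = pr e - b" by (simp add: algebra_simps)
    thus ?thesis using sides_diff[OF sd[OF e] s] by metis
  qed
  then obtain p where p: "\<And>w. w \<in> Om \<Longrightarrow> P w - Pq (q 0) w = p" by (rule no_jump_const[OF pwD]) blast+
  obtain w0 where "w0 \<in> Om" using Om_nonempty by blast
  hence pp: "p \<in> polys d" using p P(2) Pq_polys[OF q0] polys_diff by metis
  have PqP: "Pq (q p) w = P w" if w: "w \<in> Om" for w
  proof (rule poly2_eqI)
    fix x
    have "poly2 (Pq (q p) w) x = poly2 p x + poly2 (Pq (q 0) w) x"
      unfolding poly2_Pq cq using Jq empty_notin_IE by (simp add: q_def)
    also have "\<dots> = poly2 (P w) x" using p[OF w, symmetric] by simp
    finally show "poly2 (Pq (q p) w) x = poly2 (P w) x" .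
  qed
  have Xs: "spline_of (q p) \<in> spline_space d \<mu> \<Psi> \<Delta>" by (rule spline_of_spline[OF qC[OF pp]])
  have "f z = spline_of (q p) z" for z
  proof (cases "z \<in> \<Psi>")
    case True
    show ?thesis
    proof (rule eq_on_domain[OF C_on_continuous[OF Cf] _ _ True])
      show "continuous_on \<Psi> (spline_of (q p))" using Xs C_on_continuous unfolding spline_space_def by blast
      fix w assume w: "w \<in> Om"
      hence "w \<in> \<Psi>" unfolding Om_eq by blast
      thus "f w = spline_of (q p) w" using spline_of_Pq[of w "q p"] PqP[OF w] P(3)[OF w] by simp
    qed
  next
    case False
    thus ?thesis using f0 by (simp add: spline_of_def)
  qed
  hence "f = spline_of (q p)" by (simp add: fun_eq_iff)
  thus ?thesis using imageI[OF qC[OF pp], of spline_of] by simp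
qed

lemma dim_spline_space: "funs.dim (spline_space d \<mu> \<Psi> \<Delta>) = families.dim cofactors"
proof -
  interpret ff: vector_space_pair fsc "\<lambda>(c::real) (f :: point \<Rightarrow> real) z. c * f z"
    by (simp add: vector_space_pair_def vs_fsc funs.vector_space_axioms)
  have im: "spline_space d \<mu> \<Psi> \<Delta> = spline_of ` cofactors"
    using spline_in_image spline_of_spline by blast
  have inj: "inj_on spline_of cofactors"
  proof (rule inj_onI)
    fix p q assume pq: "p \<in> cofactors" "q \<in> cofactors" "spline_of p = spline_of q"
    have "p - q \<in> cofactors" by (rule families.subspace_diff[OF subspace_cofactors pq(1,2)])
    moreover have "spline_of (p - q) = 0" unfolding ff.linear_diff[OF linear_spline_of] using pq(3) by simp
    ultimately have "p - q = 0" by (rule spline_of_kernel)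
    thus "p = q" by simp
  qed
  show ?thesis unfolding im by (rule ff.dim_image_inj[OF linear_spline_of subspace_cofactors inj])
qed

end

theorem theorem3p1:
  fixes \<Psi> :: "(real \<times> real) set" and \<Delta> :: "(real \<times> real) set set"
    and d \<mu> :: nat
    and L :: "(real \<times> real) set \<Rightarrow> real poly poly"
    and M :: "real mat"
  assumes "\<mu> < d"
    and "simply_connected \<Psi>"
    and "rectilinear_partition \<Psi> \<Delta>"
    and "line_polys \<Psi> \<Delta> L"
    and "conformality_matrix d \<mu> \<Psi> \<Delta> L M"
  shows "int (funs.dim (spline_space d \<mu> \<Psi> \<Delta>)) =
    int ((d + 2) choose 2)
    + int (card (cross_cuts \<Psi> \<Delta>)) * int ((d - \<mu> + 1) choose 2)
    + (\<Sum>A\<in>interior_vertices \<Psi> \<Delta>. k_dim d \<mu> (num_directions \<Delta> A))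
    - int (vec_space.rank (dim_row M) M)"
proof -
  interpret simply_connected_conformality \<Psi> \<Delta> L d \<mu>
    using assms(1-4) by unfold_locales
  show ?thesis
    unfolding dim_spline_space dim_cofactors rank_conformality_matrix[OF assms(5)] ..
qed

end
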